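(* Let $0<\alpha\le0.2$ and let $\mathcal{F}_1\subset\mathcal{F}_2\subset\cdots\subset\mathcal{F}_k$ be a finite or countably infinite nested collection of convex parameter spaces (when $k=\infty$, $\mathcal{F}_\infty=\bigcup_{i\ge1}\mathcal{F}_i$). Let $CI^*=CI^*_{\hat j}$ be the confidence interval defined in the context, built along the subsequence $j_1<j_2<\cdots<j_m$. Then $CI^*$ has coverage probability of at least $1-\alpha$ for all $f\in\mathcal{F}_k$, that is, $CI^*\in\mathcal{I}_{\alpha,\mathcal{F}_k}$, and $$L^*_\alpha(\mathcal{F}_j,\mathcal{F}_k)\ \le\ L(CI^*,\mathcal{F}_j)\ \le\ \frac{16\,z_{\alpha/2}}{(1/2-\alpha)\,z_\alpha}\,L^*_\alpha(\mathcal{F}_j,\mathcal{F}_k)$$ simultaneously for all $1\le j\le k$. Moreover, $$L(CI^*,\mathcal{F}_{j_i})\ \le\ 8\,\omega_+\Big(\frac{z_{\alpha/2}}{\sqrt n},\mathcal{F}_{j_i},\mathcal{F}_k\Big)\qquad\text{for all }1\le i\le m,$$ and $$L(CI^*,\mathcal{F}_j)\ \le\ 16\,\omega_+\Big(\frac{z_{\alpha/2}}{\sqrt n},\mathcal{F}_j,\mathcal{F}_k\Big)\qquad\text{for all }1\le j\le k.$$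
   Context: Model. One observes, for a given $n$, either the white noise model $dY(t)=f(t)\,dt+n^{-1/2}\,dW(t)$, $-\frac12\le t\le\frac12$, with $W$ standard Brownian motion, or the Gaussian sequence model $Y(i)=f(i)+n^{-1/2}z_i$, $i\in\mathcal{M}$, with $z_i$ i.i.d. standard normal and $\mathcal{M}$ a finite or countably infinite index set. The result is for either model. $P_f,E_f$ denote probability and expectation when $f$ is the truth. $\|\cdot\|_2$ is the $L_2(-\frac12,\frac12)$ norm, respectively the $\ell_2(\mathcal{M})$ norm. A parameter space is a (nonempty) set of possible $f$, and $T$ is a linear functional. Confidence intervals. A confidence interval $CI$ is a data-dependent interval, with length $L(CI)$. $\mathcal{I}_{\alpha,\mathcal{F}}$ is the collection of all confidence intervals with $\inf_{f\in\mathcal{F}}P_f(Tf\in CI)\ge1-\alpha$. $L(CI,\mathcal{G})=\sup_{f\in\mathcal{G}}E_f(L(CI))$ and $L_\alpha^*(\mathcal{G},\mathcal{F})=\inf_{CI\in\mathcal{I}_{\alpha,\mathcal{F}}}L(CI,\mathcal{G})$. Moduli. $\omega(\varepsilon,\mathcal{F},\mathcal{G})=\sup\{Tg-Tf:\|g-f\|_2\le\varepsilon,\ f\in\mathcal{F},\ g\in\mathcal{G}\}$ and $\omega_+(\varepsilon,\mathcal{F},\mathcal{G})=\max\{\omega(\varepsilon,\mathcal{F},\mathcal{G}),\omega(\varepsilon,\mathcal{G},\mathcal{F})\}$. $z_\alpha=\Phi^{-1}(1-\alpha)$, with $\Phi$ the standard normal distribution function. Construction. A linear estimator has the form $c+\int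 h\,dY$, respectively $c+\sum_i h(i)Y(i)$, with $c$ constant and $h$ square integrable/summable. Put $\omega_{i,j}=\omega(z_{\alpha/2}/\sqrt n,\mathcal{F}_i,\mathcal{F}_j)$ and let $\hat T_{i,j}$ be a linear estimator with $$\mathrm{Var}(\hat T_{i,j})\le\frac{\omega_{i,j}^2}{z_{\alpha/2}^2},\quad \inf_{f\in\mathcal{F}_j}(E_f\hat T_{i,j}-Tf)\ge-\tfrac12\omega_{i,j},\quad \sup_{f\in\mathcal{F}_i}(E_f\hat T_{i,j}-Tf)\le\tfrac12\omega_{i,j}.$$ (Such estimators are known to exist, by earlier work.) Put $\xi_j=\omega_+(z_{\alpha/2}/\sqrt n,\mathcal{F}_j,\mathcal{F}_k)$, which is nondecreasing in $j$ and is taken to be positive (and finite for each index used), and, with $x_+=\max(x,0)$, $$CI^*_j=\Big[\tfrac{\hat T_{j,k}+\hat T_{k,j}}2-\{(\hat T_{j,k}-\hat T_{k,j})_++2\xi_j\},\ \tfrac{\hat T_{j,k}+\hat T_{k,j}}2+\{(\hat T_{j,k}-\hat T_{k,j})_++2\xi_j\}\Big].$$ Let $j_1<j_2<\cdots<j_m$, with $j_m=k$, be the subsequence of indices such that, with $j_0=0$ and $\xi_0=0$, for all $1\le i\le m$: $\xi_{j_i}\ge2\xi_{j_{i-1}}$, and $\xi_{j_i}<2\xi_j$ for all $j_{i-1}<j<j_i$. (For finite $k$ this subsequence exists and is unique. For $k=\infty$: if $\xi_\infty<\infty$ the subsequence is finite and ends at $j_m=\infty$; if $\xi_\infty=\infty$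 it is an infinite sequence of positive integers with the same two properties, i.e. $m=\infty$, and $j$ ranges over the positive integers.) Let $\hat j=\arg\min_{j_i,\,1\le i\le m}L(CI^*_{j_i})$ be the index of the shortest interval among the $CI^*_{j_i}$, and set $CI^*=CI^*_{\hat j}$. *)

theory Defs
  imports "HOL-Probability.Probability" "HOL-Library.Extended_Nat"
begin

section \<open>The two Gaussian models\<close>

text \<open>
  A parameter is a function on the space of a base measure: Lebesgue measure on the unit interval
  \<^term>\<open>{-1/2..1/2::real}\<close> for white noise, counting measure on the index set for the
  sequence model.  Parameters and observations are total functions in HOL; parameters are
  normalised to be 0 outside the space of the base measure.  A parameter is a function, not a
  class of functions modulo null sets, so that point evaluations are admissible functionals.
\<close>

definition L2 :: "'i measure \<Rightarrow> ('i \<Rightarrow> real) set" where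
  "L2 \<nu> = {f. f \<in> borel_measurable \<nu> \<and> integrable \<nu> (\<lambda>t. (f t)\<^sup>2) \<and>
               (\<forall>t. t \<notin> space \<nu> \<longrightarrow> f t = 0)}"

definition L2_dist :: "'i measure \<Rightarrow> ('i \<Rightarrow> real) \<Rightarrow> ('i \<Rightarrow> real) \<Rightarrow> real" where
  "L2_dist \<nu> f g = sqrt (integral\<^sup>L \<nu> (\<lambda>t. (g t - f t)\<^sup>2))"

text \<open>
  \<open>law M f\<close> is the distribution of the observation when \<open>f\<close> is the truth; data-dependent
  quantities are functions of the observation.
\<close>

record 'i gaussian_model =
  base :: "'i measure"
  law :: "('i \<Rightarrow> real) \<Rightarrow> ('i \<Rightarrow> real) measure"
  linear_estimators :: "(('i \<Rightarrow> real) \<Rightarrow> real) set"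

definition obs :: "'i measure \<Rightarrow> ('i \<Rightarrow> real) measure" where
  "obs \<nu> = PiM (space \<nu>) (\<lambda>_. borel)"

definition seq_law :: "nat \<Rightarrow> 'i set \<Rightarrow> ('i \<Rightarrow> real) \<Rightarrow> ('i \<Rightarrow> real) measure" where
  "seq_law n I f =
     distr (PiM I (\<lambda>_. std_normal_distribution)) (obs (count_space I))
       (\<lambda>z. \<lambda>i\<in>I. f i + z i / sqrt (real n))"

text \<open>
  For infinite \<open>I\<close> the series \<open>c + (\<Sum>i. h i * y i)\<close> is understood as a limit in quadratic mean,
  along the finite subsets of \<open>I\<close>; the limit is determined up to null sets.
\<close>

definition seq_linear :: "nat \<Rightarrow> 'i set \<Rightarrow> (('i \<Rightarrow> real) \<Rightarrow> real) set" where
  "seq_linear n I = {X \<in> borel_measurable (obs (count_space I)).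
     \<exists>c. \<exists>h \<in> L2 (count_space I). \<forall>f \<in> L2 (count_space I).
       ((\<lambda>A. \<integral>\<^sup>+ y. ennreal ((X y - (c + (\<Sum>i\<in>A. h i * y i)))\<^sup>2) \<partial>seq_law n I f) \<longlongrightarrow> 0)
         (finite_subsets_at_top I)}"

definition sequence_model :: "nat \<Rightarrow> 'i set \<Rightarrow> 'i gaussian_model" where
  "sequence_model n I = \<lparr>base = count_space I, law = seq_law n I, linear_estimators = seq_linear n I\<rparr>"

abbreviation unit_interval :: "real set" where
  "unit_interval \<equiv> {-1/2..1/2}"

definition brownian_motion :: "'w measure \<Rightarrow> (real \<Rightarrow> 'w \<Rightarrow> real) \<Rightarrow> bool" where
  "brownian_motion \<Omega> W \<longleftrightarrow>
     prob_space \<Omega> \<and>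
     (\<forall>t\<in>unit_interval. W t \<in> borel_measurable \<Omega>) \<and>
     (AE x in \<Omega>. W (-1/2) x = 0) \<and>
     (\<forall>s\<in>unit_interval. \<forall>t\<in>unit_interval. s < t \<longrightarrow>
        distributed \<Omega> lborel (\<lambda>x. W t x - W s x) (normal_density 0 (sqrt (t - s)))) \<and>
     (\<forall>r \<tau>. \<tau> ` {..r::nat} \<subseteq> unit_interval \<and> mono_on {..r} \<tau> \<longrightarrow>
        prob_space.indep_vars \<Omega> (\<lambda>_. borel) (\<lambda>i x. W (\<tau> (Suc i)) x - W (\<tau> i) x) {..<r}) \<and>
     (AE x in \<Omega>. continuous_on unit_interval (\<lambda>t. W t x))"

text \<open>
  The observed path is \<open>Y t = \<integral>\<^bsub>-1/2\<^esub>\<^bsup>t\<^esup> f + n\<^bsup>-1/2\<^esup> W t\<close>.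
\<close>

definition wn_law ::
    "nat \<Rightarrow> 'w measure \<Rightarrow> (real \<Rightarrow> 'w \<Rightarrow> real) \<Rightarrow> (real \<Rightarrow> real) \<Rightarrow> (real \<Rightarrow> real) measure" where
  "wn_law n \<Omega> W f =
     distr \<Omega> (obs (lebesgue_on unit_interval))
       (\<lambda>x. \<lambda>t\<in>unit_interval. integral\<^sup>L (lebesgue_on {-1/2..t}) f + W t x / sqrt (real n))"

text \<open>
  A list of triples \<open>(a, b, v)\<close> stands for the step function that is the sum of the functions
  \<open>v * indicator {a<..b}\<close>.  The integral of a general square integrable function with respect
  to the observed path is the limit in quadratic mean of the integrals of approximating step
  functions.
\<close>

definition valid_steps :: "(real \<times> real \<times> real) list \<Rightarrow> bool" where
  "valid_steps s \<longleftrightarrow> (\<forall>(a, b, v) \<in> set s. -1/2 \<le> a \<and> a \<le> b \<and> b \<le> 1/2)"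

definition step_fun :: "(real \<times> real \<times> real) list \<Rightarrow> real \<Rightarrow> real" where
  "step_fun s t = (\<Sum>(a, b, v) \<leftarrow> s. v * indicator {a<..b} t)"

definition step_integral :: "(real \<times> real \<times> real) list \<Rightarrow> (real \<Rightarrow> real) \<Rightarrow> real" where
  "step_integral s y = (\<Sum>(a, b, v) \<leftarrow> s. v * (y b - y a))"

definition wn_linear ::
    "nat \<Rightarrow> 'w measure \<Rightarrow> (real \<Rightarrow> 'w \<Rightarrow> real) \<Rightarrow> ((real \<Rightarrow> real) \<Rightarrow> real) set" where
  "wn_linear n \<Omega> W = {X \<in> borel_measurable (obs (lebesgue_on unit_interval)).
     \<exists>c. \<exists>h \<in> L2 (lebesgue_on unit_interval). \<exists>s.
       (\<forall>r. valid_steps (s r)) \<and>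
       (\<lambda>r. L2_dist (lebesgue_on unit_interval) h (step_fun (s r))) \<longlonglongrightarrow> 0 \<and>
       (\<forall>f \<in> L2 (lebesgue_on unit_interval).
          (\<lambda>r. \<integral>\<^sup>+ y. ennreal ((X y - (c + step_integral (s r) y))\<^sup>2) \<partial>wn_law n \<Omega> W f)
            \<longlonglongrightarrow> 0)}"

definition white_noise_model ::
    "nat \<Rightarrow> 'w measure \<Rightarrow> (real \<Rightarrow> 'w \<Rightarrow> real) \<Rightarrow> real gaussian_model" where
  "white_noise_model n \<Omega> W =
     \<lparr>base = lebesgue_on unit_interval, law = wn_law n \<Omega> W, linear_estimators = wn_linear n \<Omega> W\<rparr>"

definition mean :: "'i gaussian_model \<Rightarrow> ('i \<Rightarrow> real) \<Rightarrow> (('i \<Rightarrow> real) \<Rightarrow> real) \<Rightarrow> real" where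
  "mean M f X = integral\<^sup>L (law M f) X"

definition var :: "'i gaussian_model \<Rightarrow> ('i \<Rightarrow> real) \<Rightarrow> (('i \<Rightarrow> real) \<Rightarrow> real) \<Rightarrow> real" where
  "var M f X = integral\<^sup>L (law M f) (\<lambda>y. (X y - mean M f X)\<^sup>2)"

text \<open>\<open>z_quantile a\<close> is \<open>z\<^sub>a\<close>, the upper \<open>a\<close>-quantile of the standard normal distribution.\<close>

definition z_quantile :: "real \<Rightarrow> real" where
  "z_quantile a = inv (cdf std_normal_distribution) (1 - a)"


section \<open>Confidence intervals and moduli\<close>

definition conf_intervals ::
    "'i gaussian_model \<Rightarrow> (('i \<Rightarrow> real) \<Rightarrow> real) \<Rightarrow> real \<Rightarrow> ('i \<Rightarrow> real) set
       \<Rightarrow> (('i \<Rightarrow> real) \<Rightarrow> real set) set" where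
  "conf_intervals M T \<alpha> F = {CI.
     (\<forall>y \<in> space (obs (base M)). is_interval (CI y)) \<and>
     (\<forall>x. {y \<in> space (obs (base M)). x \<in> CI y} \<in> sets (obs (base M))) \<and>
     (\<lambda>y. emeasure lborel (CI y)) \<in> borel_measurable (obs (base M)) \<and>
     (\<forall>f \<in> F. measure (law M f) {y \<in> space (obs (base M)). T f \<in> CI y} \<ge> 1 - \<alpha>)}"

definition max_length ::
    "'i gaussian_model \<Rightarrow> (('i \<Rightarrow> real) \<Rightarrow> real set) \<Rightarrow> ('i \<Rightarrow> real) set \<Rightarrow> ennreal" where
  "max_length M CI G = (SUP f\<in>G. \<integral>\<^sup>+ y. emeasure lborel (CI y) \<partial>law M f)"

definition minimax_length ::
    "'i gaussian_model \<Rightarrow> (('i \<Rightarrow> real) \<Rightarrow> real) \<Rightarrow> real \<Rightarrow> ('i \<Rightarrow> real) set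
       \<Rightarrow> ('i \<Rightarrow> real) set \<Rightarrow> ennreal" where
  "minimax_length M T \<alpha> G F = (INF CI \<in> conf_intervals M T \<alpha> F. max_length M CI G)"

definition modulus ::
    "'i gaussian_model \<Rightarrow> (('i \<Rightarrow> real) \<Rightarrow> real) \<Rightarrow> real \<Rightarrow> ('i \<Rightarrow> real) set
       \<Rightarrow> ('i \<Rightarrow> real) set \<Rightarrow> ereal" where
  "modulus M T \<epsilon> F G =
     Sup {ereal (T g - T f) | f g. L2_dist (base M) f g \<le> \<epsilon> \<and> f \<in> F \<and> g \<in> G}"

definition modulus_plus ::
    "'i gaussian_model \<Rightarrow> (('i \<Rightarrow> real) \<Rightarrow> real) \<Rightarrow> real \<Rightarrow> ('i \<Rightarrow> real) set
       \<Rightarrow> ('i \<Rightarrow> real) set \<Rightarrow> ereal" where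
  "modulus_plus M T \<epsilon> F G = max (modulus M T \<epsilon> F G) (modulus M T \<epsilon> G F)"


section \<open>Nested parameter spaces and the adaptive interval\<close>

text \<open>Function types carry no real vector space instance, hence the pointwise formulations.\<close>

definition convex_space :: "('i \<Rightarrow> real) set \<Rightarrow> bool" where
  "convex_space F \<longleftrightarrow>
     (\<forall>f\<in>F. \<forall>g\<in>F. \<forall>u::real. 0 \<le> u \<and> u \<le> 1 \<longrightarrow> (\<lambda>t. u * f t + (1 - u) * g t) \<in> F)"

definition linear_functional_on :: "('i \<Rightarrow> real) set \<Rightarrow> (('i \<Rightarrow> real) \<Rightarrow> real) \<Rightarrow> bool" where
  "linear_functional_on D T \<longleftrightarrow>
     (\<lambda>_. 0) \<in> D \<and>
     (\<forall>f\<in>D. \<forall>g\<in>D. \<forall>a b. (\<lambda>t. a * f t + b * g t) \<in> D \<and>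
        T (\<lambda>t. a * f t + b * g t) = a * T f + b * T g)"

definition nested_spaces ::
    "'i gaussian_model \<Rightarrow> enat \<Rightarrow> (enat \<Rightarrow> ('i \<Rightarrow> real) set) \<Rightarrow> bool" where
  "nested_spaces M k F \<longleftrightarrow>
     1 \<le> k \<and>
     (\<forall>j. 1 \<le> j \<and> j \<le> k \<longrightarrow> F j \<noteq> {} \<and> F j \<subseteq> L2 (base M) \<and> convex_space (F j)) \<and>
     (\<forall>i j. 1 \<le> i \<and> i \<le> j \<and> j \<le> k \<longrightarrow> F i \<subseteq> F j) \<and>
     (k = \<infinity> \<longrightarrow> F \<infinity> = (\<Union>i\<in>{1::nat..}. F (enat i)))"

text \<open>\<open>noise n \<alpha>\<close> is the argument at which all moduli are evaluated.\<close>

definition noise :: "nat \<Rightarrow> real \<Rightarrow> real" where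
  "noise n \<alpha> = z_quantile (\<alpha> / 2) / sqrt (real n)"

definition xi ::
    "'i gaussian_model \<Rightarrow> nat \<Rightarrow> real \<Rightarrow> (('i \<Rightarrow> real) \<Rightarrow> real) \<Rightarrow> enat
       \<Rightarrow> (enat \<Rightarrow> ('i \<Rightarrow> real) set) \<Rightarrow> enat \<Rightarrow> ereal" where
  "xi M n \<alpha> T k F j = (if j = 0 then 0 else modulus_plus M T (noise n \<alpha>) (F j) (F k))"

text \<open>
  The range of the index \<open>j\<close>: the top index \<open>\<infinity>\<close> drops out if its modulus is infinite.
\<close>

definition indices :: "(enat \<Rightarrow> ereal) \<Rightarrow> enat \<Rightarrow> enat set" where
  "indices \<xi> k = {j. 1 \<le> j \<and> j \<le> k \<and> (j = \<infinity> \<longrightarrow> \<xi> j \<noteq> \<infinity>)}"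

definition bias_variance_bounds ::
    "'i gaussian_model \<Rightarrow> nat \<Rightarrow> real \<Rightarrow> (('i \<Rightarrow> real) \<Rightarrow> real) \<Rightarrow> enat
       \<Rightarrow> (enat \<Rightarrow> ('i \<Rightarrow> real) set) \<Rightarrow> enat \<Rightarrow> enat \<Rightarrow> (('i \<Rightarrow> real) \<Rightarrow> real) \<Rightarrow> bool" where
  "bias_variance_bounds M n \<alpha> T k F i j X \<longleftrightarrow>
     (let \<omega> = modulus M T (noise n \<alpha>) (F i) (F j) in
        X \<in> linear_estimators M \<and>
        (\<forall>f \<in> F k. ereal (var M f X) \<le> \<omega>\<^sup>2 / ereal ((z_quantile (\<alpha> / 2))\<^sup>2)) \<and>
        (INF f \<in> F j. ereal (mean M f X - T f)) \<ge> - (\<omega> / 2) \<and>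
        (SUP f \<in> F i. ereal (mean M f X - T f)) \<le> \<omega> / 2)"

definition ci_star ::
    "(enat \<Rightarrow> ereal) \<Rightarrow> enat \<Rightarrow> (enat \<Rightarrow> enat \<Rightarrow> ('i \<Rightarrow> real) \<Rightarrow> real)
       \<Rightarrow> enat \<Rightarrow> ('i \<Rightarrow> real) \<Rightarrow> real set" where
  "ci_star \<xi> k That j y =
     (let c = (That j k y + That k j y) / 2;
          r = max (That j k y - That k j y) 0 + 2 * real_of_ereal (\<xi> j)
      in {c - r..c + r})"

text \<open>
  \<open>js 1 < js 2 < \<dots>\<close> is the subsequence of length \<open>m\<close>, and \<open>js 0 = 0\<close>.
\<close>

definition doubling_subsequence ::
    "(enat \<Rightarrow> ereal) \<Rightarrow> enat \<Rightarrow> enat \<Rightarrow> (nat \<Rightarrow> enat) \<Rightarrow> bool" where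
  "doubling_subsequence \<xi> k m js \<longleftrightarrow>
     js 0 = 0 \<and>
     (\<forall>i. 1 \<le> i \<and> enat i \<le> m \<longrightarrow>
        js (i - 1) < js i \<and> js i \<le> k \<and>
        \<xi> (js i) \<ge> 2 * \<xi> (js (i - 1)) \<and>
        (\<forall>j. js (i - 1) < j \<and> j < js i \<longrightarrow> \<xi> (js i) < 2 * \<xi> j)) \<and>
     (if k = \<infinity> \<and> \<xi> \<infinity> = \<infinity> then m = \<infinity> \<and> (\<forall>i. js i \<noteq> \<infinity>)
      else (\<exists>m'. m = enat m' \<and> js m' = k))"

text \<open>\<open>ihat y\<close> is the position in the subsequence of a shortest interval.  Ties may be broken
  in any measurable way.\<close>

definition shortest_selector ::
    "'i gaussian_model \<Rightarrow> (enat \<Rightarrow> ('i \<Rightarrow> real) \<Rightarrow> real set) \<Rightarrow> enat \<Rightarrow> (nat \<Rightarrow> enat)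
       \<Rightarrow> (('i \<Rightarrow> real) \<Rightarrow> nat) \<Rightarrow> bool" where
  "shortest_selector M CI m js ihat \<longleftrightarrow>
     ihat \<in> obs (base M) \<rightarrow>\<^sub>M count_space UNIV \<and>
     (\<forall>y \<in> space (obs (base M)). 1 \<le> ihat y \<and> enat (ihat y) \<le> m \<and>
        (\<forall>i. 1 \<le> i \<and> enat i \<le> m \<longrightarrow>
           emeasure lborel (CI (js (ihat y)) y) \<le> emeasure lborel (CI (js i) y)))"

definition adaptive_ci ::
    "(enat \<Rightarrow> ereal) \<Rightarrow> enat \<Rightarrow> (enat \<Rightarrow> enat \<Rightarrow> ('i \<Rightarrow> real) \<Rightarrow> real)
       \<Rightarrow> (nat \<Rightarrow> enat) \<Rightarrow> (('i \<Rightarrow> real) \<Rightarrow> nat) \<Rightarrow> ('i \<Rightarrow> real) \<Rightarrow> real set" where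
  "adaptive_ci \<xi> k That js ihat y = ci_star \<xi> k That (js (ihat y)) y"

locale adaptive_ci_setting =
  fixes M :: "'i gaussian_model" and n :: nat and \<alpha> :: real
    and D :: "('i \<Rightarrow> real) set" and T :: "('i \<Rightarrow> real) \<Rightarrow> real"
    and k :: enat and F :: "enat \<Rightarrow> ('i \<Rightarrow> real) set"
    and That :: "enat \<Rightarrow> enat \<Rightarrow> ('i \<Rightarrow> real) \<Rightarrow> real"
    and m :: enat and js :: "nat \<Rightarrow> enat" and ihat :: "('i \<Rightarrow> real) \<Rightarrow> nat"
  assumes nested: "nested_spaces M k F"
    and functional: "linear_functional_on D T" "F k \<subseteq> D"
    and xi_range: "\<And>j. j \<in> indices (xi M n \<alpha> T k F) k \<Longrightarrow>
          0 < xi M n \<alpha> T k F j \<and> xi M n \<alpha> T k F j < \<infinity>"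
    and estimators: "\<And>j. j \<in> indices (xi M n \<alpha> T k F) k \<Longrightarrow>
          bias_variance_bounds M n \<alpha> T k F j k (That j k) \<and>
          bias_variance_bounds M n \<alpha> T k F k j (That k j)"
    and subsequence: "doubling_subsequence (xi M n \<alpha> T k F) k m js"
    and selector: "shortest_selector M (ci_star (xi M n \<alpha> T k F) k That) m js ihat"

end

theory Submission
  imports Defs
begin

text \<open>
  Both models are families of Gaussian laws, and only their finite-dimensional distributions matter.
  An estimator is a limit in quadratic mean of finite linear forms, hence has a normal lower tail.

  The length bound needs only second moments: under \<open>f\<close> in \<open>F j\<close> the mean of \<open>That j k - That k j\<close> is at
  most \<open>\<xi> j\<close> and its standard deviation at most \<open>2 * \<xi> j / z\<close>.  A shortest interval is no longer than the
  one for the next index of the subsequence, whose \<open>\<xi>\<close> is at most twice as large.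

  For coverage, a union bound over the subsequence suffices.  Far above a critical scale, which depends on the
  true parameter, an interval is too long to be selected.  Far below it, the mean of \<open>That j k - That k j\<close> is
  large compared with \<open>\<xi> j\<close>, so the interval is too wide to miss.  Because the \<open>\<xi>\<close> at least double, these
  probabilities decay doubly exponentially away from the critical scale.

  The lower bound on the minimax length is the two-point argument: an interval covering over \<open>F k\<close> must contain
  both \<open>T f\<close> and \<open>T g\<close> with probability \<open>1/2 - \<alpha>\<close> if \<open>f\<close> and \<open>g\<close> are at distance at most
  \<open>z_quantile \<alpha> / sqrt n\<close>.  Convexity transfers this to the distance \<open>noise n \<alpha>\<close>.
\<close>

section \<open>The standard normal distribution\<close>

text \<open>The budget of the union bound is exactly \<open>\<alpha> = 2 * \<Phi> (- z)\<close>.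
  Every miss probability is therefore expressed as a multiple of \<open>\<Phi> (- z)\<close>, and
  the multiples have to add up to at most 2. For an interval at or next to the critical scale, the
  bias may use up \<open>\<xi> / 2\<close> of the guaranteed half width \<open>2 * \<xi>\<close>,
  which leaves \<open>\<Phi> (- (3/2) * z)\<close> for each side. The condition
  \<open>\<alpha> \<le> 1/5\<close> enters this estimate through \<open>8/5 \<le> z\<^sup>2\<close>,
  which makes each side cost at most \<open>exp (-1) * \<Phi> (- z)\<close>; the sum of all
  multiples then stays below 2 by a narrow margin.

  The correlation of \<open>That j k\<close> and \<open>That k j\<close> is unknown, and so is the
  joint behaviour of estimators with different \<open>j\<close>. Hence only linear combinations of
  two estimators with the same index occur, each through its mean, a bound for its variance and a
  one-sided tail.\<close>

abbreviation \<Phi> :: "real \<Rightarrow> real" where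
  "\<Phi> \<equiv> cdf std_normal_distribution"

lemma real_distribution_std_normal: "real_distribution std_normal_distribution"
  using real_dist_normal_dist by simp

lemma \<Phi>_mono: "x \<le> y \<Longrightarrow> \<Phi> x \<le> \<Phi> y"
  by (rule finite_borel_measure.cdf_nondecreasing
      [OF real_distribution.finite_borel_measure_M[OF real_distribution_std_normal]])

lemma \<Phi>_nonneg: "0 \<le> \<Phi> x"
  by (simp add: cdf_def)

lemma prob_normal_le:
  assumes "prob_space M" "0 < \<sigma>" and X: "distributed M lborel X (normal_density \<mu> \<sigma>)"
  shows "measure M {x \<in> space M. X x \<le> a} = \<Phi> ((a - \<mu>) / \<sigma>)"
proof -
  interpret prob_space M by fact
  have D: "distributed M lborel (\<lambda>x. (X x - \<mu>) / \<sigma>) std_normal_density"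
    using normal_standard_normal_convert[OF \<open>0 < \<sigma>\<close>, of X \<mu>] X by simp
  have m: "(\<lambda>x. (X x - \<mu>) / \<sigma>) \<in> borel_measurable M"
    using distributed_measurable[OF D] by simp
  have "\<Phi> ((a - \<mu>) / \<sigma>) = measure (distr M lborel (\<lambda>x. (X x - \<mu>) / \<sigma>)) {..(a - \<mu>) / \<sigma>}"
    by (simp add: cdf_def distributed_distr_eq_density[OF D])
  also have "\<dots> = measure M ((\<lambda>x. (X x - \<mu>) / \<sigma>) -` {..(a - \<mu>) / \<sigma>} \<inter> space M)"
    using m by (subst measure_distr) auto
  also have "(\<lambda>x. (X x - \<mu>) / \<sigma>) -` {..(a - \<mu>) / \<sigma>} \<inter> space M = {x \<in> space M. X x \<le> a}"
    using \<open>0 < \<sigma>\<close> by (auto simp: divide_right_mono divide_le_cancel)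
  finally show ?thesis ..
qed

lemma \<Phi>_eq_nn_integral: "ennreal (\<Phi> x) = (\<integral>\<^sup>+ t. ennreal (std_normal_density t) * indicator {..x} t \<partial>lborel)"
proof -
  interpret real_distribution std_normal_distribution by (rule real_distribution_std_normal)
  have "ennreal (\<Phi> x) = emeasure std_normal_distribution {..x}"
    by (simp add: cdf_def emeasure_eq_measure)
  also have "\<dots> = (\<integral>\<^sup>+ t. ennreal (std_normal_density t) * indicator {..x} t \<partial>lborel)"
    by (subst emeasure_density) auto
  finally show ?thesis .
qed

lemma \<Phi>_measure_singleton: "measure std_normal_distribution {x} = 0"
proof -
  have "emeasure std_normal_distribution {x} = (\<integral>\<^sup>+ t. ennreal (std_normal_density t) * indicator {x} t \<partial>lborel)"
    by (subst emeasure_density) auto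
  also have "\<dots> = 0"
    by (rule nn_integral_null_set) (simp add: null_sets_def)
  finally show ?thesis by (simp add: measure_def)
qed

lemma isCont_\<Phi>: "isCont \<Phi> x"
  by (simp add: finite_borel_measure.isCont_cdf \<Phi>_measure_singleton
      real_distribution.finite_borel_measure_M[OF real_distribution_std_normal])

lemma \<Phi>_minus: "\<Phi> (- x) = 1 - \<Phi> x"
proof -
  interpret real_distribution std_normal_distribution by (rule real_distribution_std_normal)
  have D: "distributed std_normal_distribution lborel (\<lambda>x. x) (normal_density 0 1)"
    unfolding distributed_def by (auto intro!: distr_id2)
  have "distributed std_normal_distribution lborel (\<lambda>x. 0 + (-1) * x) (normal_density (0 + (-1) * 0) (\<bar>-1\<bar> * 1))"
    by (rule normal_density_affine[OF D]) auto
  then have D': "distributed std_normal_distribution lborel (\<lambda>x. - x) (normal_density 0 1)" by simp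
  have "\<Phi> (- x) = measure std_normal_distribution {t \<in> space std_normal_distribution. - t \<le> - x}"
    by (subst prob_normal_le[OF _ _ D']) (auto simp: prob_space_axioms)
  also have "{t \<in> space std_normal_distribution. - t \<le> - x} = (space std_normal_distribution - {..x}) \<union> {x}"
    by auto
  also have "measure std_normal_distribution \<dots> = measure std_normal_distribution (space std_normal_distribution - {..x})
     + measure std_normal_distribution {x}"
    by (intro measure_Union) (auto)
  also have "\<dots> = 1 - \<Phi> x"
    by (subst prob_compl) (auto simp: cdf_def \<Phi>_measure_singleton)
  finally show ?thesis .
qed

lemma \<Phi>_0: "\<Phi> 0 = 1/2"
  using \<Phi>_minus[of 0] by simp

text \<open>The exponent of \<open>std_normal_density (s - t)\<close> differs from that of
  \<open>std_normal_density s\<close> by \<open>s * t - t\<^sup>2 / 2\<close>, and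
  \<open>s * t \<le> - z * t\<close> for \<open>s \<le> - z\<close>. Integrating this pointwise
  comparison relates two tails to each other without estimating either of them.\<close>

lemma \<Phi>_shift_le:
  assumes "0 \<le> t"
  shows "\<Phi> (- z - t) \<le> exp (- z * t - t\<^sup>2 / 2) * \<Phi> (- z)"
proof -
  have "ennreal (\<Phi> (- z - t)) = (\<integral>\<^sup>+ s. ennreal (std_normal_density (s - t)) * indicator {..- z - t} (s - t) \<partial>lborel)"
    unfolding \<Phi>_eq_nn_integral
    by (subst nn_integral_real_affine[where c = 1 and t = "-t"]) (auto simp: algebra_simps)
  also have "\<dots> \<le> (\<integral>\<^sup>+ s. ennreal (exp (- z * t - t\<^sup>2 / 2)) * (ennreal (std_normal_density s) * indicator {..- z} s) \<partial>lborel)"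
  proof (rule nn_integral_mono)
    fix s
    have "std_normal_density (s - t) \<le> exp (- z * t - t\<^sup>2 / 2) * std_normal_density s" if "s \<le> - z"
    proof -
      have "s * t \<le> - z * t" using that assms by (rule mult_right_mono)
      then have "- (s - t)\<^sup>2 / 2 \<le> (- z * t - t\<^sup>2 / 2) + (- s\<^sup>2 / 2)"
        by (simp add: power2_eq_square field_simps)
      then have "exp (- (s - t)\<^sup>2 / 2) \<le> exp (- z * t - t\<^sup>2 / 2) * exp (- s\<^sup>2 / 2)"
        by (simp flip: exp_add)
      then show ?thesis unfolding std_normal_density_def by (simp add: divide_right_mono)
    qed
    then show "ennreal (std_normal_density (s - t)) * indicator {..- z - t} (s - t)
       \<le> ennreal (exp (- z * t - t\<^sup>2 / 2)) * (ennreal (std_normal_density s) * indicator {..- z} s)"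
      by (auto simp: indicator_def simp flip: ennreal_mult)
  qed
  also have "\<dots> = ennreal (exp (- z * t - t\<^sup>2 / 2) * \<Phi> (- z))"
    by (subst nn_integral_cmult) (auto simp: ennreal_mult \<Phi>_eq_nn_integral \<Phi>_nonneg)
  finally show ?thesis by (simp add: \<Phi>_nonneg)
qed

text \<open>The shift \<open>t = (c - 1) * z\<close> turns \<open>z * t + t\<^sup>2 / 2\<close> into
  \<open>(c\<^sup>2 - 1) * z\<^sup>2 / 2\<close>. This converts a safety margin \<open>c\<close>
  into a multiple of \<open>\<Phi> (- z)\<close>.\<close>

lemma \<Phi>_scale_le:
  assumes "1 \<le> c" "0 \<le> z"
  shows "\<Phi> (- c * z) \<le> exp (- (c\<^sup>2 - 1) * z\<^sup>2 / 2) * \<Phi> (- z)"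
proof -
  have "0 \<le> (c - 1) * z" using assms by simp
  from \<Phi>_shift_le[OF this, of z] show ?thesis
    by (simp add: algebra_simps power2_eq_square add_divide_distrib diff_divide_distrib)
qed

section \<open>Quantiles and a numerical bound for them\<close>

lemma \<Phi>_in_range:
  assumes "0 < p" "p < 1"
  shows "p \<in> range \<Phi>"
proof -
  interpret real_distribution std_normal_distribution by (rule real_distribution_std_normal)
  have "eventually (\<lambda>x. \<Phi> x < p) at_bot" using order_tendstoD(2)[OF cdf_lim_at_bot assms(1)] .
  then obtain a where a: "\<Phi> a < p" by (auto simp: eventually_at_bot_linorder)
  have "eventually (\<lambda>x. p < \<Phi> x) at_top" using order_tendstoD(1)[OF cdf_lim_at_top_prob assms(2)] .
  then obtain b where b: "p < \<Phi> b" by (auto simp: eventually_at_top_linorder)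
  have "a \<le> b" using a b \<Phi>_mono[of b a] by linarith
  then obtain x where "\<Phi> x = p" using IVT[of \<Phi> a p b] a b isCont_\<Phi> by force
  then show ?thesis by blast
qed

text \<open>Since \<open>z_quantile\<close> is defined by \<open>inv\<close>, the equation is an
  instance of surjectivity of \<Phi> onto the open unit interval.\<close>

lemma \<Phi>_z_quantile: "0 < a \<Longrightarrow> a < 1 \<Longrightarrow> \<Phi> (z_quantile a) = 1 - a"
  unfolding z_quantile_def by (rule f_inv_into_f[OF \<Phi>_in_range]) auto

text \<open>The Taylor polynomial stops at an even degree, so the Lagrange remainder carries the odd
  power \<open>(- t) ^ 5\<close> and is not positive.\<close>

lemma exp_minus_le_Taylor:
  assumes "0 \<le> (t::real)"
  shows "exp (- t) \<le> 1 - t + t^2/2 - t^3/6 + t^4/24"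
proof -
  obtain s where "exp (- t) = (\<Sum>m<5. (- t) ^ m / fact m) + exp s / fact 5 * (- t) ^ 5"
    using Maclaurin_exp_le[of "-t" 5] by auto
  moreover have "exp s / fact 5 * (- t) ^ 5 \<le> 0"
    using assms by (simp add: mult_nonneg_nonpos)
  moreover have "(\<Sum>m<5. (- t) ^ m / fact m) = 1 - t + t^2/2 - t^3/6 + t^4/24"
    by (simp add: eval_nat_numeral fact_numeral lessThan_Suc)
  ultimately show ?thesis by linarith
qed

text \<open>The upper 1/10-quantile is about 1.2816. The point 253/200 is below it by enough for a
  crude polynomial bound, while its square still exceeds 8/5, the number on which the coverage
  estimate relies.\<close>

lemma \<Phi>_1265: "\<Phi> (253/200) < 9/10"
proof -
  interpret real_distribution std_normal_distribution by (rule real_distribution_std_normal)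
  define x :: real where "x = 253/200"
  \<comment> \<open>\<open>p\<close> replaces the exponential by its Taylor polynomial of degree
    four in \<open>t\<^sup>2 / 2\<close>, and \<open>sqrt (2 * pi)\<close> by the smaller number
    5/2. \<open>q\<close> is an antiderivative of \<open>p\<close>.\<close>
  define p :: "real \<Rightarrow> real" where "p = (\<lambda>t. (1 - t^2/2 + t^4/8 - t^6/48 + t^8/384) / (5/2))"
  define q :: "real \<Rightarrow> real" where "q = (\<lambda>t. (2/5) * (t - (1/6) * t^3 + (1/40) * t^5 - (1/336) * t^7 + (1/3456) * t^9))"
  have "5/2 \<le> sqrt (2 * pi)"
    using pi_approx by (intro real_le_rsqrt) (simp add: power2_eq_square)
  then have sq: "1 / sqrt (2*pi) \<le> 1 / (5/2)" by (intro divide_left_mono) auto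
  have dp: "std_normal_density t \<le> p t" for t
  proof -
    have "exp (- (t^2/2)) \<le> 1 - (t^2/2) + (t^2/2)^2/2 - (t^2/2)^3/6 + (t^2/2)^4/24"
      by (rule exp_minus_le_Taylor) simp
    then have "exp (- (t^2)/2) \<le> (1 - t^2/2 + t^4/8 - t^6/48 + t^8/384)"
      by (simp add: power_divide flip: power_mult)
    from mult_mono[OF sq this] show ?thesis unfolding std_normal_density_def p_def by simp
  qed
  have "ennreal (measure std_normal_distribution {0<..x}) = emeasure std_normal_distribution {0<..x}"
    by (simp add: emeasure_eq_measure)
  also have "\<dots> = (\<integral>\<^sup>+ t. ennreal (std_normal_density t) * indicator {0<..x} t \<partial>lborel)"
    by (subst emeasure_density) auto
  also have "\<dots> \<le> (\<integral>\<^sup>+ t. ennreal (p t) * indicator {0..x} t \<partial>lborel)"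
    using dp by (intro nn_integral_mono) (auto simp: indicator_def intro!: ennreal_leI)
  also have "\<dots> = q x - q 0"
  proof (rule nn_integral_FTC_Icc)
    fix t
    show "p \<in> borel_measurable borel" unfolding p_def by simp
    show "0 \<le> p t" using dp[of t] normal_density_nonneg[of 0 1 t] by linarith
    show "DERIV q t :> p t" unfolding p_def q_def
      by (rule derivative_eq_intros refl)+ (simp_all add: field_simps)
  qed (simp_all add: x_def)
  finally have *: "ennreal (measure std_normal_distribution {0<..x}) \<le> ennreal (q x - q 0)" .
  have "0 \<le> q x - q 0" by (simp add: q_def x_def power_divide)
  then have "measure std_normal_distribution {0<..x} \<le> q x - q 0"
    using * by simp
  moreover have "q x - q 0 < 4/10" unfolding q_def x_def by (simp add: power_divide)
  moreover have "\<Phi> x - \<Phi> 0 = measure std_normal_distribution {0<..x}"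
    by (rule cdf_diff_eq) (simp add: x_def)
  ultimately show ?thesis using \<Phi>_0 unfolding x_def by linarith
qed

lemma less_z_quantile:
  assumes "0 < a" "a < 1" "\<Phi> x < 1 - a"
  shows "x < z_quantile a"
proof (rule ccontr)
  assume "\<not> x < z_quantile a"
  then have "\<Phi> (z_quantile a) \<le> \<Phi> x" by (intro \<Phi>_mono) simp
  with \<Phi>_z_quantile[OF assms(1,2)] assms(3) show False by linarith
qed

lemma z_quantile_gt: "0 < a \<Longrightarrow> a \<le> 1/10 \<Longrightarrow> 253/200 < z_quantile a"
  using \<Phi>_1265 by (intro less_z_quantile) linarith+

lemma z_quantile_pos: "0 < a \<Longrightarrow> a < 1/2 \<Longrightarrow> 0 < z_quantile a"
  by (intro less_z_quantile) (simp_all add: \<Phi>_0)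

lemma z_quantile_strict_antimono: "0 < a \<Longrightarrow> a < b \<Longrightarrow> b < 1 \<Longrightarrow> z_quantile b < z_quantile a"
  by (intro less_z_quantile) (simp_all add: \<Phi>_z_quantile)

section \<open>Finite products of normal distributions\<close>

text \<open>Finitely many coordinates of either model are a linear image of such a product. The
  variances are normalised to 1, so that the truth enters through \<open>\<mu>\<close>
  alone.\<close>

definition gprod :: "nat \<Rightarrow> (nat \<Rightarrow> real) \<Rightarrow> (nat \<Rightarrow> real) measure" where
  "gprod K \<mu> = PiM {..<K} (\<lambda>k. density lborel (normal_density (\<mu> k) 1))"

lemma sets_gprod [measurable_cong]: "sets (gprod K \<mu>) = sets (PiM {..<K} (\<lambda>_. borel))"
  unfolding gprod_def by (rule sets_PiM_cong) auto

lemma prob_space_gprod: "prob_space (gprod K \<mu>)"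
  unfolding gprod_def by (intro prob_space_PiM prob_space_normal_density) simp

lemma gprod_component: "k < K \<Longrightarrow> distr (gprod K \<mu>) borel (\<lambda>x. x k) = density lborel (normal_density (\<mu> k) 1)"
proof -
  assume k: "k < K"
  have "distr (gprod K \<mu>) borel (\<lambda>x. x k) = distr (gprod K \<mu>) (density lborel (normal_density (\<mu> k) 1)) (\<lambda>x. x k)"
    by (rule distr_cong) auto
  also have "\<dots> = density lborel (normal_density (\<mu> k) 1)"
    unfolding gprod_def using k by (intro distr_PiM_component prob_space_normal_density) auto
  finally show ?thesis .
qed

lemma gprod_indep: "prob_space.indep_vars (gprod K \<mu>) (\<lambda>_. borel) (\<lambda>k x. x k) {..<K}"
proof -
  interpret prob_space "gprod K \<mu>" by (rule prob_space_gprod)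
  show ?thesis
  proof (cases "K = 0")
    case True
    show ?thesis unfolding indep_vars_def indep_sets_def using True by simp
  next
    case False
    have "distr (gprod K \<mu>) (PiM {..<K} (\<lambda>_. borel)) (\<lambda>x. \<lambda>i\<in>{..<K}. x i) = distr (gprod K \<mu>) (gprod K \<mu>) (\<lambda>x. x)"
    proof (rule distr_cong)
      show "restrict x {..<K} = x" if "x \<in> space (gprod K \<mu>)" for x
        using that by (auto simp: gprod_def space_PiM)
    qed (simp_all add: sets_gprod)
    also have "\<dots> = (\<Pi>\<^sub>M i\<in>{..<K}. distr (gprod K \<mu>) borel (\<lambda>x. x i))"
      unfolding distr_id by (subst (1) gprod_def) (intro PiM_cong, simp_all add: gprod_component)
    finally show ?thesis
      using False by (subst indep_vars_iff_distr_eq_PiM') auto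
  qed
qed

lemma gprod_linear_normal:
  assumes "\<exists>k<K. \<beta> k \<noteq> 0"
  shows "distributed (gprod K \<mu>) lborel (\<lambda>x. \<Sum>k<K. \<beta> k * x k)
    (normal_density (\<Sum>k<K. \<beta> k * \<mu> k) (sqrt (\<Sum>k<K. (\<beta> k)\<^sup>2)))"
proof -
  interpret prob_space "gprod K \<mu>" by (rule prob_space_gprod)
  \<comment> \<open>A term with \<open>\<beta> k = 0\<close> is a constant and has no normal
    density. The sum is therefore formed over the nonzero coefficients and extended by zeros at the
    end.\<close>
  define I where "I = {k\<in>{..<K}. \<beta> k \<noteq> 0}"
  have I: "finite I" "I \<noteq> {}" "I \<subseteq> {..<K}" using assms by (auto simp: I_def)
  have d: "distributed (gprod K \<mu>) lborel (\<lambda>x. \<beta> k * x k) (normal_density (\<beta> k * \<mu> k) \<bar>\<beta> k\<bar>)"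
    if "k \<in> I" for k
  proof -
    have "distributed (gprod K \<mu>) lborel (\<lambda>x. x k) (normal_density (\<mu> k) 1)"
      unfolding distributed_def using gprod_component[of k K \<mu>] that I
      by (auto simp: I_def cong: distr_cong)
    from normal_density_affine[OF this, of "\<beta> k" 0] that show ?thesis by (auto simp: I_def)
  qed
  have "indep_vars (\<lambda>_. borel) (\<lambda>k x. \<beta> k * x k) {..<K}"
    by (rule indep_vars_compose2[OF gprod_indep]) auto
  from indep_vars_subset[OF this I(3)]
  have "distributed (gprod K \<mu>) lborel (\<lambda>x. \<Sum>k\<in>I. \<beta> k * x k)
    (normal_density (\<Sum>k\<in>I. \<beta> k * \<mu> k) (sqrt (\<Sum>k\<in>I. \<bar>\<beta> k\<bar>\<^sup>2)))"
    by (intro sum_indep_normal) (use d I in \<open>auto simp: I_def\<close>)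
  moreover have "(\<Sum>k\<in>I. f k) = (\<Sum>k<K. f k)" if "\<And>k. \<beta> k = 0 \<Longrightarrow> f k = 0" for f :: "nat \<Rightarrow> real"
    by (rule sum.mono_neutral_left) (use that in \<open>auto simp: I_def\<close>)
  ultimately show ?thesis by simp
qed

section \<open>Likelihood ratios and the Neyman-Pearson inequality\<close>

lemma normal_density_ratio:
  "normal_density \<mu> 1 x = exp ((\<mu> - \<nu>) * (x - \<nu>) - (\<mu> - \<nu>)\<^sup>2 / 2) * normal_density \<nu> 1 x"
proof -
  have "- (x - \<mu>)\<^sup>2 / 2 = ((\<mu> - \<nu>) * (x - \<nu>) - (\<mu> - \<nu>)\<^sup>2 / 2) + - (x - \<nu>)\<^sup>2 / 2"
    by (simp add: power2_eq_square field_simps)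
  then have "exp (- (x - \<mu>)\<^sup>2 / 2) = exp ((\<mu> - \<nu>) * (x - \<nu>) - (\<mu> - \<nu>)\<^sup>2 / 2) * exp (- (x - \<nu>)\<^sup>2 / 2)"
    by (simp only: exp_add)
  then show ?thesis unfolding normal_density_def by simp
qed

text \<open>A product measure is determined by its values on boxes, and there the product of the
  one-dimensional likelihood ratios splits into separate integrals.\<close>

lemma gprod_density:
  "gprod K \<mu> = density (gprod K \<nu>) (\<lambda>x. \<Prod>k<K. ennreal (exp ((\<mu> k - \<nu> k) * (x k - \<nu> k) - (\<mu> k - \<nu> k)\<^sup>2 / 2)))"
proof -
  let ?N = "\<lambda>\<mu> k. density lborel (normal_density (\<mu> k) 1)"
  let ?e = "\<lambda>k y. ennreal (exp ((\<mu> k - \<nu> k) * (y - \<nu> k) - (\<mu> k - \<nu> k)\<^sup>2 / 2))"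
  interpret P: product_sigma_finite "?N \<mu>"
    by (intro product_sigma_finite.intro prob_space_imp_sigma_finite prob_space_normal_density) simp
  interpret Q: product_sigma_finite "?N \<nu>"
    by (intro product_sigma_finite.intro prob_space_imp_sigma_finite prob_space_normal_density) simp
  have "density (gprod K \<nu>) (\<lambda>x. \<Prod>k<K. ?e k (x k)) = PiM {..<K} (?N \<mu>)"
  proof (rule P.PiM_eqI)
    show "sets (density (gprod K \<nu>) (\<lambda>x. \<Prod>k<K. ?e k (x k))) = sets (PiM {..<K} (?N \<mu>))"
      using sets_gprod[of K \<nu>] sets_gprod[of K \<mu>] by (simp add: gprod_def)
  next
    fix A assume A: "\<And>k. k \<in> {..<K} \<Longrightarrow> A k \<in> sets (?N \<mu> k)"
    then have A': "\<And>k. k < K \<Longrightarrow> A k \<in> sets borel" by simp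
    have box: "Pi\<^sub>E {..<K} A \<in> sets (gprod K \<nu>)"
      unfolding sets_gprod using A' by (intro sets_PiM_I_finite) auto
    have "emeasure (density (gprod K \<nu>) (\<lambda>x. \<Prod>k<K. ?e k (x k))) (Pi\<^sub>E {..<K} A)
      = (\<integral>\<^sup>+ x. (\<Prod>k<K. ?e k (x k)) * indicator (Pi\<^sub>E {..<K} A) x \<partial>gprod K \<nu>)"
      using box by (intro emeasure_density) (auto simp: gprod_def)
    also have "\<dots> = (\<integral>\<^sup>+ x. (\<Prod>k<K. ?e k (x k) * indicator (A k) (x k)) \<partial>PiM {..<K} (?N \<nu>))"
      unfolding gprod_def
    proof (rule nn_integral_cong)
      fix x assume "x \<in> space (PiM {..<K} (?N \<nu>))"
      then have "x \<in> extensional {..<K}" by (simp add: space_PiM PiE_def)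
      then have "(indicator (Pi\<^sub>E {..<K} A) x :: ennreal) = (\<Prod>k<K. indicator (A k) (x k))"
        by (auto simp: indicator_def PiE_def Pi_def prod_zero_iff intro!: prod.neutral[symmetric] prod_zero[symmetric])
      then show "(\<Prod>k<K. ?e k (x k)) * indicator (Pi\<^sub>E {..<K} A) x = (\<Prod>k<K. ?e k (x k) * indicator (A k) (x k))"
        by (simp add: prod.distrib)
    qed
    also have "\<dots> = (\<Prod>k<K. \<integral>\<^sup>+ y. ?e k y * indicator (A k) y \<partial>?N \<nu> k)"
      using A' by (intro Q.product_nn_integral_prod) auto
    also have "\<dots> = (\<Prod>k<K. emeasure (?N \<mu> k) (A k))"
    proof (rule prod.cong)
      fix k assume "k \<in> {..<K}"
      then have [measurable]: "A k \<in> sets borel" using A' by simp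
      have "(\<integral>\<^sup>+ y. ?e k y * indicator (A k) y \<partial>?N \<nu> k)
        = (\<integral>\<^sup>+ y. ennreal (normal_density (\<nu> k) 1 y) * (?e k y * indicator (A k) y) \<partial>lborel)"
        by (subst nn_integral_density) auto
      also have "\<dots> = (\<integral>\<^sup>+ y. ennreal (normal_density (\<mu> k) 1 y) * indicator (A k) y \<partial>lborel)"
        by (subst normal_density_ratio[of "\<mu> k" _ "\<nu> k"]) (auto simp: ennreal_mult mult_ac)
      also have "\<dots> = emeasure (?N \<mu> k) (A k)"
        by (subst emeasure_density) auto
      finally show "(\<integral>\<^sup>+ y. ?e k y * indicator (A k) y \<partial>?N \<nu> k) = emeasure (?N \<mu> k) (A k)" .
    qed simp
    finally show "emeasure (density (gprod K \<nu>) (\<lambda>x. \<Prod>k<K. ?e k (x k))) (Pi\<^sub>E {..<K} A)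
      = (\<Prod>k<K. emeasure (?N \<mu> k) (A k))" .
  qed simp
  then show ?thesis by (simp add: gprod_def)
qed

text \<open>Passing from \<open>B\<close> to \<open>A\<close> adds points with
  \<open>L x > \<kappa>\<close> and removes points with \<open>L x \<le> \<kappa>\<close>, so it
  cannot lower the difference. The Lagrangian form prescribes no level for \<open>A\<close> and thus
  tolerates events whose level is known only approximately.\<close>

lemma neyman_pearson_density:
  assumes Q: "finite_measure Q" and P: "finite_measure P" "P = density Q (\<lambda>x. ennreal (L x))"
    and L: "L \<in> borel_measurable Q" and A: "A \<in> sets Q" and \<kappa>: "0 \<le> \<kappa>"
    and B: "B = {x\<in>space Q. L x \<le> \<kappa>}"
  shows "measure P B - \<kappa> * measure Q B \<le> measure P A - \<kappa> * measure Q A"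
proof -
  interpret Q: finite_measure Q by fact
  interpret P: finite_measure P by fact
  note [measurable] = L A
  have Bs[measurable]: "B \<in> sets Q" unfolding B by measurable
  have sets: "sets P = sets Q" by (simp add: P(2))
  have "ennreal (\<kappa> * measure Q (A - B)) = (\<integral>\<^sup>+ x. ennreal \<kappa> * indicator (A - B) x \<partial>Q)"
    using \<kappa> by (simp add: nn_integral_cmult_indicator ennreal_mult Q.emeasure_eq_measure)
  also have "\<dots> \<le> (\<integral>\<^sup>+ x. ennreal (L x) * indicator (A - B) x \<partial>Q)"
    using sets.sets_into_space[OF A]
    by (intro nn_integral_mono) (auto simp: B indicator_def intro!: ennreal_leI)
  also have "\<dots> = emeasure P (A - B)" by (simp add: P(2) emeasure_density)
  finally have 1: "\<kappa> * measure Q (A - B) \<le> measure P (A - B)" by (simp add: P.emeasure_eq_measure)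
  have "emeasure P (B - A) = (\<integral>\<^sup>+ x. ennreal (L x) * indicator (B - A) x \<partial>Q)"
    by (simp add: P(2) emeasure_density)
  also have "\<dots> \<le> (\<integral>\<^sup>+ x. ennreal \<kappa> * indicator (B - A) x \<partial>Q)"
    by (intro nn_integral_mono) (auto simp: B indicator_def intro!: ennreal_leI)
  also have "\<dots> = ennreal (\<kappa> * measure Q (B - A))"
    using \<kappa> by (simp add: nn_integral_cmult_indicator ennreal_mult Q.emeasure_eq_measure)
  finally have 2: "measure P (B - A) \<le> \<kappa> * measure Q (B - A)"
    using \<kappa> by (simp add: P.emeasure_eq_measure)
  have "measure N A + measure N (B - A) = measure N B + measure N (A - B)" if "finite_measure N" "sets N = sets Q" for N
  proof -
    interpret N: finite_measure N by fact
    have "measure N (A \<union> B) = measure N A + measure N (B - A)"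
      using N.finite_measure_Union'[of A B] A Bs that(2) by simp
    moreover have "measure N (B \<union> A) = measure N B + measure N (A - B)"
      using N.finite_measure_Union'[of B A] A Bs that(2) by simp
    ultimately show ?thesis by (simp add: Un_commute)
  qed
  from this[OF Q] this[OF P(1) sets] 
  have q: "measure Q A = measure Q B + measure Q (A - B) - measure Q (B - A)"
    and p: "measure P A = measure P B + measure P (A - B) - measure P (B - A)" by simp_all
  show ?thesis unfolding q p using 1 2 by (simp add: algebra_simps)
qed

text \<open>Up to a constant, the logarithm of the likelihood ratio is the linear statistic
  \<open>S\<close>. It is normal with standard deviation \<open>s\<close> under both laws, and its
  two means differ by \<open>s\<^sup>2\<close>. A lower set of \<open>S\<close> with probability
  \<open>\<Phi> t\<close> under \<open>\<nu>\<close> thus has probability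
  \<open>\<Phi> (t - s)\<close> under \<open>\<mu>\<close>. The bound for \<open>\<kappa>\<close>
  does not involve the dimension \<open>K\<close>.\<close>

lemma gprod_neyman_pearson:
  assumes A: "A \<in> sets (PiM {..<K} (\<lambda>_. borel))"
    and \<delta>: "(\<Sum>k<K. (\<mu> k - \<nu> k)\<^sup>2) \<le> \<delta>\<^sup>2" "0 \<le> \<delta>" and t: "0 \<le> t"
  shows "\<exists>\<kappa>. 0 \<le> \<kappa> \<and> \<kappa> \<le> exp (\<delta> * t) \<and>
    \<Phi> (t - \<delta>) + \<kappa> * (measure (gprod K \<nu>) A - \<Phi> t) \<le> measure (gprod K \<mu>) A"
proof (cases "\<exists>k<K. \<mu> k - \<nu> k \<noteq> 0")
  \<comment> \<open>With equal means there is no test statistic, but the two laws coincide and the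
    multiplier 1 works.\<close>
  case False
  then have "gprod K \<mu> = gprod K \<nu>" unfolding gprod_def by (intro PiM_cong) auto
  moreover have "\<Phi> (t - \<delta>) \<le> \<Phi> t" using \<delta>(2) by (intro \<Phi>_mono) simp
  ultimately show ?thesis using \<delta>(2) t by (intro exI[of _ 1]) simp
next
  case True
  define s where "s = sqrt (\<Sum>k<K. (\<mu> k - \<nu> k)\<^sup>2)"
  have s2: "s\<^sup>2 = (\<Sum>k<K. (\<mu> k - \<nu> k)\<^sup>2)" unfolding s_def by (simp add: sum_nonneg)
  have s0: "0 < s"
  proof -
    obtain k where "k < K" "\<mu> k - \<nu> k \<noteq> 0" using True by blast
    then have "0 < (\<Sum>k<K. (\<mu> k - \<nu> k)\<^sup>2)" by (intro sum_pos2[of _ k]) simp_all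
    then show ?thesis unfolding s_def by simp
  qed
  have s\<delta>: "s \<le> \<delta>" by (rule power2_le_imp_le) (simp_all only: s2 \<delta>)
  \<comment> \<open>The likelihood ratio is \<open>exp (S x - c - s\<^sup>2 / 2)\<close>. This is
    its value at \<open>S x = s * t + c\<close>, which lies \<open>t\<close> standard deviations
    above the mean under \<open>\<nu>\<close>.\<close>
  define \<kappa> where "\<kappa> = exp (s * t - s\<^sup>2 / 2)"
  define L where "L = (\<lambda>x::nat \<Rightarrow> real. \<Prod>k<K. exp ((\<mu> k - \<nu> k) * (x k - \<nu> k) - (\<mu> k - \<nu> k)\<^sup>2 / 2))"
  define S where "S = (\<lambda>x::nat \<Rightarrow> real. \<Sum>k<K. (\<mu> k - \<nu> k) * x k)"
  define B where "B = {x\<in>space (gprod K \<nu>). L x \<le> \<kappa>}"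
  define c where "c = (\<Sum>k<K. (\<mu> k - \<nu> k) * \<nu> k)"
  interpret P: prob_space "gprod K \<mu>" by (rule prob_space_gprod)
  interpret Q: prob_space "gprod K \<nu>" by (rule prob_space_gprod)
  have Lexp: "L x = exp (S x - c - s\<^sup>2 / 2)" for x
  proof -
    have "L x = exp (\<Sum>k<K. (\<mu> k - \<nu> k) * (x k - \<nu> k) - (\<mu> k - \<nu> k)\<^sup>2 / 2)"
      unfolding L_def by (simp add: exp_sum)
    also have "(\<Sum>k<K. (\<mu> k - \<nu> k) * (x k - \<nu> k) - (\<mu> k - \<nu> k)\<^sup>2 / 2) = S x - c - s\<^sup>2 / 2"
      unfolding S_def c_def s2 by (simp only: right_diff_distrib sum_subtractf sum_divide_distrib)
    finally show ?thesis .
  qed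
  have B': "B = {x\<in>space (gprod K \<nu>). S x \<le> s * t + c}"
    unfolding B_def Lexp \<kappa>_def by auto
  have sp: "space (gprod K \<nu>) = space (gprod K \<mu>)" by (simp add: gprod_def space_PiM)
  have "measure (gprod K \<nu>) B = \<Phi> ((s * t + c - c) / s)"
    unfolding B' using gprod_linear_normal[OF True, of \<nu>] s0
    by (intro prob_normal_le[OF Q.prob_space_axioms]) (auto simp: S_def s_def c_def)
  also have "(s * t + c - c) / s = t" using s0 by simp
  finally have QB: "measure (gprod K \<nu>) B = \<Phi> t" .
  have m: "(\<Sum>k<K. (\<mu> k - \<nu> k) * \<mu> k) = c + s\<^sup>2"
    unfolding c_def s2 by (simp flip: sum.distrib add: power2_eq_square algebra_simps)
  have "measure (gprod K \<mu>) B = \<Phi> ((s * t + c - (c + s\<^sup>2)) / s)"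
    unfolding B' sp using gprod_linear_normal[OF True, of \<mu>] s0
    by (intro prob_normal_le[OF P.prob_space_axioms]) (auto simp: S_def s_def[symmetric] m)
  also have "(s * t + c - (c + s\<^sup>2)) / s = t - s" using s0 by (simp add: field_simps power2_eq_square)
  finally have PB: "measure (gprod K \<mu>) B = \<Phi> (t - s)" .
  have "measure (gprod K \<mu>) B - \<kappa> * measure (gprod K \<nu>) B \<le> measure (gprod K \<mu>) A - \<kappa> * measure (gprod K \<nu>) A"
  proof (rule neyman_pearson_density[OF _ _ _ _ _ _ B_def])
    show "gprod K \<mu> = density (gprod K \<nu>) (\<lambda>x. ennreal (L x))"
      unfolding L_def by (subst gprod_density[of K \<mu> \<nu>]) (simp add: prod_ennreal)
    show "L \<in> borel_measurable (gprod K \<nu>)" unfolding L_def by measurable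
  qed (use A in \<open>auto simp: sets_gprod \<kappa>_def P.finite_measure_axioms Q.finite_measure_axioms\<close>)
  moreover have "\<Phi> (t - \<delta>) \<le> \<Phi> (t - s)" using s\<delta> by (intro \<Phi>_mono) simp
  moreover have "s * t - s\<^sup>2 / 2 \<le> \<delta> * t" using mult_right_mono[OF s\<delta> t] zero_le_power2[of s] by linarith
  ultimately show ?thesis unfolding PB QB
    by (intro exI[of _ \<kappa>]) (simp add: \<kappa>_def algebra_simps)
qed

section \<open>Normal tails\<close>

text \<open>A normal variable, possibly degenerate, has the following property, which survives limits in
  quadratic mean.\<close>

definition normal_tail :: "'a measure \<Rightarrow> ('a \<Rightarrow> real) \<Rightarrow> bool" where
  "normal_tail M X \<longleftrightarrow> X \<in> borel_measurable M \<and> integrable M (\<lambda>x. (X x)\<^sup>2) \<and>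
     (\<forall>t>0. \<forall>\<sigma>>0. integral\<^sup>L M (\<lambda>x. (X x - integral\<^sup>L M X)\<^sup>2) \<le> \<sigma>\<^sup>2 \<longrightarrow>
        measure M {x \<in> space M. X x \<le> integral\<^sup>L M X - t} \<le> \<Phi> (- t / \<sigma>))"

lemma normal_tail_normal:
  assumes "prob_space M" "0 < s" and X: "distributed M lborel X (normal_density m s)"
  shows "normal_tail M X"
proof -
  interpret prob_space M by fact
  have [measurable]: "X \<in> borel_measurable M" using distributed_measurable[OF X] by simp
  have E: "expectation X = m" by (rule normal_distributed_expectation[OF \<open>0 < s\<close> X])
  have V: "variance X = s\<^sup>2" by (rule normal_distributed_variance[OF \<open>0 < s\<close> X])
  have i1: "integrable M X"
    using distributed_integrable[OF X, of "\<lambda>x. x"] integrable_normal_moment_nz_1[OF \<open>0 < s\<close>, of m] by simp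
  have i2: "integrable M (\<lambda>x. (X x - m)\<^sup>2)"
    using distributed_integrable[OF X, of "\<lambda>x. (x - m)\<^sup>2"] integrable_normal_moment[OF \<open>0 < s\<close>, of m 2] by simp
  have "integrable M (\<lambda>x. (X x - m)\<^sup>2 + (2 * m * X x - m\<^sup>2))"
    using i1 i2 by auto
  also have "(\<lambda>x. (X x - m)\<^sup>2 + (2 * m * X x - m\<^sup>2)) = (\<lambda>x. (X x)\<^sup>2)"
    by (simp add: power2_eq_square algebra_simps)
  finally have i3: "integrable M (\<lambda>x. (X x)\<^sup>2)" .
  have "prob {x \<in> space M. X x \<le> m - t} \<le> \<Phi> (- t / \<sigma>)" if "0 < t" "0 < \<sigma>" "s\<^sup>2 \<le> \<sigma>\<^sup>2" for t \<sigma>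
  proof -
    have "s \<le> \<sigma>" using power2_le_imp_le[OF that(3)] that(2) by simp
    then have "- t / s \<le> - t / \<sigma>" using that \<open>0 < s\<close> by (simp add: frac_le)
    then have "\<Phi> (- t / s) \<le> \<Phi> (- t / \<sigma>)" by (rule \<Phi>_mono)
    then show ?thesis by (simp add: prob_normal_le[OF prob_space_axioms \<open>0 < s\<close> X])
  qed
  with i3 show ?thesis unfolding normal_tail_def E V[unfolded E] by auto
qed

lemma normal_tail_const: "prob_space M \<Longrightarrow> normal_tail M (\<lambda>_. c)"
proof -
  assume "prob_space M"
  then interpret prob_space M .
  show ?thesis unfolding normal_tail_def by (auto simp: \<Phi>_nonneg prob_space)
qed

lemma normal_tail_distr:
  assumes [measurable]: "f \<in> measurable M N" "X \<in> borel_measurable N"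
  shows "normal_tail (distr M N f) X \<longleftrightarrow> normal_tail M (\<lambda>x. X (f x))"
proof -
  have "measure (distr M N f) {x \<in> space (distr M N f). X x \<le> a} = measure M {x \<in> space M. X (f x) \<le> a}" for a
    by (subst measure_distr) (auto intro!: arg_cong[where f = "measure M"] dest: measurable_space[OF assms(1)])
  then show ?thesis
    unfolding normal_tail_def by (simp add: integral_distr integrable_distr_eq)
qed

lemma normal_tailD:
  assumes "prob_space M" "normal_tail M X"
  shows "X \<in> borel_measurable M" "integrable M X" "integrable M (\<lambda>x. (X x)\<^sup>2)"
    "integrable M (\<lambda>x. (X x - c)\<^sup>2)"
proof -
  interpret prob_space M by fact
  show 1: "X \<in> borel_measurable M" and 2: "integrable M (\<lambda>x. (X x)\<^sup>2)"
    using assms(2) by (auto simp: normal_tail_def)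
  show 3: "integrable M X" by (rule square_integrable_imp_integrable[OF 1 2])
  have "integrable M (\<lambda>x. (X x)\<^sup>2 - 2 * c * X x + c\<^sup>2)" using 2 3 by auto
  also have "(\<lambda>x. (X x)\<^sup>2 - 2 * c * X x + c\<^sup>2) = (\<lambda>x. (X x - c)\<^sup>2)"
    by (simp add: power2_eq_square algebra_simps)
  finally show "integrable M (\<lambda>x. (X x - c)\<^sup>2)" .
qed

lemma (in prob_space) expectation_square_ge:
  fixes X :: "'a \<Rightarrow> real"
  assumes "X \<in> borel_measurable M" "integrable M (\<lambda>x. (X x)\<^sup>2)"
  shows "(expectation X)\<^sup>2 \<le> expectation (\<lambda>x. (X x)\<^sup>2)"
proof -
  have "0 \<le> variance X" by simp
  then show ?thesis using variance_eq[OF square_integrable_imp_integrable[OF assms] assms(2)] by simp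
qed

lemma (in prob_space) variance_le_second_moment:
  fixes X :: "'a \<Rightarrow> real"
  assumes X: "X \<in> borel_measurable M" "integrable M (\<lambda>x. (X x)\<^sup>2)"
  shows "variance X \<le> expectation (\<lambda>x. (X x - c)\<^sup>2)"
proof -
  have i: "integrable M X" by (rule square_integrable_imp_integrable[OF X])
  have "expectation (\<lambda>x. (X x - c)\<^sup>2) = expectation (\<lambda>x. (X x)\<^sup>2 + (c\<^sup>2 - 2 * c * X x))"
    by (rule Bochner_Integration.integral_cong) (simp_all add: power2_eq_square algebra_simps)
  also have "\<dots> = expectation (\<lambda>x. (X x)\<^sup>2) + (c\<^sup>2 - 2 * c * expectation X)"
    using i X(2) by (simp add: prob_space)
  finally have "expectation (\<lambda>x. (X x - c)\<^sup>2) - variance X = (expectation X - c)\<^sup>2"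
    using variance_eq[OF i X(2)] by (simp add: power2_eq_square algebra_simps)
  then show ?thesis using zero_le_power2[of "expectation X - c"] by linarith
qed

text \<open>Convexity of the square, with \<open>a + b\<close> written as the mean of
  \<open>a / r\<close> and \<open>b / (1 - r)\<close> with weights \<open>r\<close> and
  \<open>1 - r\<close>. For \<open>r\<close> near 1 the factor in front of \<open>a\<^sup>2\<close>
  is nearly 1.\<close>

lemma square_add_le:
  fixes a b :: real
  assumes "0 < r" "r < 1"
  shows "(a + b)\<^sup>2 \<le> a\<^sup>2 / r + b\<^sup>2 / (1 - r)"
proof -
  have "a\<^sup>2 / r + b\<^sup>2 / (1 - r) - (a + b)\<^sup>2 = (a * (1 - r) - b * r)\<^sup>2 / (r * (1 - r))"
    using assms by (simp add: field_simps power2_eq_square)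
  moreover have "0 \<le> (a * (1 - r) - b * r)\<^sup>2 / (r * (1 - r))" using assms by simp
  ultimately show ?thesis by linarith
qed

text \<open>An approximation in quadratic mean has nearly the same mean and variance, and by
  Chebyshev's inequality it is close to \<open>X\<close> outside a small event. The losses are
  absorbed by replacing \<open>t\<close> with \<open>r * t\<close> and \<open>\<sigma>\<close> with
  \<open>\<sigma> / r\<close>; continuity of \<Phi> then allows \<open>r\<close> to tend to
  1.\<close>

lemma normal_tail_limit:
  assumes "prob_space M" and X: "X \<in> borel_measurable M"
    and approx: "\<And>\<epsilon>::real. 0 < \<epsilon> \<Longrightarrow> \<exists>Y. normal_tail M Y \<and> (\<integral>\<^sup>+ x. ennreal ((X x - Y x)\<^sup>2) \<partial>M) < ennreal \<epsilon>"
  shows "normal_tail M X"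
proof -
  interpret prob_space M by fact
  note [measurable] = X
  have approx': "\<exists>Y. normal_tail M Y \<and> integrable M (\<lambda>x. (X x - Y x)\<^sup>2) \<and> expectation (\<lambda>x. (X x - Y x)\<^sup>2) < \<epsilon>"
    if \<epsilon>: "0 < \<epsilon>" for \<epsilon>
  proof -
    obtain Y where Y: "normal_tail M Y" "(\<integral>\<^sup>+ x. ennreal ((X x - Y x)\<^sup>2) \<partial>M) < ennreal \<epsilon>"
      using approx[OF \<epsilon>] by auto
    note [measurable] = normal_tailD(1)[OF prob_space_axioms Y(1)]
    have i: "integrable M (\<lambda>x. (X x - Y x)\<^sup>2)"
      using Y(2) by (intro integrableI_nonneg) (auto intro: less_trans ennreal_less_top)
    moreover have "ennreal (expectation (\<lambda>x. (X x - Y x)\<^sup>2)) < ennreal \<epsilon>"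
      using Y(2) nn_integral_eq_integral[OF i] by simp
    ultimately show ?thesis using Y(1) by (auto simp: ennreal_less_iff)
  qed
  have i2: "integrable M (\<lambda>x. (X x)\<^sup>2)"
  proof -
    obtain Y where Y: "normal_tail M Y" "integrable M (\<lambda>x. (X x - Y x)\<^sup>2)"
      using approx'[of 1] by auto
    note [measurable] = normal_tailD(1)[OF prob_space_axioms Y(1)]
    show ?thesis
    proof (rule Bochner_Integration.integrable_bound)
      show "integrable M (\<lambda>x. 2 * (X x - Y x)\<^sup>2 + 2 * (Y x)\<^sup>2)"
        using Y(2) normal_tailD(3)[OF prob_space_axioms Y(1)] by simp
      have "(X x)\<^sup>2 \<le> 2 * (X x - Y x)\<^sup>2 + 2 * (Y x)\<^sup>2" for x
        using square_add_le[of "1/2" "X x - Y x" "Y x"] by simp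
      then show "AE x in M. norm ((X x)\<^sup>2) \<le> norm (2 * (X x - Y x)\<^sup>2 + 2 * (Y x)\<^sup>2)" by simp
    qed measurable
  qed
  have i1: "integrable M X" by (rule square_integrable_imp_integrable[OF X i2])
  define m where "m = expectation X"
  have "prob {x \<in> space M. X x \<le> m - t} \<le> \<Phi> (- t / \<sigma>)"
    if t: "0 < t" and \<sigma>: "0 < \<sigma>" and v: "variance X \<le> \<sigma>\<^sup>2" for t \<sigma>
  proof -
    have *: "prob {x \<in> space M. X x \<le> m - t} \<le> \<Phi> (- (r * t) / (\<sigma> / r))" if r: "0 < r" "r < 1" for r
    proof (rule field_le_epsilon)
      fix e :: real assume e: "0 < e"
      \<comment> \<open>The gap \<open>t - r * t\<close> is \<open>2 * \<eta>\<close>: one half is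
        spent on the difference of the means, the other on the deviation of \<open>Y\<close> from
        \<open>X\<close>.\<close>
      define \<eta> where "\<eta> = t * (1 - r) / 2"
      have \<eta>: "0 < \<eta>" using t r by (simp add: \<eta>_def)
      \<comment> \<open>The three bounds serve, in this order, the variance of \<open>Y\<close>, the
        difference of the means, and Chebyshev's inequality at level \<open>\<eta>\<close>.\<close>
      define \<epsilon> where "\<epsilon> = min (min (\<sigma>\<^sup>2 * (1 - r)\<^sup>2) (\<eta>\<^sup>2)) (e * \<eta>\<^sup>2)"
      have "0 < \<epsilon>" using \<sigma> r \<eta> e by (simp add: \<epsilon>_def)
      then obtain Y where Y: "normal_tail M Y" "integrable M (\<lambda>x. (X x - Y x)\<^sup>2)" "expectation (\<lambda>x. (X x - Y x)\<^sup>2) < \<epsilon>"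
        using approx' by blast
      note Ym[measurable] = normal_tailD(1)[OF prob_space_axioms Y(1)]
      note Yi = normal_tailD(2,3)[OF prob_space_axioms Y(1)]
      define n where "n = expectation Y"
      have "(m - n)\<^sup>2 \<le> expectation (\<lambda>x. (X x - Y x)\<^sup>2)"
        using expectation_square_ge[of "\<lambda>x. X x - Y x"] Y(2) i1 Yi by (simp add: m_def n_def)
      also have "\<dots> \<le> \<eta>\<^sup>2" using Y(3) by (simp add: \<epsilon>_def)
      finally have "\<bar>m - n\<bar> \<le> \<eta>" using \<eta> by (simp add: abs_le_square_iff[symmetric])
      then have mn: "m \<le> n + \<eta>" by linarith
      have iX: "integrable M (\<lambda>x. (X x - m)\<^sup>2)"
      proof -
        have "integrable M (\<lambda>x. (X x)\<^sup>2 - 2 * m * X x + m\<^sup>2)" using i1 i2 by auto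
        also have "(\<lambda>x. (X x)\<^sup>2 - 2 * m * X x + m\<^sup>2) = (\<lambda>x. (X x - m)\<^sup>2)"
          by (simp add: power2_eq_square algebra_simps)
        finally show ?thesis .
      qed
      have "variance Y \<le> expectation (\<lambda>x. (Y x - m)\<^sup>2)"
        using Ym Yi(2) by (rule variance_le_second_moment)
      also have "\<dots> \<le> expectation (\<lambda>x. (X x - m)\<^sup>2 / r + (X x - Y x)\<^sup>2 / (1 - r))"
      proof (rule integral_mono)
        show "integrable M (\<lambda>x. (Y x - m)\<^sup>2)" by (rule normal_tailD(4)[OF prob_space_axioms Y(1)])
        show "integrable M (\<lambda>x. (X x - m)\<^sup>2 / r + (X x - Y x)\<^sup>2 / (1 - r))"
          using iX Y(2) by simp
        show "(Y x - m)\<^sup>2 \<le> (X x - m)\<^sup>2 / r + (X x - Y x)\<^sup>2 / (1 - r)" for x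
          using square_add_le[OF r, of "X x - m" "Y x - X x"] by (simp add: power2_commute)
      qed
      also have "\<dots> = variance X / r + expectation (\<lambda>x. (X x - Y x)\<^sup>2) / (1 - r)"
        using iX Y(2) by (simp add: m_def)
      also have "\<dots> \<le> \<sigma>\<^sup>2 / r + \<sigma>\<^sup>2 * (1 - r)\<^sup>2 / (1 - r)"
        using v Y(3) r by (intro add_mono divide_right_mono) (auto simp: \<epsilon>_def)
      also have "\<dots> = \<sigma>\<^sup>2 * (1 / r + (1 - r))" using r by (simp add: field_simps power2_eq_square)
      also have "\<dots> \<le> \<sigma>\<^sup>2 * (1 / r\<^sup>2)"
      proof (intro mult_left_mono)
        have "r * r * (1 - r) \<le> 1 * (1 - r)" using r by (intro mult_right_mono) (auto intro: mult_le_one)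
        then have "(r + r * r * (1 - r)) / r\<^sup>2 \<le> 1 / r\<^sup>2" by (intro divide_right_mono) auto
        also have "(r + r * r * (1 - r)) / r\<^sup>2 = 1 / r + (1 - r)"
          using r by (simp add: add_divide_distrib power2_eq_square)
        finally show "1 / r + (1 - r) \<le> 1 / r\<^sup>2" .
      qed simp
      finally have vY: "variance Y \<le> (\<sigma> / r)\<^sup>2" by (simp add: power_divide)
      have "{x \<in> space M. X x \<le> m - t} \<subseteq> {x \<in> space M. Y x \<le> n - r * t} \<union> {x \<in> space M. \<eta> \<le> \<bar>X x - Y x\<bar>}"
      proof
        fix x assume x: "x \<in> {x \<in> space M. X x \<le> m - t}"
        have "2 * \<eta> = t - r * t" unfolding \<eta>_def by (simp add: right_diff_distrib mult.commute)
        with x mn show "x \<in> {x \<in> space M. Y x \<le> n - r * t} \<union> {x \<in> space M. \<eta> \<le> \<bar>X x - Y x\<bar>}"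
          by auto
      qed
      then have "prob {x \<in> space M. X x \<le> m - t} \<le>
          prob ({x \<in> space M. Y x \<le> n - r * t} \<union> {x \<in> space M. \<eta> \<le> \<bar>X x - Y x\<bar>})"
        by (intro finite_measure_mono) auto
      also have "\<dots> \<le> prob {x \<in> space M. Y x \<le> n - r * t} + prob {x \<in> space M. \<eta> \<le> \<bar>X x - Y x\<bar>}"
        by (intro measure_Un_le) auto
      also have "prob {x \<in> space M. Y x \<le> n - r * t} \<le> \<Phi> (- (r * t) / (\<sigma> / r))"
      proof -
        have "0 < r * t" "0 < \<sigma> / r" using r t \<sigma> by auto
        then show ?thesis using Y(1) vY unfolding normal_tail_def n_def by blast
      qed
      also have "prob {x \<in> space M. \<eta> \<le> \<bar>X x - Y x\<bar>} \<le> expectation (\<lambda>x. (X x - Y x)\<^sup>2) / \<eta>\<^sup>2"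
        using Y(2) \<eta> by (intro second_moment_method) auto
      also have "\<dots> \<le> (e * \<eta>\<^sup>2) / \<eta>\<^sup>2" using Y(3) by (intro divide_right_mono) (auto simp: \<epsilon>_def)
      also have "\<dots> = e" using \<eta> by simp
      finally show "prob {x \<in> space M. X x \<le> m - t} \<le> \<Phi> (- (r * t) / (\<sigma> / r)) + e" by simp
    qed
    have "((\<lambda>r. \<Phi> (- (r * t) * r / \<sigma>)) \<longlongrightarrow> \<Phi> (- (1 * t) * 1 / \<sigma>)) (at_left 1)"
      by (rule isCont_tendsto_compose[OF isCont_\<Phi>]) (intro tendsto_intros, use \<sigma> in simp)
    moreover have "\<forall>\<^sub>F r in at_left (1::real). prob {x \<in> space M. X x \<le> m - t} \<le> \<Phi> (- (r * t) * r / \<sigma>)"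
      by (rule eventually_mono[OF eventually_at_left_real[of 0 1]]) (use * in auto)
    ultimately have "prob {x \<in> space M. X x \<le> m - t} \<le> \<Phi> (- (1 * t) * 1 / \<sigma>)"
      by (intro tendsto_lowerbound[where F = "at_left (1::real)"]) auto
    then show ?thesis by simp
  qed
  then show ?thesis using X i2 unfolding normal_tail_def m_def by auto
qed

section \<open>Families of Gaussian laws\<close>

text \<open>The finite sums of \<open>seq_linear\<close> and the step integrals of
  \<open>wn_linear\<close> are both affine forms in finitely many coordinates of the observation.
  The approximating form may depend on the law \<open>P\<close>, so that one law is considered at a
  time.\<close>

definition linear_limit :: "'i set \<Rightarrow> ('i \<Rightarrow> real) measure \<Rightarrow> (('i \<Rightarrow> real) \<Rightarrow> real) \<Rightarrow> bool" where
  "linear_limit I P X \<longleftrightarrow> X \<in> borel_measurable P \<and>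
     (\<forall>\<epsilon>>0. \<exists>J w c. finite J \<and> J \<subseteq> I \<and>
        (\<integral>\<^sup>+ y. ennreal ((X y - (c + (\<Sum>j\<in>J. w j * y j)))\<^sup>2) \<partial>P) < ennreal \<epsilon>)"

text \<open>This closure property takes the place of joint normality: an interval depends on two
  estimators, and the tails of their combinations decide about coverage and selection.\<close>

lemma linear_limit_combination:
  assumes P: "sets P = sets (PiM I (\<lambda>_. borel))"
    and X: "linear_limit I P X" and Y: "linear_limit I P Y"
  shows "linear_limit I P (\<lambda>y. p * X y + q * Y y)"
proof -
  note [measurable_cong] = P
  have [measurable]: "X \<in> borel_measurable P" "Y \<in> borel_measurable P"
    using X Y by (auto simp: linear_limit_def)
  have "\<exists>J w c. finite J \<and> J \<subseteq> I \<and>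
      (\<integral>\<^sup>+ y. ennreal ((p * X y + q * Y y - (c + (\<Sum>j\<in>J. w j * y j)))\<^sup>2) \<partial>P) < ennreal \<epsilon>" if "0 < \<epsilon>" for \<epsilon>
  proof -
    \<comment> \<open>The summand 1 keeps the division by \<open>s\<close> meaningful for
      \<open>p = q = 0\<close> and makes the final inequality strict.\<close>
    define s where "s = p\<^sup>2 + q\<^sup>2 + 1"
    define \<eta> where "\<eta> = \<epsilon> / (2 * s)"
    have pq: "0 < s" by (simp add: s_def add_nonneg_pos)
    then have "0 < \<eta>" using that by (simp add: \<eta>_def)
    obtain J w c where J: "finite J" "J \<subseteq> I" and
      JX: "(\<integral>\<^sup>+ y. ennreal ((X y - (c + (\<Sum>j\<in>J. w j * y j)))\<^sup>2) \<partial>P) < ennreal \<eta>"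
      using X \<open>0 < \<eta>\<close> unfolding linear_limit_def by blast
    obtain J' w' c' where J': "finite J'" "J' \<subseteq> I" and
      JY: "(\<integral>\<^sup>+ y. ennreal ((Y y - (c' + (\<Sum>j\<in>J'. w' j * y j)))\<^sup>2) \<partial>P) < ennreal \<eta>"
      using Y \<open>0 < \<eta>\<close> unfolding linear_limit_def by blast
    define K where "K = J \<union> J'"
    define v where "v = (\<lambda>j. (if j \<in> J then p * w j else 0) + (if j \<in> J' then q * w' j else 0))"
    have K: "finite K" "K \<subseteq> I" using J J' by (auto simp: K_def)
    have [measurable]: "(\<lambda>y. \<Sum>j\<in>J. w j * y j) \<in> borel_measurable P"
      using J by (intro borel_measurable_sum borel_measurable_times) auto
    have [measurable]: "(\<lambda>y. \<Sum>j\<in>J'. w' j * y j) \<in> borel_measurable P"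
      using J' by (intro borel_measurable_sum borel_measurable_times) auto
    have v: "(\<Sum>j\<in>K. v j * y j) = p * (\<Sum>j\<in>J. w j * y j) + q * (\<Sum>j\<in>J'. w' j * y j)" for y :: "'a \<Rightarrow> real"
    proof -
      have "(\<Sum>j\<in>K. v j * y j) = (\<Sum>j\<in>K. if j \<in> J then p * w j * y j else 0) + (\<Sum>j\<in>K. if j \<in> J' then q * w' j * y j else 0)"
        unfolding v_def by (simp flip: sum.distrib) (intro sum.cong, auto simp: algebra_simps)
      also have "(\<Sum>j\<in>K. if j \<in> J then p * w j * y j else 0) = (\<Sum>j\<in>J. p * w j * y j)"
        using K by (intro sum.mono_neutral_cong_right) (auto simp: K_def)
      also have "(\<Sum>j\<in>K. if j \<in> J' then q * w' j * y j else 0) = (\<Sum>j\<in>J'. q * w' j * y j)"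
        using K by (intro sum.mono_neutral_cong_right) (auto simp: K_def)
      finally show ?thesis by (simp add: sum_distrib_left mult.assoc)
    qed
    define a where "a = (\<lambda>y. X y - (c + (\<Sum>j\<in>J. w j * y j)))"
    define b where "b = (\<lambda>y. Y y - (c' + (\<Sum>j\<in>J'. w' j * y j)))"
    have [measurable]: "a \<in> borel_measurable P" "b \<in> borel_measurable P" unfolding a_def b_def by measurable
    have "(\<integral>\<^sup>+ y. ennreal ((p * X y + q * Y y - ((p * c + q * c') + (\<Sum>j\<in>K. v j * y j)))\<^sup>2) \<partial>P)
      = (\<integral>\<^sup>+ y. ennreal ((p * a y + q * b y)\<^sup>2) \<partial>P)"
      unfolding v a_def b_def by (simp add: algebra_simps)
    also have "\<dots> \<le> (\<integral>\<^sup>+ y. ennreal (p\<^sup>2 + q\<^sup>2) * (ennreal ((a y)\<^sup>2) + ennreal ((b y)\<^sup>2)) \<partial>P)"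
    proof (rule nn_integral_mono)
      fix y
      \<comment> \<open>Lagrange's identity; dropping the second square leaves the Cauchy-Schwarz
        inequality.\<close>
      have "(p * a y + q * b y)\<^sup>2 + (p * b y - q * a y)\<^sup>2 = (p\<^sup>2 + q\<^sup>2) * ((a y)\<^sup>2 + (b y)\<^sup>2)"
        by (simp add: power2_eq_square algebra_simps)
      then have "(p * a y + q * b y)\<^sup>2 \<le> (p\<^sup>2 + q\<^sup>2) * ((a y)\<^sup>2 + (b y)\<^sup>2)"
        using zero_le_power2[of "p * b y - q * a y"] by linarith
      then show "ennreal ((p * a y + q * b y)\<^sup>2) \<le> ennreal (p\<^sup>2 + q\<^sup>2) * (ennreal ((a y)\<^sup>2) + ennreal ((b y)\<^sup>2))"
        by (simp flip: ennreal_plus ennreal_mult add: ennreal_leI)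
    qed
    also have "\<dots> = ennreal (p\<^sup>2 + q\<^sup>2) * ((\<integral>\<^sup>+ y. ennreal ((a y)\<^sup>2) \<partial>P) + (\<integral>\<^sup>+ y. ennreal ((b y)\<^sup>2) \<partial>P))"
      by (subst nn_integral_cmult) (auto simp: nn_integral_add)
    also have "\<dots> \<le> ennreal (p\<^sup>2 + q\<^sup>2) * (ennreal \<eta> + ennreal \<eta>)"
      using JX JY unfolding a_def b_def by (intro mult_left_mono add_mono) auto
    also have "\<dots> = ennreal ((p\<^sup>2 + q\<^sup>2) * (\<eta> + \<eta>))"
      using \<open>0 < \<eta>\<close> by (simp flip: ennreal_plus ennreal_mult)
    also have "\<dots> < ennreal \<epsilon>"
    proof (rule ennreal_lessI)
      have "(p\<^sup>2 + q\<^sup>2) * (\<eta> + \<eta>) < s * (\<eta> + \<eta>)" using \<open>0 < \<eta>\<close> by (simp add: s_def)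
      also have "\<dots> = \<epsilon>" using pq by (simp add: \<eta>_def field_simps)
      finally show "(p\<^sup>2 + q\<^sup>2) * (\<eta> + \<eta>) < \<epsilon>" .
    qed (use that in simp)
    finally show ?thesis using K by blast
  qed
  then show ?thesis unfolding linear_limit_def by auto
qed

text \<open>The events that can be approximated by cylinders form a sigma-algebra containing the
  generators. The approximation is simultaneous under \<open>P\<close> and \<open>Q\<close>, because
  one and the same cylinder has to stand in for \<open>A\<close> on both sides of the Neyman-Pearson
  inequality.\<close>

lemma cylinder_approximation:
  assumes "finite_measure P" "finite_measure Q"
    and sP: "sets P = sets (PiM I M)" and sQ: "sets Q = sets (PiM I M)"
    and A: "A \<in> sets (PiM I M)" and "0 < (\<epsilon>::real)"
  shows "\<exists>J X. finite J \<and> J \<subseteq> I \<and> X \<in> sets (PiM J M) \<and>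
    measure P ((A - prod_emb I M J X) \<union> (prod_emb I M J X - A)) +
    measure Q ((A - prod_emb I M J X) \<union> (prod_emb I M J X - A)) < \<epsilon>"
proof -
  interpret P: finite_measure P by fact
  interpret Q: finite_measure Q by fact
  define \<D> where "\<D> = (\<lambda>A B. (A - B) \<union> (B - A) :: ('a \<Rightarrow> 'b) set)"
  define d where "d = (\<lambda>A B. measure P (\<D> A B) + measure Q (\<D> A B))"
  define C where "C = {prod_emb I M J X | J X. finite J \<and> J \<subseteq> I \<and> X \<in> sets (PiM J M)}"
  define \<A> where "\<A> = {A \<in> sets (PiM I M). \<forall>\<epsilon>>0. \<exists>B\<in>C. d A B < \<epsilon>}"
  have spc: "space P = space (PiM I M)" using sP by (rule sets_eq_imp_space_eq)
  have C_sets: "B \<in> sets (PiM I M)" if "B \<in> C" for B using that unfolding C_def by (auto intro: measurable_prod_emb)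
  have d_nonneg: "0 \<le> d A B" for A B by (simp add: d_def)
  have C_in: "B \<in> \<A>" if "B \<in> C" for B
  proof -
    have "d B B = 0" by (simp add: d_def \<D>_def)
    then show ?thesis unfolding \<A>_def using that C_sets by force
  qed
  \<comment> \<open>This form covers both the triangle inequality for \<open>d\<close> and the
    approximation of a union by a union.\<close>
  have d_mono: "d A B \<le> d A' B' + d A'' B''"
    if "\<D> A B \<subseteq> \<D> A' B' \<union> \<D> A'' B''" "A' \<in> sets (PiM I M)" "B' \<in> sets (PiM I M)" "A'' \<in> sets (PiM I M)" "B'' \<in> sets (PiM I M)"
    for A B A' B' A'' B''
  proof -
    have s: "\<D> A' B' \<in> sets (PiM I M)" "\<D> A'' B'' \<in> sets (PiM I M)" using that by (auto simp: \<D>_def)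
    have "measure P (\<D> A B) \<le> measure P (\<D> A' B' \<union> \<D> A'' B'')"
      using s by (intro P.finite_measure_mono that) (auto simp: sP)
    also have "\<dots> \<le> measure P (\<D> A' B') + measure P (\<D> A'' B'')"
      using s by (intro measure_Un_le) (auto simp: sP)
    finally have 1: "measure P (\<D> A B) \<le> measure P (\<D> A' B') + measure P (\<D> A'' B'')" .
    have "measure Q (\<D> A B) \<le> measure Q (\<D> A' B' \<union> \<D> A'' B'')"
      using s by (intro Q.finite_measure_mono that) (auto simp: sQ)
    also have "\<dots> \<le> measure Q (\<D> A' B') + measure Q (\<D> A'' B'')"
      using s by (intro measure_Un_le) (auto simp: sQ)
    finally show ?thesis using 1 by (simp add: d_def)
  qed
  have C_Un: "A \<union> B \<in> C" if AB: "A \<in> C" "B \<in> C" for A B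
  proof -
    obtain J X J' X' where J: "finite J" "J \<subseteq> I" "X \<in> sets (PiM J M)" "A = prod_emb I M J X"
      and J': "finite J'" "J' \<subseteq> I" "X' \<in> sets (PiM J' M)" "B = prod_emb I M J' X'"
      using AB unfolding C_def by auto
    have "A \<union> B = prod_emb I M (J \<union> J') (prod_emb (J \<union> J') M J X \<union> prod_emb (J \<union> J') M J' X')"
      using J J' by (simp add: prod_emb_Un)
    moreover have "prod_emb (J \<union> J') M J X \<union> prod_emb (J \<union> J') M J' X' \<in> sets (PiM (J \<union> J') M)"
      using J J' by (intro sets.Un measurable_prod_emb) auto
    ultimately show ?thesis unfolding C_def using J J' by blast
  qed
  have C_compl: "space (PiM I M) - A \<in> C" if A: "A \<in> C" for A
  proof -
    obtain J X where J: "finite J" "J \<subseteq> I" "X \<in> sets (PiM J M)" "A = prod_emb I M J X"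
      using A unfolding C_def by auto
    have "space (PiM I M) - A = prod_emb I M J (space (PiM J M) - X)"
      using J(2) by (auto simp: J(4) prod_emb_iff space_PiM PiE_iff extensional_def subset_eq)
    then show ?thesis unfolding C_def using J by blast
  qed
  have Un: "A \<union> B \<in> \<A>" if AB: "A \<in> \<A>" "B \<in> \<A>" for A B
  proof -
    have "\<exists>E\<in>C. d (A \<union> B) E < \<epsilon>" if "0 < \<epsilon>" for \<epsilon>
    proof -
      obtain E F where E: "E \<in> C" "d A E < \<epsilon> / 2" and F: "F \<in> C" "d B F < \<epsilon> / 2"
        using AB half_gt_zero[OF \<open>0 < \<epsilon>\<close>] unfolding \<A>_def by blast
      have "d (A \<union> B) (E \<union> F) \<le> d A E + d B F"
        using AB E F C_sets by (intro d_mono) (auto simp: \<D>_def \<A>_def)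
      then show ?thesis using E F C_Un by force
    qed
    then show ?thesis using AB unfolding \<A>_def by auto
  qed
  have "sigma_sets (\<Pi>\<^sub>E i\<in>I. space (M i)) {{f \<in> \<Pi>\<^sub>E i\<in>I. space (M i). f i \<in> A} |i A. i \<in> I \<and> A \<in> sets (M i)} \<subseteq> \<A>"
  proof
    fix A assume "A \<in> sigma_sets (\<Pi>\<^sub>E i\<in>I. space (M i)) {{f \<in> \<Pi>\<^sub>E i\<in>I. space (M i). f i \<in> A} |i A. i \<in> I \<and> A \<in> sets (M i)}"
    then show "A \<in> \<A>"
    proof induction
      case (Basic a)
      then obtain i B where i: "i \<in> I" "B \<in> sets (M i)" "a = {f \<in> \<Pi>\<^sub>E i\<in>I. space (M i). f i \<in> B}" by auto
      have "a = prod_emb I M {i} (\<Pi>\<^sub>E j\<in>{i}. B)"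
        using i by (auto simp: prod_emb_iff PiE_iff)
      moreover have "(\<Pi>\<^sub>E j\<in>{i}. B) \<in> sets (PiM {i} M)" using i by (intro sets_PiM_I_finite) auto
      ultimately have "a \<in> C" unfolding C_def using i by blast
      then show ?case by (rule C_in)
    next
      case Empty
      have "{} = prod_emb I M {} {}" by simp
      then have "{} \<in> C" unfolding C_def by blast
      then show ?case by (rule C_in)
    next
      case (Compl a)
      have "\<exists>E\<in>C. d (space (PiM I M) - a) E < \<epsilon>" if e: "0 < \<epsilon>" for \<epsilon>
      proof -
        obtain E where E: "E \<in> C" "d a E < \<epsilon>" using Compl.IH e unfolding \<A>_def by auto
        have "\<D> (space (PiM I M) - a) (space (PiM I M) - E) = \<D> a E"
          using Compl.IH sets.sets_into_space[of a "PiM I M"] sets.sets_into_space[OF C_sets[OF E(1)]]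
          unfolding \<D>_def \<A>_def by auto
        then have "d (space (PiM I M) - a) (space (PiM I M) - E) = d a E" by (simp add: d_def)
        then show ?thesis using E C_compl by force
      qed
      then show ?case using Compl.IH unfolding \<A>_def by (auto simp: space_PiM[symmetric])
    next
      case (Union a)
      \<comment> \<open>Countable unions are reached through finite ones: \<open>b\<close> increases
        to the union, some \<open>b n\<close> is within half of the tolerance, and a cylinder close
        to \<open>b n\<close> does the rest.\<close>
      define b where "b = (\<lambda>n. \<Union>i\<le>n. a i)"
      have b: "b n \<in> \<A>" for n
        by (induction n) (auto simp: b_def atMost_Suc Union.IH intro: Un)
      have bs: "b n \<in> sets (PiM I M)" for n using b unfolding \<A>_def by auto
      have bU: "(\<Union>n. b n) = (\<Union>i. a i)" unfolding b_def by auto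
      have Us: "(\<Union>i. a i) \<in> sets (PiM I M)" unfolding bU[symmetric] using bs by blast
      have "incseq b" unfolding b_def incseq_def by force
      have "(\<lambda>n. measure P (b n) + measure Q (b n)) \<longlonglongrightarrow> measure P (\<Union>n. b n) + measure Q (\<Union>n. b n)"
        using bs \<open>incseq b\<close>
        by (intro tendsto_add P.finite_Lim_measure_incseq Q.finite_Lim_measure_incseq) (auto simp: sP sQ)
      then have lim: "(\<lambda>n. measure P (b n) + measure Q (b n)) \<longlonglongrightarrow> measure P (\<Union>i. a i) + measure Q (\<Union>i. a i)"
        by (simp only: bU)
      have "\<exists>E\<in>C. d (\<Union>i. a i) E < \<epsilon>" if e: "0 < \<epsilon>" for \<epsilon>
      proof -
        have "eventually (\<lambda>n. measure P (\<Union>i. a i) + measure Q (\<Union>i. a i) - \<epsilon> / 2 < measure P (b n) + measure Q (b n)) sequentially"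
          using e by (intro order_tendstoD(1)[OF lim]) simp
        then obtain n where n: "measure P (\<Union>i. a i) + measure Q (\<Union>i. a i) - \<epsilon> / 2 < measure P (b n) + measure Q (b n)"
          by (auto simp: eventually_sequentially)
        have sub: "b n \<subseteq> (\<Union>i. a i)" unfolding b_def by auto
        have "\<D> (\<Union>i. a i) (b n) = (\<Union>i. a i) - b n" using sub by (auto simp: \<D>_def)
        then have "d (\<Union>i. a i) (b n) = measure P (\<Union>i. a i) - measure P (b n) + (measure Q (\<Union>i. a i) - measure Q (b n))"
          unfolding d_def using Us bs[of n] sub
          by (simp add: P.finite_measure_Diff Q.finite_measure_Diff sP sQ)
        with n have 1: "d (\<Union>i. a i) (b n) < \<epsilon> / 2" by simp
        obtain E where E: "E \<in> C" "d (b n) E < \<epsilon> / 2"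
          using b[of n] half_gt_zero[OF e] unfolding \<A>_def by blast
        have "d (\<Union>i. a i) E \<le> d (\<Union>i. a i) (b n) + d (b n) E"
          using Us bs[of n] C_sets[OF E(1)] by (intro d_mono) (auto simp: \<D>_def)
        with 1 E show ?thesis by force
      qed
      then show ?case using Us unfolding \<A>_def by auto
    qed
  qed
  then have "A \<in> \<A>" using A unfolding sets_PiM_single by blast
  then obtain E where "E \<in> C" "d A E < \<epsilon>" using \<open>0 < \<epsilon>\<close> unfolding \<A>_def by auto
  then show ?thesis unfolding C_def d_def \<D>_def by auto
qed

text \<open>In \<open>fidi\<close> the matrix \<open>B\<close> is chosen before the truth, so the
  truth only moves the mean vector of the Gaussian coordinates. The distance \<open>\<rho>\<close>
  dominates the distance of mean vectors for all finite \<open>J\<close> at once; this uniformity is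
  what lets an inequality pass to the whole observation.\<close>

locale gaussian_family =
  fixes I :: "'i set" and L :: "('i \<Rightarrow> real) set" and P :: "('i \<Rightarrow> real) \<Rightarrow> ('i \<Rightarrow> real) measure"
    and \<rho> :: "('i \<Rightarrow> real) \<Rightarrow> ('i \<Rightarrow> real) \<Rightarrow> real"
  assumes prob: "f \<in> L \<Longrightarrow> prob_space (P f)"
    and sets_P: "f \<in> L \<Longrightarrow> sets (P f) = sets (PiM I (\<lambda>_. borel))"
    and \<rho>_nonneg: "0 \<le> \<rho> f g"
    and fidi: "finite J \<Longrightarrow> J \<subseteq> I \<Longrightarrow> \<exists>K B \<mu>.
       (\<forall>f\<in>L. distr (P f) (PiM J (\<lambda>_. borel)) (\<lambda>y. restrict y J) =
          distr (gprod K (\<mu> f)) (PiM J (\<lambda>_. borel)) (\<lambda>u. \<lambda>j\<in>J. \<Sum>k<K. B j k * u k)) \<and>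
       (\<forall>f\<in>L. \<forall>g\<in>L. (\<Sum>k<K. (\<mu> f k - \<mu> g k)\<^sup>2) \<le> (\<rho> f g)\<^sup>2)"
begin

lemma measurable_linear_map: "(\<lambda>u. \<lambda>j\<in>J. \<Sum>k<K. B j k * u k) \<in> measurable (gprod K \<mu>) (PiM J (\<lambda>_. borel))"
  by measurable

lemma normal_tail_finite:
  assumes f: "f \<in> L" and J: "finite J" "J \<subseteq> I"
  shows "normal_tail (P f) (\<lambda>y. c + (\<Sum>j\<in>J. w j * y j))"
proof -
  note [measurable_cong] = sets_P[OF f]
  interpret prob_space "P f" by (rule prob[OF f])
  obtain K B \<mu> where D: "distr (P f) (PiM J (\<lambda>_. borel)) (\<lambda>y. restrict y J) =
          distr (gprod K (\<mu> f)) (PiM J (\<lambda>_. borel)) (\<lambda>u. \<lambda>j\<in>J. \<Sum>k<K. B j k * u k)"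
    using fidi[OF J] f by blast
  interpret G: prob_space "gprod K (\<mu> f)" by (rule prob_space_gprod)
  have r[measurable]: "(\<lambda>y. restrict y J) \<in> measurable (P f) (PiM J (\<lambda>_. borel))"
    using J by (simp add: sets_P[OF f] cong: measurable_cong_sets) (rule measurable_restrict_subset)
  define X where "X = (\<lambda>y::'i \<Rightarrow> real. c + (\<Sum>j\<in>J. w j * y j))"
  have [measurable]: "X \<in> borel_measurable (PiM J (\<lambda>_. borel))"
    unfolding X_def by measurable
  define \<beta> where "\<beta> = (\<lambda>k. \<Sum>j\<in>J. w j * B j k)"
  have "normal_tail (P f) (\<lambda>y. c + (\<Sum>j\<in>J. w j * y j)) \<longleftrightarrow> normal_tail (P f) (\<lambda>y. X (restrict y J))"
    by (simp add: X_def)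
  also have "\<dots> \<longleftrightarrow> normal_tail (distr (P f) (PiM J (\<lambda>_. borel)) (\<lambda>y. restrict y J)) X"
    by (rule normal_tail_distr[symmetric]) measurable
  also have "\<dots> \<longleftrightarrow> normal_tail (gprod K (\<mu> f)) (\<lambda>u. X (\<lambda>j\<in>J. \<Sum>k<K. B j k * u k))"
    unfolding D by (rule normal_tail_distr) measurable
  also have "(\<lambda>u. X (\<lambda>j\<in>J. \<Sum>k<K. B j k * u k)) = (\<lambda>u. c + (\<Sum>k<K. \<beta> k * u k))"
  proof
    fix u
    have "(\<Sum>j\<in>J. w j * (\<Sum>k<K. B j k * u k)) = (\<Sum>j\<in>J. \<Sum>k<K. w j * B j k * u k)"
      by (simp add: sum_distrib_left mult.assoc)
    also have "\<dots> = (\<Sum>k<K. \<Sum>j\<in>J. w j * B j k * u k)" by (rule sum.swap)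
    also have "\<dots> = (\<Sum>k<K. \<beta> k * u k)" by (simp add: \<beta>_def sum_distrib_right)
    finally show "X (\<lambda>j\<in>J. \<Sum>k<K. B j k * u k) = c + (\<Sum>k<K. \<beta> k * u k)" by (simp add: X_def)
  qed
  also have "normal_tail (gprod K (\<mu> f)) (\<lambda>u. c + (\<Sum>k<K. \<beta> k * u k))"
  proof (cases "\<exists>k<K. \<beta> k \<noteq> 0")
    case False
    then have "(\<lambda>u. c + (\<Sum>k<K. \<beta> k * u k)) = (\<lambda>_. c)" by auto
    then show ?thesis using normal_tail_const[OF G.prob_space_axioms] by simp
  next
    case True
    then obtain k where "k < K" "\<beta> k \<noteq> 0" by blast
    then have "0 < (\<Sum>k<K. (\<beta> k)\<^sup>2)" by (intro sum_pos2[of _ k]) simp_all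
    then have s: "0 < sqrt (\<Sum>k<K. (\<beta> k)\<^sup>2)" by simp
    from G.normal_density_affine[OF gprod_linear_normal[OF True] s, of 1 c]
    have "distributed (gprod K (\<mu> f)) lborel (\<lambda>u. c + (\<Sum>k<K. \<beta> k * u k))
      (normal_density (c + (\<Sum>k<K. \<beta> k * \<mu> f k)) (sqrt (\<Sum>k<K. (\<beta> k)\<^sup>2)))" by simp
    then show ?thesis by (rule normal_tail_normal[OF G.prob_space_axioms s])
  qed
  finally show ?thesis by simp
qed

lemma normal_tail_linear_limit:
  assumes f: "f \<in> L" and X: "linear_limit I (P f) X"
  shows "normal_tail (P f) X"
proof (rule normal_tail_limit[OF prob[OF f]])
  show "X \<in> borel_measurable (P f)" using X by (simp add: linear_limit_def)
  fix \<epsilon> :: real assume "0 < \<epsilon>"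
  then show "\<exists>Y. normal_tail (P f) Y \<and> (\<integral>\<^sup>+ y. ennreal ((X y - Y y)\<^sup>2) \<partial>P f) < ennreal \<epsilon>"
    using X normal_tail_finite[OF f] unfolding linear_limit_def by blast
qed

lemma measure_cylinder:
  assumes f: "f \<in> L" and J: "J \<subseteq> I" "X \<in> sets (PiM J (\<lambda>_. borel))"
    and D: "distr (P f) (PiM J (\<lambda>_. borel)) (\<lambda>y. restrict y J) =
          distr (gprod K \<mu>) (PiM J (\<lambda>_. borel)) (\<lambda>u. \<lambda>j\<in>J. \<Sum>k<K. B j k * u k)"
  shows "measure (P f) (prod_emb I (\<lambda>_. borel) J X) =
    measure (gprod K \<mu>) ((\<lambda>u. \<lambda>j\<in>J. \<Sum>k<K. B j k * u k) -` X \<inter> space (PiM {..<K} (\<lambda>_. borel)))"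
proof -
  have sp: "space (P f) = space (PiM I (\<lambda>_. borel))" using sets_P[OF f] by (rule sets_eq_imp_space_eq)
  have spG: "space (gprod K \<mu>) = space (PiM {..<K} (\<lambda>_. borel))" by (rule sets_eq_imp_space_eq[OF sets_gprod])
  have r: "(\<lambda>y. restrict y J) \<in> measurable (P f) (PiM J (\<lambda>_. borel))"
    using J by (simp add: sets_P[OF f] cong: measurable_cong_sets) (rule measurable_restrict_subset)
  have "measure (P f) (prod_emb I (\<lambda>_. borel) J X) = measure (distr (P f) (PiM J (\<lambda>_. borel)) (\<lambda>y. restrict y J)) X"
    using r J by (subst measure_distr) (simp_all add: prod_emb_def sp space_PiM)
  also have "\<dots> = measure (gprod K \<mu>) ((\<lambda>u. \<lambda>j\<in>J. \<Sum>k<K. B j k * u k) -` X \<inter> space (PiM {..<K} (\<lambda>_. borel)))"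
    unfolding D using J measurable_linear_map by (subst measure_distr) (simp_all add: spG)
  finally show ?thesis .
qed

text \<open>The multiplier \<open>\<kappa>\<close> of the finite-dimensional Neyman-Pearson inequality is bounded uniformly over all
  finite-dimensional projections.  The inequality therefore passes from cylinders to all events, and no
  likelihood ratio on the infinite-dimensional space is needed.\<close>

lemma half_le_measure:
  assumes f: "f \<in> L" and g: "g \<in> L" and A: "A \<in> sets (PiM I (\<lambda>_. borel))"
    and t: "\<rho> f g \<le> t" and m: "\<Phi> t \<le> measure (P g) A"
  shows "1/2 \<le> measure (P f) A"
proof (rule field_le_epsilon)
  fix e :: real assume e: "0 < e"
  interpret F: prob_space "P f" by (rule prob[OF f])
  interpret G: prob_space "P g" by (rule prob[OF g])
  have t0: "0 \<le> t" using t \<rho>_nonneg[of f g] by linarith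
  \<comment> \<open>Replacing \<open>A\<close> by a cylinder costs at most \<open>\<epsilon>\<close>
    under \<open>P f\<close> and at most \<open>\<kappa> * \<epsilon>\<close> through
    \<open>P g\<close>, where \<open>\<kappa> \<le> exp (\<rho> f g * t)\<close>. Together this is
    at most \<open>e\<close>.\<close>
  define \<epsilon> where "\<epsilon> = e / (1 + exp (\<rho> f g * t))"
  have "0 < \<epsilon>" using e by (simp add: \<epsilon>_def add_pos_pos)
  from cylinder_approximation[OF F.finite_measure_axioms G.finite_measure_axioms sets_P[OF f] sets_P[OF g] A this]
  obtain J X where J: "finite J" "J \<subseteq> I" "X \<in> sets (PiM J (\<lambda>_. borel))"
    and *: "measure (P f) ((A - prod_emb I (\<lambda>_. borel) J X) \<union> (prod_emb I (\<lambda>_. borel) J X - A)) +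
      measure (P g) ((A - prod_emb I (\<lambda>_. borel) J X) \<union> (prod_emb I (\<lambda>_. borel) J X - A)) < \<epsilon>"
    by blast
  define C where "C = prod_emb I (\<lambda>_. borel :: real measure) J X"
  have C: "C \<in> sets (PiM I (\<lambda>_. borel))" unfolding C_def using J by (intro measurable_prod_emb) auto
  have close: "\<bar>measure N A - measure N C\<bar> \<le> measure N ((A - C) \<union> (C - A))"
    if "finite_measure N" "sets N = sets (PiM I (\<lambda>_. borel))" for N
  proof -
    interpret N: finite_measure N by fact
    have "measure N A \<le> measure N (C \<union> ((A - C) \<union> (C - A)))"
      using A C that(2) by (intro N.finite_measure_mono) auto
    also have "\<dots> \<le> measure N C + measure N ((A - C) \<union> (C - A))"
      using A C that(2) by (intro measure_Un_le) auto
    finally have 1: "measure N A \<le> measure N C + measure N ((A - C) \<union> (C - A))" .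
    have "measure N C \<le> measure N (A \<union> ((A - C) \<union> (C - A)))"
      using A C that(2) by (intro N.finite_measure_mono) auto
    also have "\<dots> \<le> measure N A + measure N ((A - C) \<union> (C - A))"
      using A C that(2) by (intro measure_Un_le) auto
    finally show ?thesis using 1 by linarith
  qed
  have cf: "measure (P f) C - \<epsilon> \<le> measure (P f) A" and cg: "measure (P g) A - \<epsilon> \<le> measure (P g) C"
    using close[OF F.finite_measure_axioms sets_P[OF f]] close[OF G.finite_measure_axioms sets_P[OF g]] *
      measure_nonneg[of "P f" "(A - C) \<union> (C - A)"] measure_nonneg[of "P g" "(A - C) \<union> (C - A)"]
    unfolding C_def by linarith+
  obtain K B \<mu> where D: "\<forall>f\<in>L. distr (P f) (PiM J (\<lambda>_. borel)) (\<lambda>y. restrict y J) =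
          distr (gprod K (\<mu> f)) (PiM J (\<lambda>_. borel)) (\<lambda>u. \<lambda>j\<in>J. \<Sum>k<K. B j k * u k)"
     and \<mu>: "\<forall>f\<in>L. \<forall>g\<in>L. (\<Sum>k<K. (\<mu> f k - \<mu> g k)\<^sup>2) \<le> (\<rho> f g)\<^sup>2"
    using fidi[OF J(1,2)] by blast
  define U where "U = (\<lambda>u. \<lambda>j\<in>J. \<Sum>k<K. B j k * u k) -` X \<inter> space (PiM {..<K} (\<lambda>_. borel))"
  have U: "U \<in> sets (PiM {..<K} (\<lambda>_. borel))"
    unfolding U_def using J by (intro measurable_sets) measurable
  have CU: "measure (P h) C = measure (gprod K (\<mu> h)) U" if "h \<in> L" for h
    unfolding C_def U_def using that J D by (intro measure_cylinder) auto
  obtain \<kappa> where \<kappa>: "0 \<le> \<kappa>" "\<kappa> \<le> exp (\<rho> f g * t)"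
      "\<Phi> (t - \<rho> f g) + \<kappa> * (measure (P g) C - \<Phi> t) \<le> measure (P f) C"
    using gprod_neyman_pearson[OF U _ \<rho>_nonneg[of f g] t0, of "\<mu> f" "\<mu> g"] \<mu> f g CU by auto
  have "1/2 \<le> \<Phi> (t - \<rho> f g)" using \<Phi>_mono[of 0 "t - \<rho> f g"] t \<Phi>_0 by simp
  moreover have "- (exp (\<rho> f g * t) * \<epsilon>) \<le> \<kappa> * (measure (P g) C - \<Phi> t)"
  proof -
    have "\<kappa> * (- \<epsilon>) \<le> \<kappa> * (measure (P g) C - \<Phi> t)" using cg m \<kappa> by (intro mult_left_mono) auto
    moreover have "\<kappa> * \<epsilon> \<le> exp (\<rho> f g * t) * \<epsilon>" using \<kappa> \<open>0 < \<epsilon>\<close> by (intro mult_right_mono) auto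
    ultimately show ?thesis by simp
  qed
  ultimately have "1/2 \<le> measure (P f) A + (1 + exp (\<rho> f g * t)) * \<epsilon>"
    using cf \<kappa>(3) by (simp add: algebra_simps)
  also have "(1 + exp (\<rho> f g * t)) * \<epsilon> = e"
  proof -
    have "1 + exp (\<rho> f g * t) \<noteq> 0" using exp_gt_zero[of "\<rho> f g * t"] by linarith
    then show ?thesis by (simp add: \<epsilon>_def)
  qed
  finally show "1/2 \<le> measure (P f) A + e" .
qed

end

section \<open>The sequence model\<close>

text \<open>Shared by both models: a representation of the observed coordinates by independent
  unit-variance variables \<open>U\<close> yields the form required by \<open>fidi\<close>. It is
  asked for only almost surely because Brownian motion starts at 0 only almost surely.\<close>

lemma (in prob_space) finite_dimensional_law:
  assumes J: "J \<subseteq> I" and Y: "\<And>i. i \<in> I \<Longrightarrow> Y i \<in> borel_measurable M"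
    and U: "indep_vars (\<lambda>_. borel) U {..<K}"
    and D: "\<And>k. k < K \<Longrightarrow> distr M borel (U k) = density lborel (normal_density (\<mu> k) 1)"
    and YU: "AE x in M. \<forall>j\<in>J. Y j x = (\<Sum>k<K. B j k * U k x)"
  shows "distr (distr M (PiM I (\<lambda>_. borel)) (\<lambda>x. \<lambda>i\<in>I. Y i x)) (PiM J (\<lambda>_. borel)) (\<lambda>y. restrict y J) =
    distr (gprod K \<mu>) (PiM J (\<lambda>_. borel)) (\<lambda>u. \<lambda>j\<in>J. \<Sum>k<K. B j k * (u k :: real))"
proof -
  have Um: "U k \<in> borel_measurable M" if "k < K" for k
    using indep_vars_def U that by (auto simp: indep_vars_def)
  have V: "(\<lambda>x. \<lambda>k\<in>{..<K}. U k x) \<in> measurable M (PiM {..<K} (\<lambda>_. borel))"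
    using Um by (intro measurable_restrict) auto
  have G: "distr M (PiM {..<K} (\<lambda>_. borel)) (\<lambda>x. \<lambda>k\<in>{..<K}. U k x) = gprod K \<mu>"
  proof (cases "K = 0")
    \<comment> \<open>Without coordinates, both sides are probability measures on a space with a
      single point.\<close>
    case True
    interpret product_sigma_finite "\<lambda>k. density lborel (normal_density (\<mu> k) 1)"
      by (intro product_sigma_finite.intro prob_space_imp_sigma_finite prob_space_normal_density) simp
    show ?thesis unfolding gprod_def
    proof (rule PiM_eqI)
      show "sets (distr M (PiM {..<K} (\<lambda>_. borel)) (\<lambda>x. \<lambda>k\<in>{..<K}. U k x)) =
        sets (PiM {..<K} (\<lambda>k. density lborel (normal_density (\<mu> k) 1)))"
        using sets_gprod[of K \<mu>] by (simp add: gprod_def)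
      fix A :: "nat \<Rightarrow> real set"
      have "Pi\<^sub>E {..<K} A = space (PiM {..<K} (\<lambda>_. borel :: real measure))"
        using True by (simp add: space_PiM)
      moreover have "prob_space (distr M (PiM {..<K} (\<lambda>_. borel)) (\<lambda>x. \<lambda>k\<in>{..<K}. U k x))"
        using V by (rule prob_space_distr)
      ultimately show "emeasure (distr M (PiM {..<K} (\<lambda>_. borel)) (\<lambda>x. \<lambda>k\<in>{..<K}. U k x)) (Pi\<^sub>E {..<K} A)
         = (\<Prod>k<K. emeasure (density lborel (normal_density (\<mu> k) 1)) (A k))"
        using True prob_space.emeasure_space_1 by fastforce
    qed simp
  next
    case False
    have "distr M (PiM {..<K} (\<lambda>_. borel)) (\<lambda>x. \<lambda>k\<in>{..<K}. U k x) = PiM {..<K} (\<lambda>k. distr M borel (U k))"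
      using U False Um by (subst indep_vars_iff_distr_eq_PiM'[symmetric]) auto
    also have "\<dots> = gprod K \<mu>" unfolding gprod_def using D by (intro PiM_cong) auto
    finally show ?thesis .
  qed
  have Ym: "(\<lambda>x. \<lambda>i\<in>I. Y i x) \<in> measurable M (PiM I (\<lambda>_. borel))" using Y by (intro measurable_restrict)
  have R: "(\<lambda>y. restrict y J) \<in> measurable (PiM I (\<lambda>_. borel)) (PiM J (\<lambda>_. borel))"
    using J by (rule measurable_restrict_subset)
  have "distr (distr M (PiM I (\<lambda>_. borel)) (\<lambda>x. \<lambda>i\<in>I. Y i x)) (PiM J (\<lambda>_. borel)) (\<lambda>y. restrict y J)
    = distr M (PiM J (\<lambda>_. borel)) (\<lambda>x. restrict (\<lambda>i\<in>I. Y i x) J)"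
    by (subst distr_distr[OF R Ym]) (simp only: comp_def)
  also have "\<dots> = distr M (PiM J (\<lambda>_. borel)) (\<lambda>x. \<lambda>j\<in>J. \<Sum>k<K. B j k * (\<lambda>k\<in>{..<K}. U k x) k)"
  proof (rule distr_cong_AE)
    show "AE x in M. restrict (\<lambda>i\<in>I. Y i x) J = (\<lambda>j\<in>J. \<Sum>k<K. B j k * (\<lambda>k\<in>{..<K}. U k x) k)"
      using YU by eventually_elim (use J in \<open>auto simp: fun_eq_iff restrict_def\<close>)
    show "(\<lambda>x. restrict (\<lambda>i\<in>I. Y i x) J) \<in> measurable M (PiM J (\<lambda>_. borel))"
      using measurable_comp[OF Ym R] by (simp add: comp_def)
    show "(\<lambda>x. \<lambda>j\<in>J. \<Sum>k<K. B j k * (\<lambda>k\<in>{..<K}. U k x) k) \<in> measurable M (PiM J (\<lambda>_. borel))"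
      using Um by (intro measurable_restrict borel_measurable_sum borel_measurable_times) auto
  qed simp_all
  also have "\<dots> = distr (distr M (PiM {..<K} (\<lambda>_. borel)) (\<lambda>x. \<lambda>k\<in>{..<K}. U k x)) (PiM J (\<lambda>_. borel))
      (\<lambda>u. \<lambda>j\<in>J. \<Sum>k<K. B j k * u k)"
    using V by (subst distr_distr) (auto simp: comp_def)
  finally show ?thesis unfolding G .
qed

lemma L2_diff_integrable:
  assumes "f \<in> L2 \<nu>" "g \<in> L2 \<nu>"
  shows "integrable \<nu> (\<lambda>t. (g t - f t)\<^sup>2)"
proof (rule Bochner_Integration.integrable_bound)
  have [measurable]: "f \<in> borel_measurable \<nu>" "g \<in> borel_measurable \<nu>" using assms by (auto simp: L2_def)
  show "integrable \<nu> (\<lambda>t. 2 * (g t)\<^sup>2 + 2 * (f t)\<^sup>2)" using assms by (auto simp: L2_def)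
  show "(\<lambda>t. (g t - f t)\<^sup>2) \<in> borel_measurable \<nu>" by measurable
  have "(g t - f t)\<^sup>2 \<le> 2 * (g t)\<^sup>2 + 2 * (f t)\<^sup>2" for t
    using square_add_le[of "1/2" "g t" "- f t"] by simp
  then show "AE t in \<nu>. norm ((g t - f t)\<^sup>2) \<le> norm (2 * (g t)\<^sup>2 + 2 * (f t)\<^sup>2)" by simp
qed

lemma L2_dist_square: "(L2_dist \<nu> f g)\<^sup>2 = integral\<^sup>L \<nu> (\<lambda>t. (g t - f t)\<^sup>2)"
  unfolding L2_dist_def by simp

lemma prob_space_std_PiM: "prob_space (PiM I (\<lambda>_. std_normal_distribution))"
  by (intro prob_space_PiM prob_space_normal_density) simp

lemma indep_std_PiM:
  fixes K :: nat
  assumes e: "inj_on e {..<K}" "e ` {..<K} \<subseteq> I"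
  shows "prob_space.indep_vars (PiM I (\<lambda>_. std_normal_distribution)) (\<lambda>_. borel) (\<lambda>k z. z (e k)) {..<K}"
proof -
  interpret prob_space "PiM I (\<lambda>_. std_normal_distribution)" by (rule prob_space_std_PiM)
  show ?thesis
  proof (cases "K = 0")
    case True
    show ?thesis unfolding indep_vars_def indep_sets_def using True by simp
  next
    case False
    have eI: "e k \<in> I" if "k < K" for k using e that by auto
    have comp: "distr (PiM I (\<lambda>_. std_normal_distribution)) borel (\<lambda>z. z (e k)) = std_normal_distribution" if "k < K" for k
    proof -
      have "distr (PiM I (\<lambda>_. std_normal_distribution)) borel (\<lambda>z. z (e k))
        = distr (PiM I (\<lambda>_. std_normal_distribution)) std_normal_distribution (\<lambda>z. z (e k))"
        by (rule distr_cong) auto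
      also have "\<dots> = std_normal_distribution"
        by (intro distr_PiM_component prob_space_normal_density eI that) auto
      finally show ?thesis .
    qed
    have "distr (PiM I (\<lambda>_. std_normal_distribution)) (PiM {..<K} (\<lambda>_. borel)) (\<lambda>z. \<lambda>k\<in>{..<K}. z (e k))
      = distr (PiM I (\<lambda>_. std_normal_distribution)) (PiM {..<K} (\<lambda>_. std_normal_distribution)) (\<lambda>z. \<lambda>k\<in>{..<K}. z (e k))"
      by (rule distr_cong) (auto intro!: sets_PiM_cong)
    also have "\<dots> = PiM {..<K} (\<lambda>_. std_normal_distribution)"
      using e by (intro distr_PiM_reindex prob_space_normal_density) auto
    also have "\<dots> = PiM {..<K} (\<lambda>k. distr (PiM I (\<lambda>_. std_normal_distribution)) borel (\<lambda>z. z (e k)))"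
      by (intro PiM_cong) (auto simp: comp)
    finally show ?thesis
      using False eI by (subst indep_vars_iff_distr_eq_PiM') auto
  qed
qed

lemma gaussian_family_sequence:
  fixes I :: "'i set"
  assumes n: "0 < n"
  shows "gaussian_family I (L2 (count_space I)) (seq_law n I) (\<lambda>f g. sqrt n * L2_dist (count_space I) f g)"
proof (rule gaussian_family.intro)
  interpret prob_space "PiM I (\<lambda>_. std_normal_distribution)" by (rule prob_space_std_PiM)
  have m: "(\<lambda>z. \<lambda>i\<in>I. f i + z i / sqrt (real n)) \<in>
      measurable (PiM I (\<lambda>_. std_normal_distribution)) (PiM I (\<lambda>_. borel))" for f
    by (rule measurable_restrict) auto
  show "prob_space (seq_law n I f)" for f unfolding seq_law_def obs_def using m
    by (intro prob_space_distr) simp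
  show "sets (seq_law n I f) = sets (PiM I (\<lambda>_. borel))" for f
    unfolding seq_law_def obs_def by simp
  show "0 \<le> sqrt n * L2_dist (count_space I) f g" for f g
    by (simp add: L2_dist_def)
  fix J assume J: "finite J" "J \<subseteq> I"
  define K where "K = card J"
  obtain e where e: "bij_betw e {..<K} J"
    using ex_bij_betw_nat_finite[OF J(1)] unfolding K_def atLeast0LessThan by auto
  have eJ: "e k \<in> J" if "k < K" for k using e that by (auto simp: bij_betw_def)
  \<comment> \<open>The entries \<open>sqrt n * y (e k)\<close> have unit variance; \<open>B\<close>
    undoes this scaling and the enumeration \<open>e\<close> of \<open>J\<close>.\<close>
  define B where "B = (\<lambda>j k. if e k = j then 1 / sqrt (real n) else 0)"
  define \<mu> where "\<mu> = (\<lambda>f k. sqrt (real n) * f (e k) :: real)"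
  have "distr (seq_law n I f) (PiM J (\<lambda>_. borel)) (\<lambda>y. restrict y J) =
          distr (gprod K (\<mu> f)) (PiM J (\<lambda>_. borel)) (\<lambda>u. \<lambda>j\<in>J. \<Sum>k<K. B j k * u k)" for f
    unfolding seq_law_def obs_def space_count_space
  proof (rule finite_dimensional_law[OF J(2)])
    show "(\<lambda>z. f i + z i / sqrt (real n)) \<in> borel_measurable (PiM I (\<lambda>_. std_normal_distribution))" if "i \<in> I" for i
      using that by auto
    have i0: "indep_vars (\<lambda>_. borel) (\<lambda>k z. z (e k)) {..<K}"
      using e J by (intro indep_std_PiM) (auto simp: bij_betw_def)
    show "indep_vars (\<lambda>_. borel) (\<lambda>k z. \<mu> f k + 1 * z (e k)) {..<K}"
      by (rule indep_vars_compose2[OF i0]) auto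
    show "distr (PiM I (\<lambda>_. std_normal_distribution)) borel (\<lambda>z. \<mu> f k + 1 * z (e k)) = density lborel (normal_density (\<mu> f k) 1)"
      if k: "k < K" for k
    proof -
      have "distr (PiM I (\<lambda>_. std_normal_distribution)) lborel (\<lambda>z. z (e k))
        = distr (PiM I (\<lambda>_. std_normal_distribution)) std_normal_distribution (\<lambda>z. z (e k))"
        by (rule distr_cong) auto
      also have "\<dots> = std_normal_distribution"
        using eJ[OF k] J by (intro distr_PiM_component prob_space_normal_density) auto
      finally have "distributed (PiM I (\<lambda>_. std_normal_distribution)) lborel (\<lambda>z. z (e k)) (normal_density 0 1)"
        unfolding distributed_def using eJ[OF k] J by auto
      from normal_density_affine[OF this, of 1 "\<mu> f k"]
      have "distributed (PiM I (\<lambda>_. std_normal_distribution)) lborel (\<lambda>z. \<mu> f k + 1 * z (e k)) (normal_density (\<mu> f k) 1)"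
        by simp
      then have "distr (PiM I (\<lambda>_. std_normal_distribution)) lborel (\<lambda>z. \<mu> f k + 1 * z (e k)) = density lborel (normal_density (\<mu> f k) 1)"
        by (rule distributed_distr_eq_density)
      then show ?thesis by (simp cong: distr_cong)
    qed
    show "AE z in PiM I (\<lambda>_. std_normal_distribution). \<forall>j\<in>J. f j + z j / sqrt (real n) = (\<Sum>k<K. B j k * (\<mu> f k + 1 * z (e k)))"
    proof (rule AE_I2, rule ballI)
      fix z :: "'i \<Rightarrow> real" and j assume "j \<in> J"
      have "(\<Sum>k<K. B j k * (\<mu> f k + 1 * z (e k))) = (\<Sum>k<K. (if e k = j then f j + z j / sqrt (real n) else 0))"
        using n by (intro sum.cong) (auto simp: B_def \<mu>_def field_simps)
      also have "\<dots> = (\<Sum>i\<in>J. (if i = j then f j + z j / sqrt (real n) else 0))"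
        by (rule sum.reindex_bij_betw[OF e])
      also have "\<dots> = f j + z j / sqrt (real n)" using \<open>j \<in> J\<close> J by simp
      finally show "f j + z j / sqrt (real n) = (\<Sum>k<K. B j k * (\<mu> f k + 1 * z (e k)))" ..
    qed
  qed
  moreover have "(\<Sum>k<K. (\<mu> f k - \<mu> g k)\<^sup>2) \<le> (sqrt n * L2_dist (count_space I) f g)\<^sup>2"
    if f: "f \<in> L2 (count_space I)" and g: "g \<in> L2 (count_space I)" for f g
  proof -
    have int: "integrable (count_space I) (\<lambda>t. (g t - f t)\<^sup>2)" by (rule L2_diff_integrable[OF f g])
    have "(\<Sum>k<K. (\<mu> f k - \<mu> g k)\<^sup>2) = (\<Sum>k<K. n * (g (e k) - f (e k))\<^sup>2)"
      by (intro sum.cong) (auto simp: \<mu>_def power_mult_distrib power2_commute simp flip: right_diff_distrib)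
    also have "\<dots> = n * (\<Sum>j\<in>J. (g j - f j)\<^sup>2)"
      using sum.reindex_bij_betw[OF e, of "\<lambda>j. (g j - f j)\<^sup>2"] by (simp flip: sum_distrib_left)
    finally have 1: "(\<Sum>k<K. (\<mu> f k - \<mu> g k)\<^sup>2) = n * (\<Sum>j\<in>J. (g j - f j)\<^sup>2)" .
    \<comment> \<open>The partial sum of squares is the integral over \<open>J\<close> and hence
      dominated by the full squared distance, whatever \<open>J\<close> is.\<close>
    have "(\<Sum>j\<in>J. (g j - f j)\<^sup>2) = (\<integral>t. (g t - f t)\<^sup>2 * indicator J t \<partial>count_space I)"
      using J by (subst lebesgue_integral_count_space_finite_support)
        (auto intro!: sum.mono_neutral_cong_right simp: indicator_def intro: finite_subset[OF _ J(1)] split: if_splits)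
    also have "\<dots> \<le> (\<integral>t. (g t - f t)\<^sup>2 \<partial>count_space I)"
    proof (rule integral_mono[OF _ int])
      show "integrable (count_space I) (\<lambda>t. (g t - f t)\<^sup>2 * indicator J t)"
        using integrable_real_mult_indicator[OF _ int, of J] J by simp
    qed (simp add: indicator_def)
    finally show ?thesis
      unfolding 1 by (simp add: power_mult_distrib L2_dist_square mult_left_mono)
  qed
  ultimately show "\<exists>K B \<mu>.
       (\<forall>f\<in>L2 (count_space I). distr (seq_law n I f) (PiM J (\<lambda>_. borel)) (\<lambda>y. restrict y J) =
          distr (gprod K (\<mu> f)) (PiM J (\<lambda>_. borel)) (\<lambda>u. \<lambda>j\<in>J. \<Sum>k<K. B j k * u k)) \<and>
       (\<forall>f\<in>L2 (count_space I). \<forall>g\<in>L2 (count_space I). (\<Sum>k<K. (\<mu> f k - \<mu> g k)\<^sup>2) \<le> (sqrt n * L2_dist (count_space I) f g)\<^sup>2)"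
    by blast
qed

lemma linear_limit_sequence:
  assumes X: "X \<in> seq_linear n I" and f: "f \<in> L2 (count_space I)"
  shows "linear_limit I (seq_law n I f) X"
  unfolding linear_limit_def
proof (intro conjI allI impI)
  show "X \<in> borel_measurable (seq_law n I f)"
    using X unfolding seq_linear_def seq_law_def by simp
  fix \<epsilon> :: real assume e: "0 < \<epsilon>"
  obtain c h where "((\<lambda>A. \<integral>\<^sup>+ y. ennreal ((X y - (c + (\<Sum>i\<in>A. h i * y i)))\<^sup>2) \<partial>seq_law n I f) \<longlongrightarrow> 0)
         (finite_subsets_at_top I)"
    using X f unfolding seq_linear_def by blast
  then have "\<forall>\<^sub>F A in finite_subsets_at_top I. (\<integral>\<^sup>+ y. ennreal ((X y - (c + (\<Sum>i\<in>A. h i * y i)))\<^sup>2) \<partial>seq_law n I f) < ennreal \<epsilon>"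
    by (rule order_tendstoD) (use e in simp)
  then show "\<exists>J w c. finite J \<and> J \<subseteq> I \<and>
        (\<integral>\<^sup>+ y. ennreal ((X y - (c + (\<Sum>j\<in>J. w j * y j)))\<^sup>2) \<partial>seq_law n I f) < ennreal \<epsilon>"
    unfolding eventually_finite_subsets_at_top by blast
qed

section \<open>The white noise model\<close>

lemma step_integral_linear:
  assumes "valid_steps s"
  shows "\<exists>J w. finite J \<and> J \<subseteq> unit_interval \<and> (\<forall>y. step_integral s y = (\<Sum>j\<in>J. w j * y j))"
  using assms
proof (induction s)
  case Nil
  show ?case by (intro exI[of _ "{}"]) (simp add: step_integral_def)
next
  case (Cons x s)
  obtain a b v where x: "x = (a, b, v)" by (cases x)
  have ab: "a \<in> unit_interval" "b \<in> unit_interval" using Cons.prems by (auto simp: x valid_steps_def)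
  obtain J w where J: "finite J" "J \<subseteq> unit_interval" and w: "\<And>y. step_integral s y = (\<Sum>j\<in>J. w j * y j)"
    using Cons by (auto simp: valid_steps_def)
  define K where "K = insert a (insert b J)"
  \<comment> \<open>Adding the contributions separately treats an end point that already belongs to
    \<open>J\<close>, or the coincidence \<open>a = b\<close>, without case distinctions.\<close>
  define w' where "w' = (\<lambda>j. (if j \<in> J then w j else 0) + ((if j = b then v else 0) - (if j = a then v else 0)))"
  have "step_integral (x # s) y = (\<Sum>j\<in>K. w' j * y j)" for y
  proof -
    have K: "finite K" "a \<in> K" "b \<in> K" "J \<subseteq> K" using J by (auto simp: K_def)
    have "(\<Sum>j\<in>K. w' j * y j) = (\<Sum>j\<in>K. if j \<in> J then w j * y j else 0) +
       ((\<Sum>j\<in>K. if j = b then v * y j else 0) - (\<Sum>j\<in>K. if j = a then v * y j else 0))"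
      unfolding sum.distrib[symmetric] sum_subtractf[symmetric] w'_def
      by (intro sum.cong) (auto simp: algebra_simps)
    also have "(\<Sum>j\<in>K. if j \<in> J then w j * y j else 0) = (\<Sum>j\<in>J. w j * y j)"
      using K by (intro sum.mono_neutral_cong_right) auto
    also have "\<dots> = step_integral s y" by (simp add: w)
    finally show ?thesis using K by (simp add: x step_integral_def algebra_simps)
  qed
  moreover have "finite K" "K \<subseteq> unit_interval" using J ab by (auto simp: K_def)
  ultimately show ?case by blast
qed

text \<open>Passing from the path to its normalised increments turns the drift into averages over the
  partition intervals, whose squared distances are controlled by the Cauchy-Schwarz inequality.\<close>

definition drift :: "(real \<Rightarrow> real) \<Rightarrow> real \<Rightarrow> real" where
  "drift f t = integral\<^sup>L (lebesgue_on {-1/2..t}) f"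

lemma drift_eq:
  assumes "t \<le> 1/2"
  shows "drift f t = (\<integral>u. indicator {..t} u * f u \<partial>lebesgue_on unit_interval)"
proof -
  have "drift f t = (\<integral>u. indicator {-1/2..t} u *\<^sub>R f u \<partial>lebesgue)"
    unfolding drift_def by (rule integral_restrict_space) simp
  also have "\<dots> = (\<integral>u. indicator unit_interval u *\<^sub>R (indicator {..t} u * f u) \<partial>lebesgue)"
    using assms by (intro Bochner_Integration.integral_cong) (auto simp: indicator_def)
  also have "\<dots> = (\<integral>u. indicator {..t} u * f u \<partial>lebesgue_on unit_interval)"
    by (rule integral_restrict_space[symmetric]) simp
  finally show ?thesis .
qed

lemma finite_measure_unit: "finite_measure (lebesgue_on unit_interval)"
  by (rule finite_measure_lebesgue_on) simp

lemma L2_unit_integrable: "f \<in> L2 (lebesgue_on unit_interval) \<Longrightarrow> integrable (lebesgue_on unit_interval) f"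
  by (rule finite_measure.square_integrable_imp_integrable[OF finite_measure_unit]) (auto simp: L2_def)

lemma integrable_indicator_unit:
  fixes h :: "real \<Rightarrow> real"
  assumes "integrable (lebesgue_on unit_interval) h"
  shows "integrable (lebesgue_on unit_interval) (\<lambda>u. indicator {..t} u * h u)"
proof (rule Bochner_Integration.integrable_bound[OF assms])
  have [measurable]: "h \<in> borel_measurable (lebesgue_on unit_interval)" using assms by auto
  have "{..t} \<inter> unit_interval \<in> sets (lebesgue_on unit_interval)"
    by (subst sets_restrict_space_iff) auto
  then have "(\<lambda>u. indicator ({..t} \<inter> unit_interval) u * h u) \<in> borel_measurable (lebesgue_on unit_interval)"
    by (intro borel_measurable_times borel_measurable_indicator borel_measurable_integrable[OF assms])
  then show "(\<lambda>u. indicator {..t} u * h u) \<in> borel_measurable (lebesgue_on unit_interval)"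
    by (rule measurable_cong[THEN iffD1, rotated]) (auto simp: indicator_def)
qed (auto simp: indicator_def)

lemma drift_start: "drift f (-1/2) = 0"
proof -
  have "AE u in lebesgue. u \<noteq> -1/2" using AE_lborel_singleton by (rule AE_completion)
  then have "AE u in lebesgue. indicator {-1/2..-1/2} u *\<^sub>R f u = 0"
    by eventually_elim simp
  then have "(\<integral>u. indicator {-1/2..-1/2} u *\<^sub>R f u \<partial>lebesgue) = 0"
    by (rule integral_eq_zero_AE)
  then show ?thesis unfolding drift_def by (subst integral_restrict_space) auto
qed

lemma drift_diff:
  assumes "f \<in> L2 (lebesgue_on unit_interval)" "g \<in> L2 (lebesgue_on unit_interval)" "t \<le> 1/2"
  shows "drift g t - drift f t = drift (\<lambda>u. g u - f u) t"
  unfolding drift_eq[OF assms(3)]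
  using integrable_indicator_unit[OF L2_unit_integrable[OF assms(1)]] integrable_indicator_unit[OF L2_unit_integrable[OF assms(2)]]
  by (subst Bochner_Integration.integral_diff[symmetric]) (auto simp: algebra_simps)

text \<open>The integral of \<open>(h u - c)\<^sup>2\<close> over the interval from \<open>s\<close>
  to \<open>t\<close> is not negative; with \<open>c\<close> the average of \<open>h\<close> there,
  expanding the square gives the claim. The right-hand side is an increment, so the bounds telescope
  along a partition.\<close>

lemma drift_Cauchy_Schwarz:
  fixes h :: "real \<Rightarrow> real"
  assumes h: "integrable (lebesgue_on unit_interval) h" "integrable (lebesgue_on unit_interval) (\<lambda>u. (h u)\<^sup>2)"
    and st: "-1/2 \<le> s" "s < t" "t \<le> 1/2"
  shows "(drift h t - drift h s)\<^sup>2 / (t - s) \<le> drift (\<lambda>u. (h u)\<^sup>2) t - drift (\<lambda>u. (h u)\<^sup>2) s"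
proof -
  interpret finite_measure "lebesgue_on unit_interval" by (rule finite_measure_unit)
  let ?\<nu> = "lebesgue_on unit_interval"
  define c where "c = (drift h t - drift h s) / (t - s)"
  have one: "integrable ?\<nu> (\<lambda>u. 1::real)" by simp
  have ind: "drift k t - drift k s = (\<integral>u. indicator {s<..t} u * k u \<partial>?\<nu>) \<and> integrable ?\<nu> (\<lambda>u. indicator {s<..t} u * k u)"
    if k: "integrable ?\<nu> k" for k
  proof -
    have eq: "(\<lambda>u. indicator {..t} u * k u - indicator {..s} u * k u) = (\<lambda>u. indicator {s<..t} u * k u)"
      using st by (auto simp: indicator_def fun_eq_iff)
    have "s \<le> 1/2" using st by simp
    then show ?thesis
      unfolding drift_eq[OF \<open>t \<le> 1/2\<close>] drift_eq[OF \<open>s \<le> 1/2\<close>]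
      using integrable_indicator_unit[OF k, of t] integrable_indicator_unit[OF k, of s]
      by (subst Bochner_Integration.integral_diff[symmetric]) (auto simp flip: eq)
  qed
  have len: "drift (\<lambda>_. 1) t - drift (\<lambda>_. 1) s = t - s"
    using st by (simp add: drift_def measure_restrict_space)
  have int: "integrable ?\<nu> (\<lambda>u. (h u)\<^sup>2 - 2 * c * h u + c\<^sup>2 * 1)" using h one by auto
  have "0 \<le> (\<integral>u. indicator {s<..t} u * (h u - c)\<^sup>2 \<partial>?\<nu>)"
    by (rule Bochner_Integration.integral_nonneg) (auto simp: indicator_def)
  also have "\<dots> = (\<integral>u. (indicator {s<..t} u * (h u)\<^sup>2 - 2 * c * (indicator {s<..t} u * h u)) + c\<^sup>2 * (indicator {s<..t} u * 1) \<partial>?\<nu>)"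
    by (intro Bochner_Integration.integral_cong) (auto simp: power2_eq_square algebra_simps)
  also have "\<dots> = (drift (\<lambda>u. (h u)\<^sup>2) t - drift (\<lambda>u. (h u)\<^sup>2) s) - 2 * c * (drift h t - drift h s) + c\<^sup>2 * (t - s)"
    using ind[OF h(1)] ind[OF h(2)] ind[OF one] len by simp
  also have "\<dots> = (drift (\<lambda>u. (h u)\<^sup>2) t - drift (\<lambda>u. (h u)\<^sup>2) s) - (drift h t - drift h s)\<^sup>2 / (t - s)"
  proof -
    have "drift h t - drift h s = c * (t - s)" using st by (simp add: c_def)
    then show ?thesis using st by (simp add: power2_eq_square)
  qed
  finally show ?thesis by simp
qed

lemma linear_limit_white_noise:
  assumes X: "X \<in> wn_linear n \<Omega> W" and f: "f \<in> L2 (lebesgue_on unit_interval)"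
  shows "linear_limit unit_interval (wn_law n \<Omega> W f) X"
  unfolding linear_limit_def
proof (intro conjI allI impI)
  show "X \<in> borel_measurable (wn_law n \<Omega> W f)"
    using X unfolding wn_linear_def wn_law_def by simp
  fix \<epsilon> :: real assume e: "0 < \<epsilon>"
  obtain c s where s: "\<And>r. valid_steps (s r)"
    and l: "(\<lambda>r. \<integral>\<^sup>+ y. ennreal ((X y - (c + step_integral (s r) y))\<^sup>2) \<partial>wn_law n \<Omega> W f) \<longlonglongrightarrow> 0"
    using X f unfolding wn_linear_def by blast
  have "\<forall>\<^sub>F r in sequentially. (\<integral>\<^sup>+ y. ennreal ((X y - (c + step_integral (s r) y))\<^sup>2) \<partial>wn_law n \<Omega> W f) < ennreal \<epsilon>"
    by (rule order_tendstoD[OF l]) (use e in simp)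
  then obtain r where r: "(\<integral>\<^sup>+ y. ennreal ((X y - (c + step_integral (s r) y))\<^sup>2) \<partial>wn_law n \<Omega> W f) < ennreal \<epsilon>"
    by (auto simp: eventually_sequentially)
  obtain J w where J: "finite J" "J \<subseteq> unit_interval" "\<And>y. step_integral (s r) y = (\<Sum>j\<in>J. w j * y j)"
    using step_integral_linear[OF s[of r]] by blast
  show "\<exists>J w c. finite J \<and> J \<subseteq> unit_interval \<and>
        (\<integral>\<^sup>+ y. ennreal ((X y - (c + (\<Sum>j\<in>J. w j * y j)))\<^sup>2) \<partial>wn_law n \<Omega> W f) < ennreal \<epsilon>"
    using J r by (intro exI[of _ J] exI[of _ w] exI[of _ c]) auto
qed

text \<open>The Brownian increments between consecutive points of a grid containing \<open>J\<close>
  are independent, and divided by their standard deviations they become unit-variance coordinates.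
  The distance of the mean vectors is controlled by \<open>drift_Cauchy_Schwarz\<close>,
  independently of the grid.\<close>

lemma gaussian_family_white_noise:
  assumes n: "0 < n" and W: "brownian_motion \<Omega> W"
  shows "gaussian_family unit_interval (L2 (lebesgue_on unit_interval)) (wn_law n \<Omega> W)
     (\<lambda>f g. sqrt n * L2_dist (lebesgue_on unit_interval) f g)"
proof (rule gaussian_family.intro)
  interpret prob_space \<Omega> using W by (simp add: brownian_motion_def)
  let ?\<nu> = "lebesgue_on unit_interval"
  define Y where "Y = (\<lambda>f t x. drift f t + W t x / sqrt (real n))"
  have Wm: "W t \<in> borel_measurable \<Omega>" if "t \<in> unit_interval" for t
    using W that by (simp add: brownian_motion_def)
  have Ym: "Y f t \<in> borel_measurable \<Omega>" if "t \<in> unit_interval" for f t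
    using Wm[OF that] by (simp add: Y_def)
  have law: "wn_law n \<Omega> W f = distr \<Omega> (PiM unit_interval (\<lambda>_. borel)) (\<lambda>x. \<lambda>t\<in>unit_interval. Y f t x)" for f
    unfolding wn_law_def obs_def Y_def drift_def by simp
  have m: "(\<lambda>x. \<lambda>t\<in>unit_interval. Y f t x) \<in> measurable \<Omega> (PiM unit_interval (\<lambda>_. borel))" for f
    by (rule measurable_restrict) (rule Ym)
  show "prob_space (wn_law n \<Omega> W f)" for f unfolding law using m by (rule prob_space_distr)
  show "sets (wn_law n \<Omega> W f) = sets (PiM unit_interval (\<lambda>_. borel))" for f unfolding law by simp
  show "0 \<le> sqrt n * L2_dist ?\<nu> f g" for f g by (simp add: L2_dist_def)
  fix J :: "real set" assume J: "finite J" "J \<subseteq> unit_interval"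
  \<comment> \<open>The left end point is where the telescoping sums start; the observed path is
    almost surely 0 there.\<close>
  define S where "S = insert (1/2) (insert (-1/2) J)"
  define K where "K = card S - 1"
  define \<tau> where "\<tau> = (\<lambda>i. sorted_list_of_set S ! i)"
  have S: "finite S" "S \<subseteq> unit_interval" "-1/2 \<in> S" "1/2 \<in> S" using J by (auto simp: S_def)
  have cS: "card S = Suc K" using S card_gt_0_iff[of S] by (auto simp: K_def)
  have \<tau>S: "\<tau> i \<in> S" if "i \<le> K" for i
  proof -
    have "\<tau> i \<in> set (sorted_list_of_set S)" unfolding \<tau>_def using that S cS by (intro nth_mem) simp
    then show ?thesis using S by simp
  qed
  have \<tau>_strict: "\<tau> i < \<tau> j" if "i < j" "j \<le> K" for i j
    unfolding \<tau>_def using that cS by (intro sorted_wrt_nth_less[OF strict_sorted_list_of_set]) auto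
  have \<tau>_less: "\<tau> i < \<tau> j \<longleftrightarrow> i < j" if "i \<le> K" "j \<le> K" for i j
    using \<tau>_strict[of i j] \<tau>_strict[of j i] that by (metis less_asym less_irrefl linorder_neqE_nat)
  have \<tau>_ex: "\<exists>i\<le>K. \<tau> i = t" if "t \<in> S" for t
  proof -
    have "t \<in> set (sorted_list_of_set S)" using that S by simp
    then show ?thesis unfolding \<tau>_def in_set_conv_nth using S cS by (auto simp: less_Suc_eq_le)
  qed
  have \<tau>0: "\<tau> 0 = -1/2"
  proof -
    obtain i where i: "i \<le> K" "\<tau> i = -1/2" using \<tau>_ex[OF S(3)] by blast
    have "-1/2 \<le> \<tau> 0" using \<tau>S[of 0] S(2) by auto
    then have "\<not> 0 < i" using \<tau>_strict[of 0 i] i by auto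
    then show ?thesis using i by simp
  qed
  have \<tau>U: "\<tau> i \<in> unit_interval" if "i \<le> K" for i using \<tau>S[OF that] S(2) by blast
  define \<Delta> where "\<Delta> = (\<lambda>k. \<tau> (Suc k) - \<tau> k)"
  have \<Delta>: "0 < \<Delta> k" if "k < K" for k using \<tau>_strict[of k "Suc k"] that by (simp add: \<Delta>_def)
  \<comment> \<open>\<open>B\<close> adds up the rescaled increments before time \<open>j\<close>:
    for the grid point \<open>j = \<tau> i\<close>, the condition \<open>\<tau> k < j\<close> means
    \<open>k < i\<close>.\<close>
  define B where "B = (\<lambda>j k. if \<tau> k < j then sqrt (\<Delta> k) / sqrt (real n) else 0)"
  define \<mu> where "\<mu> = (\<lambda>f k. sqrt (real n) * (drift f (\<tau> (Suc k)) - drift f (\<tau> k)) / sqrt (\<Delta> k))"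
  define U where "U = (\<lambda>f k x. \<mu> f k + (1 / sqrt (\<Delta> k)) * (W (\<tau> (Suc k)) x - W (\<tau> k) x))"
  have W0: "AE x in \<Omega>. W (-1/2) x = 0" using W by (simp add: brownian_motion_def)
  have "distr (wn_law n \<Omega> W f) (PiM J (\<lambda>_. borel)) (\<lambda>y. restrict y J) =
          distr (gprod K (\<mu> f)) (PiM J (\<lambda>_. borel)) (\<lambda>u. \<lambda>j\<in>J. \<Sum>k<K. B j k * u k)" for f
    unfolding law
  proof (rule finite_dimensional_law[OF J(2) Ym])
    define \<tau>' where "\<tau>' = (\<lambda>i. \<tau> (min i K))"
    have "\<tau>' ` {..K} \<subseteq> unit_interval" using \<tau>U by (auto simp: \<tau>'_def)
    moreover have "mono_on {..K} \<tau>'"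
      by (rule mono_onI) (auto simp: \<tau>'_def min_def intro: less_imp_le[OF \<tau>_strict] dest: le_imp_less_or_eq)
    ultimately have "indep_vars (\<lambda>_. borel) (\<lambda>i x. W (\<tau>' (Suc i)) x - W (\<tau>' i) x) {..<K}"
      using W unfolding brownian_motion_def by blast
    then have i0: "indep_vars (\<lambda>_. borel) (\<lambda>i x. W (\<tau> (Suc i)) x - W (\<tau> i) x) {..<K}"
      by (rule indep_vars_cong[THEN iffD1, rotated 3]) (auto simp: \<tau>'_def min_def)
    show "indep_vars (\<lambda>_. borel) (U f) {..<K}"
      unfolding U_def by (rule indep_vars_compose2[OF i0]) auto
    show "distr \<Omega> borel (U f k) = density lborel (normal_density (\<mu> f k) 1)" if k: "k < K" for k
    proof -
      have "distributed \<Omega> lborel (\<lambda>x. W (\<tau> (Suc k)) x - W (\<tau> k) x) (normal_density 0 (sqrt (\<tau> (Suc k) - \<tau> k)))"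
        using W \<tau>U[of k] \<tau>U[of "Suc k"] \<tau>_strict[of k "Suc k"] k unfolding brownian_motion_def by auto
      then have "distributed \<Omega> lborel (\<lambda>x. W (\<tau> (Suc k)) x - W (\<tau> k) x) (normal_density 0 (sqrt (\<Delta> k)))"
        by (simp only: \<Delta>_def)
      from normal_density_affine[OF this, of "1 / sqrt (\<Delta> k)" "\<mu> f k"] \<Delta>[OF k]
      have "distributed \<Omega> lborel (U f k) (normal_density (\<mu> f k) 1)" by (simp add: U_def)
      then have "distr \<Omega> lborel (U f k) = density lborel (normal_density (\<mu> f k) 1)"
        by (rule distributed_distr_eq_density)
      then show ?thesis by (simp cong: distr_cong)
    qed
    show "AE x in \<Omega>. \<forall>j\<in>J. Y f j x = (\<Sum>k<K. B j k * U f k x)"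
      using W0
    proof eventually_elim
      case (elim x)
      show ?case
      proof
        fix j assume "j \<in> J"
        then obtain i where i: "i \<le> K" "\<tau> i = j" using \<tau>_ex[of j] by (auto simp: S_def)
        have inc: "sqrt (\<Delta> k) / sqrt (real n) * U f k x = Y f (\<tau> (Suc k)) x - Y f (\<tau> k) x" if "k < K" for k
        proof -
          have key: "r / q * (q * d / r + 1 / r * w) = d + w / q" if "0 < r" "0 < q" for r q d w :: real
            using that by (simp add: field_simps)
          show ?thesis unfolding U_def \<mu>_def Y_def using \<Delta>[OF that] n
            by (subst key) (simp_all add: diff_divide_distrib)
        qed
        have "(\<Sum>k<K. B j k * U f k x) = (\<Sum>k<i. Y f (\<tau> (Suc k)) x - Y f (\<tau> k) x)"
          using i \<tau>_less[of _ i] by (intro sum.mono_neutral_cong_right) (auto simp: B_def inc[unfolded times_divide_eq_left])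
        also have "\<dots> = Y f (\<tau> i) x - Y f (\<tau> 0) x"
          by (rule sum_lessThan_telescope)
        also have "Y f (\<tau> 0) x = 0" using elim drift_start by (simp add: Y_def \<tau>0)
        finally show "Y f j x = (\<Sum>k<K. B j k * U f k x)" using i by simp
      qed
    qed
  qed
  moreover have "(\<Sum>k<K. (\<mu> f k - \<mu> g k)\<^sup>2) \<le> (sqrt n * L2_dist ?\<nu> f g)\<^sup>2"
    if f: "f \<in> L2 ?\<nu>" and g: "g \<in> L2 ?\<nu>" for f g
  proof -
    define h where "h = (\<lambda>u. g u - f u)"
    have h2: "integrable ?\<nu> (\<lambda>u. (h u)\<^sup>2)" unfolding h_def by (rule L2_diff_integrable[OF f g])
    have h1: "integrable ?\<nu> h" unfolding h_def using L2_unit_integrable[OF f] L2_unit_integrable[OF g] by simp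
    define G where "G = drift (\<lambda>u. (h u)\<^sup>2)"
    have "(\<Sum>k<K. (\<mu> f k - \<mu> g k)\<^sup>2) \<le> (\<Sum>k<K. n * (G (\<tau> (Suc k)) - G (\<tau> k)))"
    proof (rule sum_mono)
      fix k assume "k \<in> {..<K}"
      then have k: "k < K" by simp
      have u: "\<tau> k \<in> unit_interval" "\<tau> (Suc k) \<in> unit_interval" using \<tau>U[of k] \<tau>U[of "Suc k"] k by auto
      have dh: "drift g t - drift f t = drift h t" if "t \<in> unit_interval" for t
        using drift_diff[OF f g, of t] that by (simp add: h_def)
      have "\<mu> f k - \<mu> g k = - (sqrt (real n) * ((drift g (\<tau> (Suc k)) - drift f (\<tau> (Suc k))) - (drift g (\<tau> k) - drift f (\<tau> k))) / sqrt (\<Delta> k))"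
        by (simp add: \<mu>_def diff_divide_distrib add_divide_distrib algebra_simps)
      also have "\<dots> = - (sqrt (real n) * (drift h (\<tau> (Suc k)) - drift h (\<tau> k)) / sqrt (\<Delta> k))"
        by (simp only: dh[OF u(1)] dh[OF u(2)])
      finally have "(\<mu> f k - \<mu> g k)\<^sup>2 = n * ((drift h (\<tau> (Suc k)) - drift h (\<tau> k))\<^sup>2 / (\<tau> (Suc k) - \<tau> k))"
        using \<Delta>[OF k] by (simp add: power_mult_distrib power_divide \<Delta>_def)
      also have "\<dots> \<le> n * (G (\<tau> (Suc k)) - G (\<tau> k))"
        unfolding G_def using u \<tau>_strict[of k "Suc k"] k
        by (intro mult_left_mono drift_Cauchy_Schwarz h1 h2) auto
      finally show "(\<mu> f k - \<mu> g k)\<^sup>2 \<le> n * (G (\<tau> (Suc k)) - G (\<tau> k))" .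
    qed
    also have "\<dots> = n * (G (\<tau> K) - G (\<tau> 0))"
      using sum_lessThan_telescope[of "\<lambda>k. G (\<tau> k)" K] by (simp flip: sum_distrib_left)
    also have "\<dots> = n * G (\<tau> K)" unfolding \<tau>0 G_def drift_start by simp
    also have "\<dots> \<le> n * (\<integral>u. (h u)\<^sup>2 \<partial>?\<nu>)"
    proof (rule mult_left_mono)
      have "\<tau> K \<le> 1/2" using \<tau>U[of K] by simp
      show "G (\<tau> K) \<le> (\<integral>u. (h u)\<^sup>2 \<partial>?\<nu>)"
        unfolding G_def drift_eq[OF \<open>\<tau> K \<le> 1/2\<close>]
        by (intro integral_mono integrable_indicator_unit h2) (auto simp: indicator_def)
    qed simp
    finally show ?thesis by (simp add: power_mult_distrib L2_dist_square h_def)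
  qed
  ultimately show "\<exists>K B \<mu>.
       (\<forall>f\<in>L2 ?\<nu>. distr (wn_law n \<Omega> W f) (PiM J (\<lambda>_. borel)) (\<lambda>y. restrict y J) =
          distr (gprod K (\<mu> f)) (PiM J (\<lambda>_. borel)) (\<lambda>u. \<lambda>j\<in>J. \<Sum>k<K. B j k * u k)) \<and>
       (\<forall>f\<in>L2 ?\<nu>. \<forall>g\<in>L2 ?\<nu>. (\<Sum>k<K. (\<mu> f k - \<mu> g k)\<^sup>2) \<le> (sqrt n * L2_dist ?\<nu> f g)\<^sup>2)"
    by blast
qed

section \<open>Coverage of a shortest interval\<close>

text \<open>The triangle inequality for standard deviations: a bound that holds whatever the
  correlation of \<open>X\<close> and \<open>Y\<close> is.\<close>

lemma (in prob_space) variance_combination: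
  fixes X Y :: "'a \<Rightarrow> real"
  assumes X: "normal_tail M X" "variance X \<le> \<sigma>\<^sup>2" and Y: "normal_tail M Y" "variance Y \<le> \<sigma>\<^sup>2"
  shows "variance (\<lambda>x. p * X x + q * Y x) \<le> ((\<bar>p\<bar> + \<bar>q\<bar>) * \<sigma>)\<^sup>2"
proof -
  note Xi = normal_tailD[OF prob_space_axioms X(1)] and Yi = normal_tailD[OF prob_space_axioms Y(1)]
  have [measurable]: "X \<in> borel_measurable M" "Y \<in> borel_measurable M" using Xi Yi by auto
  define x where "x = (\<lambda>\<omega>. X \<omega> - expectation X)"
  define y where "y = (\<lambda>\<omega>. Y \<omega> - expectation Y)"
  have xi: "integrable M (\<lambda>\<omega>. (x \<omega>)\<^sup>2)" and yi: "integrable M (\<lambda>\<omega>. (y \<omega>)\<^sup>2)"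
    unfolding x_def y_def using Xi(4) Yi(4) by auto
  have [measurable]: "x \<in> borel_measurable M" "y \<in> borel_measurable M" unfolding x_def y_def by auto
  have ineq: "(p * u + q * v)\<^sup>2 \<le> (\<bar>p\<bar> + \<bar>q\<bar>) * (\<bar>p\<bar> * u\<^sup>2 + \<bar>q\<bar> * v\<^sup>2)" for u v :: real
  proof -
    have "(p * u + q * v)\<^sup>2 \<le> (\<bar>p\<bar> * \<bar>u\<bar> + \<bar>q\<bar> * \<bar>v\<bar>)\<^sup>2"
      by (rule abs_le_square_iff[THEN iffD1]) (simp add: abs_mult[symmetric] abs_triangle_ineq)
    also have "\<dots> = (\<bar>p\<bar> + \<bar>q\<bar>) * (\<bar>p\<bar> * \<bar>u\<bar>\<^sup>2 + \<bar>q\<bar> * \<bar>v\<bar>\<^sup>2) - \<bar>p\<bar> * \<bar>q\<bar> * (\<bar>u\<bar> - \<bar>v\<bar>)\<^sup>2"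
      by (simp add: power2_eq_square algebra_simps)
    also have "\<dots> \<le> (\<bar>p\<bar> + \<bar>q\<bar>) * (\<bar>p\<bar> * u\<^sup>2 + \<bar>q\<bar> * v\<^sup>2)" by simp
    finally show ?thesis .
  qed
  have int: "integrable M (\<lambda>\<omega>. (\<bar>p\<bar> + \<bar>q\<bar>) * (\<bar>p\<bar> * (x \<omega>)\<^sup>2 + \<bar>q\<bar> * (y \<omega>)\<^sup>2))" using xi yi by auto
  have "variance (\<lambda>\<omega>. p * X \<omega> + q * Y \<omega>) = expectation (\<lambda>\<omega>. (p * x \<omega> + q * y \<omega>)\<^sup>2)"
    using Xi(2) Yi(2) by (simp add: x_def y_def algebra_simps)
  also have "\<dots> \<le> expectation (\<lambda>\<omega>. (\<bar>p\<bar> + \<bar>q\<bar>) * (\<bar>p\<bar> * (x \<omega>)\<^sup>2 + \<bar>q\<bar> * (y \<omega>)\<^sup>2))"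
  proof (rule integral_mono[OF _ int])
    show "integrable M (\<lambda>\<omega>. (p * x \<omega> + q * y \<omega>)\<^sup>2)"
      using ineq by (intro Bochner_Integration.integrable_bound[OF int]) (auto intro!: AE_I2 order.trans[OF _ abs_ge_self])
  qed (rule ineq)
  also have "\<dots> = (\<bar>p\<bar> + \<bar>q\<bar>) * (\<bar>p\<bar> * variance X + \<bar>q\<bar> * variance Y)"
    using xi yi by (simp add: x_def y_def)
  also have "\<dots> \<le> (\<bar>p\<bar> + \<bar>q\<bar>) * (\<bar>p\<bar> * \<sigma>\<^sup>2 + \<bar>q\<bar> * \<sigma>\<^sup>2)"
    using X Y by (intro mult_left_mono add_mono) auto
  also have "\<dots> = ((\<bar>p\<bar> + \<bar>q\<bar>) * \<sigma>)\<^sup>2" by (simp add: power2_eq_square algebra_simps)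
  finally show ?thesis .
qed

text \<open>Since \<open>k * (\<xi> / z)\<close> bounds the standard deviation, a distance of
  \<open>c * k * \<xi>\<close> below the mean amounts to \<open>c * z\<close> in normalised
  units.\<close>

lemma (in prob_space) normal_tail_prob:
  assumes X: "normal_tail M X" "variance X \<le> (k * (\<xi> / z))\<^sup>2" and "0 < k" "0 < \<xi>" "0 < z" "0 < c"
    and l: "l \<le> expectation X - c * k * \<xi>"
  shows "prob {x \<in> space M. X x \<le> l} \<le> \<Phi> (- c * z)"
proof -
  have [measurable]: "X \<in> borel_measurable M" using X(1) by (simp add: normal_tail_def)
  have "0 < k * (\<xi> / z)" "0 < c * k * \<xi>" using assms by auto
  then have "prob {x \<in> space M. X x \<le> expectation X - c * k * \<xi>} \<le> \<Phi> (- (c * k * \<xi>) / (k * (\<xi> / z)))"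
    using X unfolding normal_tail_def by blast
  also have "- (c * k * \<xi>) / (k * (\<xi> / z)) = - c * z" using assms by simp
  finally have *: "prob {x \<in> space M. X x \<le> expectation X - c * k * \<xi>} \<le> \<Phi> (- c * z)" .
  have "prob {x \<in> space M. X x \<le> l} \<le> prob {x \<in> space M. X x \<le> expectation X - c * k * \<xi>}"
    using l by (intro finite_measure_mono) auto
  with * show ?thesis by linarith
qed

text \<open>The upper end point \<open>(X + Y) / 2 + (X - Y)\<^sub>+ + 2 \<xi>\<close> exceeds both \<open>X + 2 \<xi>\<close> and
  \<open>(3 X - Y) / 2 + 2 \<xi>\<close>.  The second bound is the useful one if the mean of \<open>X - Y\<close> is large.\<close>

lemma (in prob_space) upper_miss:
  assumes lin: "\<And>p q. normal_tail M (\<lambda>x. p * X x + q * Y x)"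
    and var: "variance X \<le> (\<xi> / z)\<^sup>2" "variance Y \<le> (\<xi> / z)\<^sup>2" and pos: "0 < \<xi>" "0 < z" "0 < c"
    and bias: "\<theta> - \<xi> / 2 \<le> expectation X" "expectation Y \<le> \<theta> + \<xi> / 2"
    and c: "\<theta> + (c - 2) * \<xi> \<le> expectation X \<or> (4 * c - 3) * \<xi> \<le> expectation X - expectation Y"
  shows "prob {x \<in> space M. (X x + Y x) / 2 + (max (X x - Y x) 0 + 2 * \<xi>) < \<theta>} \<le> \<Phi> (- c * z)"
proof -
  have X: "normal_tail M X" and Y: "normal_tail M Y" using lin[of 1 0] lin[of 0 1] by simp_all
  note Xi = normal_tailD[OF prob_space_axioms X] and Yi = normal_tailD[OF prob_space_axioms Y]
  have [measurable]: "X \<in> borel_measurable M" "Y \<in> borel_measurable M" using Xi Yi by auto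
  from c show ?thesis
  proof
    assume c: "\<theta> + (c - 2) * \<xi> \<le> expectation X"
    have "prob {x \<in> space M. (X x + Y x) / 2 + (max (X x - Y x) 0 + 2 * \<xi>) < \<theta>}
      \<le> prob {x \<in> space M. X x \<le> \<theta> - 2 * \<xi>}"
      by (rule finite_measure_mono) (auto simp: max_def field_simps split: if_splits)
    also have "\<dots> \<le> \<Phi> (- c * z)"
      using X var pos c by (intro normal_tail_prob[where k = 1 and \<xi> = \<xi>]) (auto simp: algebra_simps)
    finally show ?thesis .
  next
    assume c: "(4 * c - 3) * \<xi> \<le> expectation X - expectation Y"
    have E: "expectation (\<lambda>x. 3/2 * X x + (- (1/2)) * Y x) = 3/2 * expectation X - 1/2 * expectation Y"
      using Xi(2) Yi(2) by simp
    have "prob {x \<in> space M. (X x + Y x) / 2 + (max (X x - Y x) 0 + 2 * \<xi>) < \<theta>}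
      \<le> prob {x \<in> space M. 3/2 * X x + (- (1/2)) * Y x \<le> \<theta> - 2 * \<xi>}"
      by (rule finite_measure_mono) (auto simp: max_def field_simps split: if_splits)
    also have "\<dots> \<le> \<Phi> (- c * z)"
    proof (rule normal_tail_prob[where k = 2 and \<xi> = \<xi>])
      show "variance (\<lambda>x. 3/2 * X x + (- (1/2)) * Y x) \<le> (2 * (\<xi> / z))\<^sup>2"
        using variance_combination[OF X var(1) Y var(2), of "3/2" "- (1/2)"] by simp
      \<comment> \<open>The mean is that of \<open>X\<close> plus half that of \<open>X - Y\<close>,
        hence at least \<open>\<theta> - \<xi> / 2 + (4 * c - 3) * \<xi> / 2 = \<theta> - 2 * \<xi>
        + 2 * c * \<xi>\<close>. This is the origin of \<open>4 * c - 3\<close>.\<close>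
      have "\<theta> - 2 * \<xi> \<le> 3/2 * expectation X - 1/2 * expectation Y - c * 2 * \<xi>"
        using c bias pos by (simp add: algebra_simps)
      then show "\<theta> - 2 * \<xi> \<le> expectation (\<lambda>x. 3/2 * X x + (- (1/2)) * Y x) - c * 2 * \<xi>"
        unfolding E .
    qed (rule lin | use pos in simp)+
    finally show ?thesis .
  qed
qed

definition two_sided_ci :: "real \<Rightarrow> real \<Rightarrow> real \<Rightarrow> real set" where
  "two_sided_ci a b \<xi> = {(a + b) / 2 - (max (a - b) 0 + 2 * \<xi>)..(a + b) / 2 + (max (a - b) 0 + 2 * \<xi>)}"

text \<open>Replacing \<open>X\<close>, \<open>Y\<close>, \<open>\<theta>\<close> by
  \<open>- Y\<close>, \<open>- X\<close>, \<open>- \<theta>\<close> exchanges the two end points as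
  well as the two bias bounds, so both sides follow from \<open>upper_miss\<close>. The margins
  \<open>c\<close> and \<open>c'\<close> are separate because a large mean difference may show on
  one side only.\<close>

lemma (in prob_space) two_sided_miss:
  assumes lin: "\<And>p q. normal_tail M (\<lambda>x. p * X x + q * Y x)"
    and var: "variance X \<le> (\<xi> / z)\<^sup>2" "variance Y \<le> (\<xi> / z)\<^sup>2" and pos: "0 < \<xi>" "0 < z" "0 < c" "0 < c'"
    and bias: "\<theta> - \<xi> / 2 \<le> expectation X" "expectation Y \<le> \<theta> + \<xi> / 2"
    and c: "\<theta> + (c - 2) * \<xi> \<le> expectation X \<or> (4 * c - 3) * \<xi> \<le> expectation X - expectation Y"
    and c': "expectation Y \<le> \<theta> - (c' - 2) * \<xi> \<or> (4 * c' - 3) * \<xi> \<le> expectation X - expectation Y"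
  shows "prob {x \<in> space M. \<theta> \<notin> two_sided_ci (X x) (Y x) \<xi>} \<le> \<Phi> (- c * z) + \<Phi> (- c' * z)"
proof -
  have X: "normal_tail M X" and Y: "normal_tail M Y" using lin[of 1 0] lin[of 0 1] by simp_all
  note Xi = normal_tailD[OF prob_space_axioms X] and Yi = normal_tailD[OF prob_space_axioms Y]
  have [measurable]: "X \<in> borel_measurable M" "Y \<in> borel_measurable M" using Xi Yi by auto
  let ?U = "{x \<in> space M. (X x + Y x) / 2 + (max (X x - Y x) 0 + 2 * \<xi>) < \<theta>}"
  let ?L = "{x \<in> space M. (- Y x + - X x) / 2 + (max (- Y x - - X x) 0 + 2 * \<xi>) < - \<theta>}"
  have "prob {x \<in> space M. \<theta> \<notin> two_sided_ci (X x) (Y x) \<xi>} \<le> prob (?U \<union> ?L)"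
    by (rule finite_measure_mono) (auto simp: two_sided_ci_def field_simps)
  also have "\<dots> \<le> prob ?U + prob ?L" by (intro measure_Un_le) measurable
  also have "prob ?U \<le> \<Phi> (- c * z)"
    using upper_miss[OF lin var pos(1-3) bias c] .
  also have "prob ?L \<le> \<Phi> (- c' * z)"
  proof (rule upper_miss)
    show "normal_tail M (\<lambda>x. p * - Y x + q * - X x)" for p q
      using lin[of "- q" "- p"] by (simp add: algebra_simps)
    show "variance (\<lambda>x. - Y x) \<le> (\<xi> / z)\<^sup>2" "variance (\<lambda>x. - X x) \<le> (\<xi> / z)\<^sup>2"
      using variance_combination[OF X var(1) Y var(2), of "-1" 0]
        variance_combination[OF X var(1) Y var(2), of 0 "-1"] by auto
    show "- \<theta> - \<xi> / 2 \<le> expectation (\<lambda>x. - Y x)" "expectation (\<lambda>x. - X x) \<le> - \<theta> + \<xi> / 2"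
      using bias Xi(2) Yi(2) by simp_all
    show "- \<theta> + (c' - 2) * \<xi> \<le> expectation (\<lambda>x. - Y x) \<or>
        (4 * c' - 3) * \<xi> \<le> expectation (\<lambda>x. - Y x) - expectation (\<lambda>x. - X x)"
      using c' Xi(2) Yi(2) by (auto simp: algebra_simps)
  qed (use pos in auto)
  finally show ?thesis by simp
qed

text \<open>The margins in use are \<open>c = 3/2\<close> and \<open>c = 5/2\<close>, besides the
  large ones far below the critical scale. The threshold 8/5 for \<open>z\<^sup>2\<close> is exactly
  what yields \<open>e = 1\<close> for 3/2; for 5/2 it yields \<open>e = 4\<close>. Natural
  exponents turn the total into a polynomial in \<open>exp (-1)\<close>.\<close>

lemma \<Phi>_scale_exp_le:
  assumes z: "0 \<le> z" "8/5 \<le> z\<^sup>2" and c: "1 \<le> c" and e: "real e \<le> 4/5 * (c\<^sup>2 - 1)"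
  shows "\<Phi> (- c * z) \<le> exp (-1) ^ e * \<Phi> (- z)"
proof -
  have "\<Phi> (- c * z) \<le> exp (- (c\<^sup>2 - 1) * z\<^sup>2 / 2) * \<Phi> (- z)" by (rule \<Phi>_scale_le[OF c z(1)])
  also have "\<dots> \<le> exp (- real e) * \<Phi> (- z)"
  proof (rule mult_right_mono[OF _ \<Phi>_nonneg])
    have "1 \<le> c\<^sup>2" using c by (simp add: one_le_power)
    then have "(c\<^sup>2 - 1) * (8/5) \<le> (c\<^sup>2 - 1) * z\<^sup>2" using z by (intro mult_left_mono) auto
    then have "real e \<le> (c\<^sup>2 - 1) * z\<^sup>2 / 2" using e by linarith
    then have "- (c\<^sup>2 - 1) * z\<^sup>2 / 2 \<le> - real e" by (simp add: algebra_simps)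
    then show "exp (- (c\<^sup>2 - 1) * z\<^sup>2 / 2) \<le> exp (- real e)" by simp
  qed
  also have "exp (- real e) = exp (-1) ^ e" by (simp flip: exp_of_nat_mult)
  finally show ?thesis .
qed

text \<open>\<open>miss_weight q\<close> bounds, in units of \<open>\<Phi> (- z)\<close>, the probability that the interval \<open>q\<close> steps
  below the critical scale misses the parameter.\<close>

definition miss_weight :: "nat \<Rightarrow> real" where
  "miss_weight q = (if q \<le> 1 then 2 * exp (-1) else if q = 2 then exp (-1) + exp (-1) ^ 4
     else 2 * exp (-1) ^ (2 * q - 1))"

lemma miss_weight_nonneg: "0 \<le> miss_weight q"
  by (simp add: miss_weight_def)

lemma exp_minus_one_le: "exp (-1) \<le> (37/100 :: real)"
proof -
  have "(100/37 :: real) \<le> exp 1" using e_approx_32 by (simp add: abs_if split: if_splits)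
  then show ?thesis by (simp add: exp_minus field_simps)
qed

text \<open>The additional \<open>exp (-1) ^ 4\<close> pays for the selection of an interval above
  the critical scale. With \<open>u = exp (-1)\<close> the first three weights give
  \<open>5 * u + u ^ 4\<close>, and the remaining ones are geometric with ratio
  \<open>u\<^sup>2 \<le> 1/4\<close>. The term \<open>5 * u\<close>, about 1.84, uses up most of the
  budget 2.\<close>

lemma sum_miss_weight: "(\<Sum>q<N. miss_weight q) + exp (-1) ^ 4 \<le> 2"
proof -
  define u :: real where "u = exp (-1)"
  have u: "0 \<le> u" "u \<le> 37/100" using exp_minus_one_le by (auto simp: u_def)
  have u2: "u\<^sup>2 \<le> 1/4"
    using power_mono[OF u(2,1), of 2] by (simp add: power2_eq_square)
  have "(\<Sum>q<N. miss_weight q) \<le> (\<Sum>q<3 + N. miss_weight q)"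
    by (rule sum_mono2) (auto simp: miss_weight_nonneg)
  also have "\<dots> = (\<Sum>q<3. miss_weight q) + (\<Sum>q<N. miss_weight (3 + q))"
    by (induction N) (simp_all only: add_Suc_right sum.lessThan_Suc add.assoc lessThan_0 sum.empty add_0_right)
  also have "(\<Sum>q<3. miss_weight q) = 5 * u + u ^ 4"
    by (simp add: miss_weight_def u_def eval_nat_numeral)
  also have "(\<Sum>q<N. miss_weight (3 + q)) \<le> (\<Sum>q<N. 2 * u ^ 5 * (1/4) ^ q)"
  proof (rule sum_mono)
    fix q
    have "miss_weight (3 + q) = 2 * u ^ 5 * (u\<^sup>2) ^ q"
      by (simp add: miss_weight_def u_def power_add[symmetric] power_mult[symmetric] algebra_simps)
    also have "\<dots> \<le> 2 * u ^ 5 * (1/4) ^ q" using u u2 by (intro mult_left_mono power_mono) auto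
    finally show "miss_weight (3 + q) \<le> 2 * u ^ 5 * (1/4) ^ q" .
  qed
  also have "(\<Sum>q<N. 2 * u ^ 5 * (1/4) ^ q) = 2 * u ^ 5 * (\<Sum>q<N. (1/4) ^ q)"
    by (simp only: sum_distrib_left)
  also have "\<dots> \<le> 2 * u ^ 5 * (4/3)"
  proof (rule mult_left_mono)
    have "(\<Sum>q<N. (1/4::real) ^ q) \<le> (\<Sum>q. (1/4) ^ q)" by (rule sum_le_suminf) auto
    then show "(\<Sum>q<N. (1/4::real) ^ q) \<le> 4/3" by (simp add: suminf_geometric)
  qed (use u in auto)
  finally have "(\<Sum>q<N. miss_weight q) + u ^ 4 \<le> 5 * u + 2 * u ^ 4 + 8/3 * u ^ 5" by simp
  also have "\<dots> \<le> 5 * (37/100) + 2 * (37/100) ^ 4 + 8/3 * (37/100) ^ 5"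
    using u by (intro add_mono mult_left_mono power_mono) auto
  also have "\<dots> \<le> 2" by (simp add: power_divide)
  finally show ?thesis by (simp add: u_def)
qed

text \<open>The bias bounds alone give the margin 3/2 on both sides. For \<open>q = 2\<close> the
  means of \<open>X\<close> and \<open>Y\<close> differ by at least \<open>\<xi>\<close>, so one of
  them lies \<open>\<xi> / 2\<close> beyond \<open>\<theta>\<close> and raises the margin on its
  side to 5/2. From \<open>q = 3\<close> on, the mean difference is large enough for the second
  alternative of \<open>two_sided_miss\<close> on both sides.\<close>

lemma (in prob_space) miss_le_weight:
  assumes lin: "\<And>p q. normal_tail M (\<lambda>x. p * X x + q * Y x)"
    and var: "variance X \<le> (\<xi> / z)\<^sup>2" "variance Y \<le> (\<xi> / z)\<^sup>2"
    and pos: "0 < \<xi>" "0 < z" and z: "8/5 \<le> z\<^sup>2"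
    and bias: "\<theta> - \<xi> / 2 \<le> expectation X" "expectation Y \<le> \<theta> + \<xi> / 2"
    and d: "(2 ^ (q + 1) - 7) * \<xi> \<le> max (expectation X - expectation Y) 0"
  shows "prob {x \<in> space M. \<theta> \<notin> two_sided_ci (X x) (Y x) \<xi>} \<le> miss_weight q * \<Phi> (- z)"
proof -
  note miss = two_sided_miss[OF lin var pos _ _ bias]
  have e: "\<Phi> (- (3/2) * z) \<le> exp (-1) ^ 1 * \<Phi> (- z)"
    using pos z by (intro \<Phi>_scale_exp_le) (auto simp: power2_eq_square)
  have e4: "\<Phi> (- (5/2) * z) \<le> exp (-1) ^ 4 * \<Phi> (- z)"
    using pos z by (intro \<Phi>_scale_exp_le) (auto simp: power2_eq_square)
  consider "q \<le> 1" | "q = 2" | "3 \<le> q" by linarith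
  then show ?thesis
  proof cases
    case 1
    have "prob {x \<in> space M. \<theta> \<notin> two_sided_ci (X x) (Y x) \<xi>} \<le> \<Phi> (- (3/2) * z) + \<Phi> (- (3/2) * z)"
      using bias by (intro miss) (auto simp: algebra_simps)
    also have "\<dots> \<le> miss_weight q * \<Phi> (- z)" using e 1 by (simp add: miss_weight_def)
    finally show ?thesis .
  next
    case 2
    then have "\<xi> \<le> expectation X - expectation Y" using d pos by (simp add: max_def split: if_splits)
    then have "\<theta> + \<xi> / 2 \<le> expectation X \<or> expectation Y \<le> \<theta> - \<xi> / 2" by linarith
    then have "prob {x \<in> space M. \<theta> \<notin> two_sided_ci (X x) (Y x) \<xi>} \<le> \<Phi> (- (3/2) * z) + \<Phi> (- (5/2) * z)"
    proof
      assume "\<theta> + \<xi> / 2 \<le> expectation X"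
      then have "prob {x \<in> space M. \<theta> \<notin> two_sided_ci (X x) (Y x) \<xi>} \<le> \<Phi> (- (5/2) * z) + \<Phi> (- (3/2) * z)"
        using bias by (intro miss) (auto simp: algebra_simps)
      then show ?thesis by simp
    next
      assume "expectation Y \<le> \<theta> - \<xi> / 2"
      then show ?thesis using bias by (intro miss) (auto simp: algebra_simps)
    qed
    also have "\<dots> \<le> miss_weight q * \<Phi> (- z)" using e e4 2 by (simp add: miss_weight_def algebra_simps)
    finally show ?thesis .
  next
    case 3
    define r where "r = q - 3"
    have q: "q = r + 3" using 3 by (simp add: r_def)
    \<comment> \<open>Chosen such that \<open>4 * c - 3 = 2 ^ q\<close>, which is at most
      \<open>2 ^ (q + 1) - 7\<close> from \<open>q = 3\<close> on.\<close>
    define c :: real where "c = 3/4 + 2 ^ q / 4"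
    have "Suc r \<le> 2 ^ r" by (metis Suc_leI less_exp)
    then have r: "real r + 1 \<le> 2 ^ r" by (metis of_nat_Suc of_nat_le_iff of_nat_numeral of_nat_power add.commute)
    then have c: "real r + 11/4 \<le> c" by (simp add: c_def q power_add)
    have "(4 * c - 3) * \<xi> = 2 ^ q * \<xi>" by (simp add: c_def)
    also have "\<dots> \<le> (2 ^ (q + 1) - 7) * \<xi>"
      using r pos by (intro mult_right_mono) (auto simp: q power_add)
    finally have d': "(4 * c - 3) * \<xi> \<le> max (expectation X - expectation Y) 0" using d by linarith
    have "0 < (4 * c - 3) * \<xi>" using c pos by simp
    then have d'': "(4 * c - 3) * \<xi> \<le> expectation X - expectation Y" using d' by (simp add: max_def split: if_splits)
    have c0: "0 < c" "1 \<le> c" using c by linarith+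
    have "prob {x \<in> space M. \<theta> \<notin> two_sided_ci (X x) (Y x) \<xi>} \<le> \<Phi> (- c * z) + \<Phi> (- c * z)"
      using c0 d'' by (intro miss) auto
    also have "\<Phi> (- c * z) \<le> exp (-1) ^ (2 * q - 1) * \<Phi> (- z)"
    proof (rule \<Phi>_scale_exp_le)
      have "2 * real r + 5 \<le> 2 * real r + 5 + (1/4 + 12/5 * real r + 4/5 * (real r * real r))"
        by (rule le_add_same_cancel1[THEN iffD2]) (intro add_nonneg_nonneg, auto)
      also have "\<dots> = 4/5 * ((real r + 11/4)\<^sup>2 - 1)" by (simp add: power2_eq_square field_simps)
      also have "\<dots> \<le> 4/5 * (c\<^sup>2 - 1)" using c by (intro mult_left_mono diff_right_mono power_mono) auto
      finally have "2 * real r + 5 \<le> 4/5 * (c\<^sup>2 - 1)" .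
      moreover have "real (2 * q - 1) = 2 * real r + 5" by (simp add: q)
      ultimately show "real (2 * q - 1) \<le> 4/5 * (c\<^sup>2 - 1)" by simp
    qed (use pos z c0 in auto)
    finally show ?thesis using 3 by (simp add: miss_weight_def mult_ac)
  qed
qed

text \<open>The index \<open>r\<close> minimises \<open>d i + 7 * s i\<close>, with minimum \<open>V\<close>, where \<open>d i\<close> is the positive part of the mean of
  \<open>X i - Y i\<close>.  An index with \<open>s i > V / 2\<close> is chosen only if \<open>X r - Y r\<close> exceeds its mean by \<open>5 * s r\<close>.
  For an index with \<open>s i \<le> V / 2\<close>, minimality makes \<open>d i / s i\<close> large, so that the interval is long and
  rarely misses.  The constant \<open>7\<close> balances the two cases.\<close>

lemma (in prob_space) adaptive_coverage:
  fixes X Y :: "nat \<Rightarrow> 'a \<Rightarrow> real" and s :: "nat \<Rightarrow> real"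
  assumes z: "0 < z" "8/5 \<le> z\<^sup>2" and N: "N \<noteq> {}" and s0: "\<And>i. i \<in> N \<Longrightarrow> 0 < s i"
    and doubling: "\<And>i j. i \<in> N \<Longrightarrow> j \<in> N \<Longrightarrow> i \<le> j \<Longrightarrow> 2 ^ (j - i) * s i \<le> s j"
    and lin: "\<And>i p q. i \<in> N \<Longrightarrow> normal_tail M (\<lambda>x. p * X i x + q * Y i x)"
    and var: "\<And>i. i \<in> N \<Longrightarrow> variance (X i) \<le> (s i / z)\<^sup>2" "\<And>i. i \<in> N \<Longrightarrow> variance (Y i) \<le> (s i / z)\<^sup>2"
    and bias: "\<And>i. i \<in> N \<Longrightarrow> \<theta> - s i / 2 \<le> expectation (X i)" "\<And>i. i \<in> N \<Longrightarrow> expectation (Y i) \<le> \<theta> + s i / 2"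
    and sel: "\<And>x. x \<in> space M \<Longrightarrow> ihat x \<in> N"
      "\<And>x i. x \<in> space M \<Longrightarrow> i \<in> N \<Longrightarrow>
         max (X (ihat x) x - Y (ihat x) x) 0 + 2 * s (ihat x) \<le> max (X i x - Y i x) 0 + 2 * s i"
  shows "prob {x \<in> space M. \<theta> \<notin> two_sided_ci (X (ihat x) x) (Y (ihat x) x) (s (ihat x))} \<le> 2 * \<Phi> (- z)"
proof -
  have XY: "normal_tail M (X i)" "normal_tail M (Y i)" if "i \<in> N" for i
    using lin[OF that, of 1 0] lin[OF that, of 0 1] by simp_all
  note Xi = normal_tailD[OF prob_space_axioms XY(1)] and Yi = normal_tailD[OF prob_space_axioms XY(2)]
  define d where "d = (\<lambda>i. max (expectation (X i) - expectation (Y i)) 0)"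
  \<comment> \<open>Doubling leaves only finitely many indices below any level. Thus a minimiser and
    the largest index of \<open>F\<close> exist even if the subsequence is infinite.\<close>
  have fin: "finite {i \<in> N. s i \<le> c}" for c
  proof -
    obtain i where i: "i \<in> N" using N by blast
    obtain e where e: "c / s i < 2 ^ e" using real_arch_pow[of 2 "c / s i"] by auto
    have "j \<le> i + e" if j: "j \<in> N" "s j \<le> c" for j
    proof (rule ccontr)
      assume "\<not> j \<le> i + e"
      then have ij: "i \<le> j" "e \<le> j - i" by auto
      have "c < 2 ^ e * s i" using e s0[OF i] by (simp add: field_simps)
      also have "\<dots> \<le> 2 ^ (j - i) * s i" using ij s0[OF i] by (intro mult_right_mono power_increasing) auto
      also have "\<dots> \<le> s j" using doubling[OF i j(1) ij(1)] .
      finally show False using j by simp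
    qed
    then have "{i \<in> N. s i \<le> c} \<subseteq> {..i + e}" by auto
    then show ?thesis using finite_subset by blast
  qed
  obtain r where r: "r \<in> N" "\<And>i. i \<in> N \<Longrightarrow> d r + 7 * s r \<le> d i + 7 * s i"
  proof -
    obtain i where i: "i \<in> N" using N by blast
    \<comment> \<open>Outside \<open>G\<close> the term \<open>7 * s j\<close> alone exceeds the
      value at \<open>i\<close>, so minimising over the finite set \<open>G\<close> is
      enough.\<close>
    define G where "G = {j \<in> N. s j \<le> (d i + 7 * s i) / 7}"
    have "finite G" unfolding G_def by (rule fin)
    have "i \<in> G" unfolding G_def using i by (auto simp: d_def)
    then obtain r where r: "is_arg_min (\<lambda>j. d j + 7 * s j) (\<lambda>j. j \<in> G) r"
      using ex_is_arg_min_if_finite[of G] \<open>finite G\<close> by blast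
    then have r1: "r \<in> G" and r2: "\<And>j. j \<in> G \<Longrightarrow> d r + 7 * s r \<le> d j + 7 * s j"
      by (auto simp: is_arg_min_linorder)
    show thesis
    proof
      show "r \<in> N" using r1 by (simp add: G_def)
      fix j assume j: "j \<in> N"
      show "d r + 7 * s r \<le> d j + 7 * s j"
      proof (cases "j \<in> G")
        case False
        have "0 \<le> d j" by (simp add: d_def)
        moreover have "d i + 7 * s i < 7 * s j" using False j by (simp add: G_def)
        ultimately show ?thesis using r2[OF \<open>i \<in> G\<close>] by linarith
      qed (rule r2)
    qed
  qed
  define V where "V = d r + 7 * s r"
  define F where "F = {i \<in> N. s i \<le> V / 2}"
  have F: "finite F" unfolding F_def by (rule fin)
  have dr: "0 \<le> d r" by (simp add: d_def)
  have rF: "r \<in> F" using r(1) s0[OF r(1)] dr by (simp add: F_def V_def)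
  define i0 where "i0 = Max F"
  have i0: "i0 \<in> F" "\<And>i. i \<in> F \<Longrightarrow> i \<le> i0" using F rF unfolding i0_def by (auto intro: Max_in)
  define miss where "miss = (\<lambda>i. {x \<in> space M. \<theta> \<notin> two_sided_ci (X i x) (Y i x) (s i)})"
  have miss_sets: "miss i \<in> events" if "i \<in> N" for i
  proof -
    have [measurable]: "X i \<in> borel_measurable M" "Y i \<in> borel_measurable M" using Xi(1) Yi(1) that by auto
    show ?thesis unfolding miss_def two_sided_ci_def by simp
  qed
  have miss_le: "prob (miss i) \<le> miss_weight (i0 - i) * \<Phi> (- z)" if i: "i \<in> F" for i
    unfolding miss_def
  proof (rule miss_le_weight)
    have iN: "i \<in> N" "i0 \<in> N" and s_i0: "s i0 \<le> V / 2" using i i0 by (auto simp: F_def)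
    \<comment> \<open>Doubling up to \<open>i0\<close> keeps \<open>2 ^ (i0 - i + 1) * s i\<close>
      below \<open>V\<close>, and \<open>V\<close> is the minimum of \<open>d i + 7 * s i\<close>;
      solving for \<open>d i\<close> gives the hypothesis of \<open>miss_le_weight\<close>.\<close>
    have "2 ^ (i0 - i + 1) * s i = 2 * (2 ^ (i0 - i) * s i)" by simp
    also have "\<dots> \<le> V" using doubling[OF iN i0(2)[OF i]] s_i0 by linarith
    also have "\<dots> \<le> d i + 7 * s i" unfolding V_def by (rule r(2)[OF iN(1)])
    finally show "(2 ^ (i0 - i + 1) - 7) * s i \<le> max (expectation (X i) - expectation (Y i)) 0"
      by (simp add: d_def algebra_simps)
  qed (use i z s0 lin var bias in \<open>auto simp: F_def\<close>)
  \<comment> \<open>An interval with \<open>2 * s i > V\<close> can be shortest only if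
    \<open>X r - Y r\<close> exceeds \<open>V - 2 * s r = d r + 5 * s r\<close>. The event is
    written for \<open>Y r - X r\<close> because \<open>normal_tail\<close> describes lower tails.
    As the standard deviation is at most \<open>2 * (s r / z)\<close>, the excess
    \<open>5 * s r\<close> is the margin 5/2.\<close>
  define E where "E = {x \<in> space M. - 1 * X r x + 1 * Y r x \<le> - expectation (X r) + expectation (Y r) - 5 * s r}"
  have Es: "E \<in> events"
  proof -
    have [measurable]: "X r \<in> borel_measurable M" "Y r \<in> borel_measurable M" using Xi(1) Yi(1) r(1) by auto
    show ?thesis unfolding E_def by measurable
  qed
  have E_le: "prob E \<le> exp (-1) ^ 4 * \<Phi> (- z)"
  proof -
    have "prob E \<le> \<Phi> (- (5/2) * z)"
      unfolding E_def
    proof (rule normal_tail_prob[where k = 2 and \<xi> = "s r"])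
      show "normal_tail M (\<lambda>x. - 1 * X r x + 1 * Y r x)" by (rule lin[OF r(1)])
      show "variance (\<lambda>x. - 1 * X r x + 1 * Y r x) \<le> (2 * (s r / z))\<^sup>2"
        using variance_combination[OF XY(1)[OF r(1)] var(1)[OF r(1)] XY(2)[OF r(1)] var(2)[OF r(1)], of "-1" 1] by simp
      show "- expectation (X r) + expectation (Y r) - 5 * s r \<le> expectation (\<lambda>x. - 1 * X r x + 1 * Y r x) - 5/2 * 2 * s r"
        using Xi(2)[OF r(1)] Yi(2)[OF r(1)] by simp
    qed (use z s0[OF r(1)] in auto)
    also have "\<dots> \<le> exp (-1) ^ 4 * \<Phi> (- z)"
      using z by (intro \<Phi>_scale_exp_le) (auto simp: power2_eq_square)
    finally show ?thesis .
  qed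
  have "prob {x \<in> space M. \<theta> \<notin> two_sided_ci (X (ihat x) x) (Y (ihat x) x) (s (ihat x))} \<le> prob ((\<Union>i\<in>F. miss i) \<union> E)"
  proof (rule finite_measure_mono)
    show "(\<Union>i\<in>F. miss i) \<union> E \<in> events" using F Es miss_sets by (auto simp: F_def)
    show "{x \<in> space M. \<theta> \<notin> two_sided_ci (X (ihat x) x) (Y (ihat x) x) (s (ihat x))} \<subseteq> (\<Union>i\<in>F. miss i) \<union> E"
    proof
      fix x assume x: "x \<in> {x \<in> space M. \<theta> \<notin> two_sided_ci (X (ihat x) x) (Y (ihat x) x) (s (ihat x))}"
      show "x \<in> (\<Union>i\<in>F. miss i) \<union> E"
      proof (cases "ihat x \<in> F")
        case True
        then show ?thesis using x by (auto simp: miss_def)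
      next
        case False
        then have "V < 2 * s (ihat x)" using x sel(1)[of x] by (auto simp: F_def)
        moreover have "2 * s (ihat x) \<le> max (X r x - Y r x) 0 + 2 * s r"
          using sel(2)[of x r] x r(1) by (auto simp: max_def split: if_splits)
        ultimately have "d r + 5 * s r < max (X r x - Y r x) 0" by (simp add: V_def)
        then have "d r + 5 * s r < X r x - Y r x" using dr s0[OF r(1)] by (auto simp: max_def split: if_splits)
        then show ?thesis using x by (auto simp: E_def d_def)
      qed
    qed
  qed
  also have "\<dots> \<le> prob (\<Union>i\<in>F. miss i) + prob E"
    using F Es miss_sets by (intro measure_Un_le) (auto simp: F_def)
  also have "prob (\<Union>i\<in>F. miss i) \<le> (\<Sum>i\<in>F. prob (miss i))"
    using F miss_sets by (intro finite_measure_subadditive_finite) (auto simp: F_def)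
  also have "\<dots> \<le> (\<Sum>i\<in>F. miss_weight (i0 - i) * \<Phi> (- z))" by (rule sum_mono) (rule miss_le)
  also have "\<dots> \<le> (\<Sum>i<Suc i0. miss_weight (i0 - i) * \<Phi> (- z))"
    using i0 by (intro sum_mono2) (auto simp: miss_weight_nonneg \<Phi>_nonneg less_Suc_eq_le)
  also have "\<dots> = (\<Sum>q<Suc i0. miss_weight q) * \<Phi> (- z)"
    using sum.nat_diff_reindex[of miss_weight "Suc i0"] by (simp add: sum_distrib_right[symmetric])
  also note E_le
  also have "(\<Sum>q<Suc i0. miss_weight q) * \<Phi> (- z) + exp (-1) ^ 4 * \<Phi> (- z)
      = ((\<Sum>q<Suc i0. miss_weight q) + exp (-1) ^ 4) * \<Phi> (- z)" by (simp only: distrib_right)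
  also have "\<dots> \<le> 2 * \<Phi> (- z)"
    by (rule mult_right_mono[OF sum_miss_weight \<Phi>_nonneg])
  finally show ?thesis by simp
qed

section \<open>The adaptive interval\<close>

lemma L2_dist_commute: "L2_dist \<nu> f g = L2_dist \<nu> g f"
  unfolding L2_dist_def by (simp add: power2_commute)

lemma ereal_bounded_real:
  assumes "0 \<le> \<omega>" "\<omega> \<le> ereal s"
  obtains w where "\<omega> = ereal w" "0 \<le> w" "w \<le> s"
  using assms by (cases \<omega>) auto

text \<open>The positive part of a centred variable has half the mean of its absolute value, which costs
  only half a standard deviation.\<close>

lemma (in prob_space) expectation_pos_part_le:
  assumes D: "integrable M D" "integrable M (\<lambda>x. (D x - expectation D)\<^sup>2)"
    and v: "variance D \<le> (2 * c)\<^sup>2" and m: "expectation D \<le> s" and c: "0 < c" and s: "0 \<le> s" and t: "0 \<le> t"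
  shows "(\<integral>\<^sup>+ x. ennreal (2 * max (D x) 0 + t) \<partial>M) \<le> ennreal (2 * s + 2 * c + t)"
proof -
  define \<mu> where "\<mu> = expectation D"
  \<comment> \<open>For \<open>x = D - \<mu>\<close>, twice the positive part is
    \<open>x + \<bar>x\<bar>\<close>, and
    \<open>\<bar>x\<bar> \<le> x\<^sup>2 / (4 * c) + c\<close>. The mean of this last bound is at
    most \<open>2 * c\<close>, because the variance is at most
    \<open>(2 * c)\<^sup>2\<close>.\<close>
  define R where "R = (\<lambda>x. 2 * max \<mu> 0 + (D x - \<mu>) + ((D x - \<mu>)\<^sup>2 / (4 * c) + c) + t)"
  have pw: "2 * max (D x) 0 + t \<le> R x" for x
  proof -
    have "0 \<le> (\<bar>D x - \<mu>\<bar> - 2 * c)\<^sup>2" by simp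
    also have "\<dots> = (D x - \<mu>)\<^sup>2 - 4 * c * \<bar>D x - \<mu>\<bar> + 4 * c * c"
      by (simp add: power2_eq_square algebra_simps)
    finally have "\<bar>D x - \<mu>\<bar> * (4 * c) \<le> (D x - \<mu>)\<^sup>2 + c * (4 * c)" by (simp add: algebra_simps)
    then have "\<bar>D x - \<mu>\<bar> \<le> ((D x - \<mu>)\<^sup>2 + c * (4 * c)) / (4 * c)" using c by (simp add: pos_le_divide_eq)
    then have "\<bar>D x - \<mu>\<bar> \<le> (D x - \<mu>)\<^sup>2 / (4 * c) + c" using c by (simp add: add_divide_distrib)
    then show ?thesis unfolding R_def by (auto simp: max_def)
  qed
  have D2: "integrable M (\<lambda>x. (D x - \<mu>)\<^sup>2)" using D(2) by (simp add: \<mu>_def)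
  have int: "integrable M R" unfolding R_def using D(1) D2 by simp
  have nonneg: "0 \<le> R x" for x
  proof -
    have "0 \<le> 2 * max (D x) 0 + t" using t by simp
    then show ?thesis using pw[of x] by linarith
  qed
  have "(\<integral>\<^sup>+ x. ennreal (2 * max (D x) 0 + t) \<partial>M) \<le> (\<integral>\<^sup>+ x. ennreal (R x) \<partial>M)"
    using pw by (intro nn_integral_mono ennreal_leI) auto
  also have "\<dots> = ennreal (expectation R)" using int nonneg by (intro nn_integral_eq_integral) auto
  also have "expectation R = 2 * max \<mu> 0 + (variance D / (4 * c) + c) + t"
    unfolding R_def using D(1) D2 by (simp add: \<mu>_def prob_space)
  also have "ennreal \<dots> \<le> ennreal (2 * s + 2 * c + t)"
  proof (rule ennreal_leI)
    have "variance D / (4 * c) \<le> (2 * c)\<^sup>2 / (4 * c)" using v c by (intro divide_right_mono) auto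
    also have "\<dots> = c" using c by (simp add: power2_eq_square)
    finally show "2 * max \<mu> 0 + (variance D / (4 * c) + c) + t \<le> 2 * s + 2 * c + t"
      using m s by (simp add: \<mu>_def max_def)
  qed
  finally show ?thesis .
qed

text \<open>The two models enter the rest of the argument only through \<open>family\<close> and
  \<open>linear\<close>, which allows both to be treated at once.\<close>

locale adaptive_gaussian = adaptive_ci_setting M n \<alpha> D T k F That m js ihat
  for M :: "'i gaussian_model" and n :: nat and \<alpha> :: real and D T k F That m js ihat +
  assumes n: "0 < n" and \<alpha>: "0 < \<alpha>" "\<alpha> \<le> 1/5"
    and family: "gaussian_family (space (base M)) (L2 (base M)) (law M) (\<lambda>f g. sqrt n * L2_dist (base M) f g)"
    and linear: "\<And>X f. X \<in> linear_estimators M \<Longrightarrow> f \<in> L2 (base M) \<Longrightarrow> linear_limit (space (base M)) (law M f) X"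
begin

sublocale family: gaussian_family "space (base M)" "L2 (base M)" "law M" "\<lambda>f g. sqrt n * L2_dist (base M) f g"
  by (rule family)

abbreviation "\<xi> \<equiv> xi M n \<alpha> T k F"
abbreviation "z \<equiv> z_quantile (\<alpha> / 2)"
abbreviation "z' \<equiv> z_quantile \<alpha>"
abbreviation "CI \<equiv> adaptive_ci \<xi> k That js ihat"

definition s :: "enat \<Rightarrow> real" where "s j = real_of_ereal (\<xi> j)"

definition N :: "nat set" where "N = {i. 1 \<le> i \<and> enat i \<le> m}"

lemma z: "0 < z" "8/5 \<le> z\<^sup>2" "1 \<le> z"
proof -
  have "253/200 < z" using \<alpha> by (intro z_quantile_gt) auto
  then show "0 < z" "1 \<le> z" by auto
  have "(253/200)\<^sup>2 \<le> z\<^sup>2" using \<open>253/200 < z\<close> by (intro power_mono) auto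
  then show "8/5 \<le> z\<^sup>2" by (simp add: power2_eq_square)
qed

lemma z': "0 < z'" "z' < z"
  using \<alpha> by (auto intro!: z_quantile_pos z_quantile_strict_antimono)

lemma two_\<Phi>_z: "2 * \<Phi> (- z) = \<alpha>"
  using \<alpha> by (simp add: \<Phi>_minus \<Phi>_z_quantile)

lemma law_space: "f \<in> L2 (base M) \<Longrightarrow> space (law M f) = space (obs (base M))"
  using family.sets_P by (metis obs_def sets_eq_imp_space_eq)

lemma law_sets: "f \<in> L2 (base M) \<Longrightarrow> sets (law M f) = sets (obs (base M))"
  using family.sets_P by (simp add: obs_def)

lemma F_k: "1 \<le> k" "F k \<noteq> {}" "F k \<subseteq> L2 (base M)"
  using nested by (auto simp: nested_spaces_def)

lemma indexD:
  assumes "j \<in> indices \<xi> k"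
  shows "1 \<le> j" "j \<le> k" "F j \<noteq> {}" "F j \<subseteq> F k" "F j \<subseteq> L2 (base M)" "convex_space (F j)" "convex_space (F k)"
    and "\<xi> j = modulus_plus M T (noise n \<alpha>) (F j) (F k)" "\<xi> j = ereal (s j)" "0 < s j"
proof -
  show 1: "1 \<le> j" "j \<le> k" using assms by (auto simp: indices_def)
  then show "F j \<noteq> {}" "F j \<subseteq> F k" "F j \<subseteq> L2 (base M)" "convex_space (F j)" "convex_space (F k)"
    using nested F_k(1) by (auto simp: nested_spaces_def)
  show "\<xi> j = modulus_plus M T (noise n \<alpha>) (F j) (F k)" using 1 by (auto simp: xi_def)
  have "0 < \<xi> j \<and> \<xi> j < \<infinity>" by (rule xi_range[OF assms])
  then show "\<xi> j = ereal (s j)" "0 < s j" unfolding s_def by (cases "\<xi> j"; simp)+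
qed

text \<open>Taking \<open>f = g\<close> in the smaller space shows that both moduli are not
  negative. They are at most their maximum, which is finite, so real arithmetic can be used from
  here on.\<close>

lemma modulus_real:
  assumes j: "j \<in> indices \<xi> k"
  shows "\<exists>w. modulus M T (noise n \<alpha>) (F j) (F k) = ereal w \<and> 0 \<le> w \<and> w \<le> s j"
    and "\<exists>w. modulus M T (noise n \<alpha>) (F k) (F j) = ereal w \<and> 0 \<le> w \<and> w \<le> s j"
proof -
  obtain f where f: "f \<in> F j" "f \<in> F k" using indexD(3,4)[OF j] by blast
  have "L2_dist (base M) f f \<le> noise n \<alpha>" using z(1) by (simp add: L2_dist_def noise_def)
  then have "0 \<le> modulus M T (noise n \<alpha>) (F j) (F k)" "0 \<le> modulus M T (noise n \<alpha>) (F k) (F j)"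
    unfolding modulus_def using f by (auto intro!: Sup_upper2[of "ereal (T f - T f)"] simp: zero_ereal_def simp del: ereal_eq_0)
  moreover have "modulus M T (noise n \<alpha>) (F j) (F k) \<le> ereal (s j)" "modulus M T (noise n \<alpha>) (F k) (F j) \<le> ereal (s j)"
    using indexD(8,9)[OF j] unfolding modulus_plus_def by (metis max.cobounded1 max.cobounded2)+
  ultimately show "\<exists>w. modulus M T (noise n \<alpha>) (F j) (F k) = ereal w \<and> 0 \<le> w \<and> w \<le> s j"
    and "\<exists>w. modulus M T (noise n \<alpha>) (F k) (F j) = ereal w \<and> 0 \<le> w \<and> w \<le> s j"
    by (metis ereal_bounded_real)+
qed

text \<open>Replaces the estimator's own modulus \<open>w\<close> by a larger \<open>c\<close>. With
  \<open>c = s j\<close>, both estimators of an index are bounded on one common scale.\<close>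

lemma bounds_real:
  assumes "bias_variance_bounds M n \<alpha> T k F i j X" "modulus M T (noise n \<alpha>) (F i) (F j) = ereal w"
    and "0 \<le> w" "w \<le> c"
  shows "X \<in> linear_estimators M" "f \<in> F k \<Longrightarrow> var M f X \<le> (c / z)\<^sup>2"
    "f \<in> F j \<Longrightarrow> T f - c / 2 \<le> mean M f X" "f \<in> F i \<Longrightarrow> mean M f X \<le> T f + c / 2"
proof -
  have b: "X \<in> linear_estimators M" "\<forall>f\<in>F k. ereal (var M f X) \<le> (ereal w)\<^sup>2 / ereal (z\<^sup>2)"
    "- (ereal w / 2) \<le> (INF f \<in> F j. ereal (mean M f X - T f))" "(SUP f \<in> F i. ereal (mean M f X - T f)) \<le> ereal w / 2"
    using assms(1) unfolding bias_variance_bounds_def Let_def assms(2) by auto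
  show "X \<in> linear_estimators M" by (rule b)
  show "var M f X \<le> (c / z)\<^sup>2" if "f \<in> F k"
  proof -
    have "ereal (var M f X) \<le> ereal (w\<^sup>2 / z\<^sup>2)" using b(2) that z(1) by simp
    also have "w\<^sup>2 / z\<^sup>2 \<le> c\<^sup>2 / z\<^sup>2" using assms by (intro divide_right_mono power_mono) auto
    finally show ?thesis by (simp add: power_divide)
  qed
  show "T f - c / 2 \<le> mean M f X" if "f \<in> F j"
  proof -
    have "- (ereal w / 2) \<le> ereal (mean M f X - T f)" using b(3) INF_lower[OF that] by (rule order.trans)
    then have "ereal (- (w / 2)) \<le> ereal (mean M f X - T f)" by simp
    then show ?thesis using assms by simp
  qed
  show "mean M f X \<le> T f + c / 2" if "f \<in> F i"
  proof -
    have "ereal (mean M f X - T f) \<le> ereal w / 2" using SUP_upper[OF that] b(4) by (rule order.trans)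
    then have "ereal (mean M f X - T f) \<le> ereal (w / 2)" by simp
    then show ?thesis using assms by simp
  qed
qed

text \<open>At every truth in \<open>F k\<close>, \<open>That j k\<close> is not much too small and
  \<open>That k j\<close> is not much too large on average; this one-sided information drives
  coverage. The opposite bounds hold for truths in \<open>F j\<close> only and make the interval
  short there.\<close>

lemma estimator_bounds:
  assumes j: "j \<in> indices \<xi> k" and f: "f \<in> F k"
  shows "That j k \<in> linear_estimators M" "That k j \<in> linear_estimators M"
    "var M f (That j k) \<le> (s j / z)\<^sup>2" "var M f (That k j) \<le> (s j / z)\<^sup>2"
    "T f - s j / 2 \<le> mean M f (That j k)" "mean M f (That k j) \<le> T f + s j / 2"
    "f \<in> F j \<Longrightarrow> mean M f (That j k) \<le> T f + s j / 2" "f \<in> F j \<Longrightarrow> T f - s j / 2 \<le> mean M f (That k j)"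
proof -
  obtain w where w: "modulus M T (noise n \<alpha>) (F j) (F k) = ereal w" "0 \<le> w" "w \<le> s j"
    using modulus_real(1)[OF j] by blast
  obtain w' where w': "modulus M T (noise n \<alpha>) (F k) (F j) = ereal w'" "0 \<le> w'" "w' \<le> s j"
    using modulus_real(2)[OF j] by blast
  have b: "bias_variance_bounds M n \<alpha> T k F j k (That j k)" "bias_variance_bounds M n \<alpha> T k F k j (That k j)"
    using estimators[OF j] by auto
  show "That j k \<in> linear_estimators M" "var M f (That j k) \<le> (s j / z)\<^sup>2" "T f - s j / 2 \<le> mean M f (That j k)"
    "f \<in> F j \<Longrightarrow> mean M f (That j k) \<le> T f + s j / 2"
    using bounds_real[OF b(1) w] f by auto
  show "That k j \<in> linear_estimators M" "var M f (That k j) \<le> (s j / z)\<^sup>2" "mean M f (That k j) \<le> T f + s j / 2"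
    "f \<in> F j \<Longrightarrow> T f - s j / 2 \<le> mean M f (That k j)"
    using bounds_real[OF b(2) w'] f by auto
qed

lemma estimator_normal:
  assumes j: "j \<in> indices \<xi> k" and f: "f \<in> F k"
  shows "normal_tail (law M f) (\<lambda>y. p * That j k y + q * That k j y)"
proof -
  have f': "f \<in> L2 (base M)" using f F_k by blast
  show ?thesis
    by (intro family.normal_tail_linear_limit linear_limit_combination family.sets_P linear f' estimator_bounds(1,2)[OF j f])
qed

lemma estimator_measurable:
  assumes j: "j \<in> indices \<xi> k"
  shows "That j k \<in> borel_measurable (obs (base M))" "That k j \<in> borel_measurable (obs (base M))"
proof -
  obtain f where f: "f \<in> F k" using F_k by blast
  then have f': "f \<in> L2 (base M)" using F_k by blast
  show "That j k \<in> borel_measurable (obs (base M))" "That k j \<in> borel_measurable (obs (base M))"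
    using linear[OF estimator_bounds(1)[OF j f] f'] linear[OF estimator_bounds(2)[OF j f] f']
      measurable_cong_sets[OF law_sets[OF f'] refl, of borel]
    by (auto simp: linear_limit_def)
qed

section \<open>The doubling subsequence\<close>

lemma js_step:
  assumes "i \<in> N"
  shows "js (i - 1) < js i" "js i \<le> k" "2 * \<xi> (js (i - 1)) \<le> \<xi> (js i)"
    "js (i - 1) < j \<Longrightarrow> j < js i \<Longrightarrow> \<xi> (js i) < 2 * \<xi> j"
  using subsequence assms unfolding doubling_subsequence_def N_def by auto

lemma js_index:
  assumes i: "i \<in> N"
  shows "js i \<in> indices \<xi> k"
proof -
  have "1 \<le> js i" using js_step(1)[OF i] by (simp add: ileI1 one_eSuc gr_implies_not_zero zero_less_iff_neq_zero)
  moreover have "\<xi> (js i) \<noteq> \<infinity>" if "js i = \<infinity>"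
    using js_step(2)[OF i] that subsequence unfolding doubling_subsequence_def by (auto split: if_splits)
  ultimately show ?thesis using js_step(2)[OF i] by (auto simp: indices_def)
qed

lemma N_nonempty: "N \<noteq> {}"
proof -
  have "1 \<in> N"
  proof (cases m)
    case (enat m')
    then have "js m' = k" "js 0 = 0" using subsequence unfolding doubling_subsequence_def by (auto split: if_splits)
    \<comment> \<open>An empty subsequence would mean \<open>k = js 0 = 0\<close>.\<close>
    then have "m' \<noteq> 0" using F_k(1) by (intro notI) simp
    then show ?thesis unfolding N_def using enat by (simp add: one_enat_def[symmetric] Suc_ile_eq)
  next
    case infinity
    then show ?thesis unfolding N_def by simp
  qed
  then show ?thesis by blast
qed

lemma N_downward: "i \<in> N \<Longrightarrow> 1 \<le> j \<Longrightarrow> j \<le> i \<Longrightarrow> j \<in> N"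
  unfolding N_def by (auto intro: order.trans[of "enat j" "enat i"])

lemma s_doubling:
  assumes "i \<in> N" "j \<in> N" "i \<le> j"
  shows "2 ^ (j - i) * s (js i) \<le> s (js j)"
  using assms(3,2)
proof (induction j rule: dec_induct)
  case (step j)
  have j: "j \<in> N" using N_downward[OF step.prems, of j] step.hyps assms(1) by (auto simp: N_def)
  have "ereal (2 * s (js j)) \<le> ereal (s (js (Suc j)))"
    using js_step(3)[OF step.prems] indexD(9)[OF js_index[OF j]] indexD(9)[OF js_index[OF step.prems]] by simp
  then show ?case using step.IH[OF j] step.hyps by (simp add: Suc_diff_le)
qed simp

text \<open>For the least position \<open>i\<close> with \<open>j \<le> js i\<close>, the index
  \<open>j\<close> lies above \<open>js (i - 1)\<close>. Either \<open>j\<close> equals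
  \<open>js i\<close>, or it is one of the skipped indices, for which
  \<open>\<xi> (js i) < 2 * \<xi> j\<close>.\<close>

lemma js_cover:
  assumes j: "j \<in> indices \<xi> k"
  shows "\<exists>i\<in>N. j \<le> js i \<and> s (js i) \<le> 2 * s j"
proof -
  have ex: "\<exists>i. i \<in> N \<and> j \<le> js i"
  proof (cases "k = \<infinity> \<and> \<xi> \<infinity> = \<infinity>")
    case True
    then have m: "m = \<infinity>" using subsequence unfolding doubling_subsequence_def by auto
    then have N: "N = {1..}" unfolding N_def by auto
    \<comment> \<open>An infinite subsequence is strictly increasing and hence passes every finite
      index; the index \<infinity> is excluded in this case.\<close>
    have "enat i \<le> js i" for i
    proof (induction i)
      case (Suc i)
      have "js i < js (Suc i)" using js_step(1)[of "Suc i"] N by simp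
      with Suc have "enat i < js (Suc i)" by simp
      then show ?case by (simp add: Suc_ile_eq)
    qed (simp add: zero_enat_def[symmetric])
    moreover obtain j' where "j = enat j'" using j True by (cases j) (auto simp: indices_def)
    moreover have "1 \<le> j'" using indexD(1)[OF j] \<open>j = enat j'\<close> by (simp add: one_enat_def)
    ultimately show ?thesis using N by auto
  next
    case False
    then obtain m' where m': "m = enat m'" "js m' = k" "js 0 = 0"
      using subsequence unfolding doubling_subsequence_def by auto
    then have "m' \<noteq> 0" using F_k(1) by (intro notI) simp
    then have "m' \<in> N" unfolding N_def using m' by simp
    then show ?thesis using m' indexD(2)[OF j] by (intro exI[of _ m']) simp
  qed
  define i where "i = (LEAST i. i \<in> N \<and> j \<le> js i)"
  have i: "i \<in> N" "j \<le> js i" using LeastI_ex[OF ex] by (auto simp: i_def)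
  have "js (i - 1) < j"
  proof (cases "i = 1")
    case True
    have "js 0 = 0" using subsequence by (simp add: doubling_subsequence_def)
    then show ?thesis using True less_le_trans[of 0 1 j] indexD(1)[OF j] by simp
  next
    case False
    then have "i - 1 \<in> N" using N_downward[OF i(1), of "i - 1"] i(1) by (auto simp: N_def)
    moreover have "i - 1 < i" using i(1) by (auto simp: N_def)
    ultimately show ?thesis using not_less_Least[of "i - 1" "\<lambda>i. i \<in> N \<and> j \<le> js i"] by (auto simp: i_def)
  qed
  have "s (js i) \<le> 2 * s j"
  proof (cases "j = js i")
    case True
    then show ?thesis using indexD(10)[OF j] by simp
  next
    case False
    then have "\<xi> (js i) < 2 * \<xi> j" using js_step(4)[OF i(1) \<open>js (i - 1) < j\<close>] i(2) by simp
    then have "ereal (s (js i)) < ereal (2 * s j)" using indexD(9)[OF j] indexD(9)[OF js_index[OF i(1)]] by simp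
    then show ?thesis by simp
  qed
  then show ?thesis using i by blast
qed

section \<open>Measurability, coverage and length of the selected interval\<close>

lemma ci_star_eq: "ci_star \<xi> k That j y = two_sided_ci (That j k y) (That k j y) (s j)"
  by (simp add: ci_star_def two_sided_ci_def s_def Let_def)

lemma length_ci_star:
  "j \<in> indices \<xi> k \<Longrightarrow> emeasure lborel (ci_star \<xi> k That j y) = ennreal (2 * max (That j k y - That k j y) 0 + 4 * s j)"
  unfolding ci_star_eq two_sided_ci_def using indexD(10)[of j] by (subst emeasure_lborel_Icc) auto

lemma ihat:
  assumes "y \<in> space (obs (base M))"
  shows "ihat y \<in> N" "i \<in> N \<Longrightarrow> emeasure lborel (CI y) \<le> emeasure lborel (ci_star \<xi> k That (js i) y)"
  using selector assms unfolding shortest_selector_def N_def adaptive_ci_def by auto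

lemma ihat_measurable: "ihat \<in> measurable (obs (base M)) (count_space N)"
proof (rule measurableI)
  fix A assume "A \<in> sets (count_space N)"
  have "ihat \<in> measurable (obs (base M)) (count_space UNIV)" using selector by (simp add: shortest_selector_def)
  then show "ihat -` A \<inter> space (obs (base M)) \<in> sets (obs (base M))" by (rule measurable_sets) simp
qed (simp add: ihat(1))

text \<open>The selector has countably many values, so an estimator evaluated at the selected
  position is a countable pasting of measurable functions.\<close>

lemma CI_measurable:
  "{y \<in> space (obs (base M)). x \<in> CI y} \<in> sets (obs (base M))"
  "(\<lambda>y. emeasure lborel (CI y)) \<in> borel_measurable (obs (base M))"
proof -
  have N: "countable N" by simp
  have a: "(\<lambda>y. That (js (ihat y)) k y) \<in> borel_measurable (obs (base M))"
    by (rule measurable_compose_countable'[OF _ ihat_measurable N]) (rule estimator_measurable(1)[OF js_index])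
  have b: "(\<lambda>y. That k (js (ihat y)) y) \<in> borel_measurable (obs (base M))"
    by (rule measurable_compose_countable'[OF _ ihat_measurable N, where f = "\<lambda>i y. That k (js i) y"])
      (rule estimator_measurable(2)[OF js_index])
  have c: "(\<lambda>y. s (js (ihat y))) \<in> borel_measurable (obs (base M))"
    by (rule measurable_compose_countable'[OF _ ihat_measurable N, where f = "\<lambda>i y. s (js i)"]) simp
  note [measurable] = a b c
  show "{y \<in> space (obs (base M)). x \<in> CI y} \<in> sets (obs (base M))"
    unfolding adaptive_ci_def ci_star_eq two_sided_ci_def atLeastAtMost_iff by measurable
  have "(\<lambda>y. ennreal (2 * max (That (js (ihat y)) k y - That k (js (ihat y)) y) 0 + 4 * s (js (ihat y)))) \<in> borel_measurable (obs (base M))"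
    by measurable
  then show "(\<lambda>y. emeasure lborel (CI y)) \<in> borel_measurable (obs (base M))"
    by (rule measurable_cong[THEN iffD2, rotated]) (simp add: adaptive_ci_def length_ci_star js_index ihat(1))
qed

lemma CI_coverage:
  assumes f: "f \<in> F k"
  shows "1 - \<alpha> \<le> measure (law M f) {y \<in> space (obs (base M)). T f \<in> CI y}"
proof -
  have f': "f \<in> L2 (base M)" using f F_k by blast
  interpret prob_space "law M f" by (rule family.prob[OF f'])
  note sp = law_space[OF f']
  have "prob {y \<in> space (law M f). T f \<notin> two_sided_ci (That (js (ihat y)) k y) (That k (js (ihat y)) y) (s (js (ihat y)))}
    \<le> 2 * \<Phi> (- z)"
  proof (rule adaptive_coverage[OF z(1,2) N_nonempty, where X = "\<lambda>i. That (js i) k" and Y = "\<lambda>i. That k (js i)" and s = "\<lambda>i. s (js i)" and ihat = ihat])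
    show "0 < s (js i)" if "i \<in> N" for i using indexD(10)[OF js_index[OF that]] .
    show "2 ^ (j - i) * s (js i) \<le> s (js j)" if "i \<in> N" "j \<in> N" "i \<le> j" for i j using s_doubling[OF that] .
    show "normal_tail (law M f) (\<lambda>y. p * That (js i) k y + q * That k (js i) y)" if "i \<in> N" for i p q
      using estimator_normal[OF js_index[OF that] f] .
    show "ihat y \<in> N" if "y \<in> space (law M f)" for y using ihat(1) that sp by simp
    show "max (That (js (ihat y)) k y - That k (js (ihat y)) y) 0 + 2 * s (js (ihat y))
        \<le> max (That (js i) k y - That k (js i) y) 0 + 2 * s (js i)"
      if y: "y \<in> space (law M f)" and i: "i \<in> N" for y i
    proof -
      have y': "y \<in> space (obs (base M))" using y sp by simp
      have "ennreal (2 * max (That (js (ihat y)) k y - That k (js (ihat y)) y) 0 + 4 * s (js (ihat y)))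
        \<le> ennreal (2 * max (That (js i) k y - That k (js i) y) 0 + 4 * s (js i))"
        using ihat(2)[OF y' i] length_ci_star[OF js_index[OF i]] length_ci_star[OF js_index[OF ihat(1)[OF y']]]
        by (simp add: adaptive_ci_def)
      then show ?thesis using indexD(10)[OF js_index[OF i]] by (subst (asm) ennreal_le_iff) auto
    qed
  qed (use estimator_bounds[OF js_index f] in \<open>auto simp: mean_def var_def\<close>)
  also have "{y \<in> space (law M f). T f \<notin> two_sided_ci (That (js (ihat y)) k y) (That k (js (ihat y)) y) (s (js (ihat y)))}
      = space (law M f) - {y \<in> space (obs (base M)). T f \<in> CI y}"
    unfolding sp adaptive_ci_def ci_star_eq by auto
  also have "prob \<dots> = 1 - prob {y \<in> space (obs (base M)). T f \<in> CI y}"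
    using CI_measurable(1) law_sets[OF f'] by (intro prob_compl) simp
  finally show ?thesis unfolding two_\<Phi>_z by simp
qed

lemma CI_conf_interval: "CI \<in> conf_intervals M T \<alpha> (F k)"
proof -
  have "is_interval (CI y)" for y
    unfolding adaptive_ci_def ci_star_eq two_sided_ci_def by (rule is_interval_cc)
  then show ?thesis unfolding conf_intervals_def using CI_measurable CI_coverage by auto
qed

text \<open>The selected interval is no longer than the one at \<open>js i\<close>. For a truth in
  \<open>F (js i)\<close> the mean of the difference of the two estimators is at most
  \<open>s (js i)\<close>. In units of \<open>s (js i)\<close>, the positive part contributes
  \<open>2 + 2 / z\<close> to the mean length and the fixed part 4; \<open>1 \<le> z\<close> makes
  the total at most 8.\<close>

lemma CI_length_subsequence:
  assumes i: "i \<in> N"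
  shows "max_length M CI (F (js i)) \<le> ennreal (8 * s (js i))"
  unfolding max_length_def
proof (rule SUP_least)
  note j = js_index[OF i]
  fix f assume fj: "f \<in> F (js i)"
  then have f: "f \<in> F k" using indexD(4)[OF j] by blast
  have f': "f \<in> L2 (base M)" using f F_k by blast
  interpret prob_space "law M f" by (rule family.prob[OF f'])
  let ?a = "That (js i) k" and ?b = "That k (js i)"
  note est = estimator_bounds[OF j f]
  have a: "normal_tail (law M f) ?a" and b: "normal_tail (law M f) ?b"
    using estimator_normal[OF j f, of 1 0] estimator_normal[OF j f, of 0 1] by simp_all
  note ai = normal_tailD[OF prob_space_axioms a] and bi = normal_tailD[OF prob_space_axioms b]
  have d: "normal_tail (law M f) (\<lambda>y. ?a y - ?b y)" using estimator_normal[OF j f, of 1 "-1"] by simp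
  note di = normal_tailD[OF prob_space_axioms d]
  have pos: "0 < s (js i)" by (rule indexD(10)[OF j])
  have "(\<integral>\<^sup>+ y. emeasure lborel (CI y) \<partial>law M f) \<le> (\<integral>\<^sup>+ y. ennreal (2 * max (?a y - ?b y) 0 + 4 * s (js i)) \<partial>law M f)"
    using ihat(2)[OF _ i] length_ci_star[OF j] by (intro nn_integral_mono) (auto simp: law_space[OF f'])
  also have "\<dots> \<le> ennreal (2 * s (js i) + 2 * (s (js i) / z) + 4 * s (js i))"
  proof (rule expectation_pos_part_le[OF di(2) di(4)])
    show "variance (\<lambda>y. ?a y - ?b y) \<le> (2 * (s (js i) / z))\<^sup>2"
      using variance_combination[OF a _ b, of "s (js i) / z" 1 "-1"] est(3,4) by (simp add: var_def mean_def)
    show "expectation (\<lambda>y. ?a y - ?b y) \<le> s (js i)"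
      using est(7,8)[OF fj] ai(2) bi(2) by (simp add: mean_def)
  qed (use pos z in auto)
  also have "\<dots> \<le> ennreal (8 * s (js i))"
  proof (rule ennreal_leI)
    have "s (js i) / z \<le> s (js i) / 1" using z pos by (intro divide_left_mono) auto
    then show "2 * s (js i) + 2 * (s (js i) / z) + 4 * s (js i) \<le> 8 * s (js i)" using pos by simp
  qed
  finally show "(\<integral>\<^sup>+ y. emeasure lborel (CI y) \<partial>law M f) \<le> ennreal (8 * s (js i))" .
qed

lemma CI_length:
  assumes j: "j \<in> indices \<xi> k"
  shows "max_length M CI (F j) \<le> ennreal (16 * s j)"
proof -
  obtain i where i: "i \<in> N" "j \<le> js i" "s (js i) \<le> 2 * s j" using js_cover[OF j] by blast
  have "F j \<subseteq> F (js i)" using nested indexD(1)[OF j] i(2) js_step(2)[OF i(1)] by (auto simp: nested_spaces_def)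
  then have "max_length M CI (F j) \<le> max_length M CI (F (js i))" unfolding max_length_def by (intro SUP_subset_mono) auto
  also have "\<dots> \<le> ennreal (8 * s (js i))" by (rule CI_length_subsequence[OF i(1)])
  also have "\<dots> \<le> ennreal (16 * s j)" using i(3) by (intro ennreal_leI) simp
  finally show ?thesis .
qed

text \<open>A confidence interval under \<open>f\<close> contains \<open>T f\<close> with probability \<open>1 - \<alpha>\<close>, and, since \<open>g\<close> cannot
  be distinguished well from \<open>f\<close>, it contains \<open>T g\<close> with probability at least \<open>1/2\<close>.\<close>

lemma length_lower_bound:
  assumes C: "C \<in> conf_intervals M T \<alpha> (F k)" and f: "f \<in> F k" and g: "g \<in> F k" and fG: "f \<in> G"
    and dist: "L2_dist (base M) f g \<le> z' / sqrt n"
  shows "ennreal (\<bar>T g - T f\<bar> * (1/2 - \<alpha>)) \<le> max_length M C G"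
proof -
  have f': "f \<in> L2 (base M)" and g': "g \<in> L2 (base M)" using f g F_k by auto
  interpret prob_space "law M f" by (rule family.prob[OF f'])
  note sp = law_space[OF f'] and st = law_sets[OF f']
  define A where "A = (\<lambda>h. {y \<in> space (obs (base M)). T h \<in> C y})"
  have As: "A h \<in> sets (obs (base M))" for h using C unfolding A_def conf_intervals_def by auto
  have As': "A h \<in> sets (PiM (space (base M)) (\<lambda>_. borel))" for h using As by (simp add: obs_def)
  \<comment> \<open>Coverage under \<open>g\<close> has level
    \<open>1 - \<alpha> = \<Phi> z'\<close>, and the normalised distance of \<open>f\<close> and
    \<open>g\<close> is at most \<open>z'\<close>; hence \<open>half_le_measure\<close> applies with
    \<open>t = z'\<close>.\<close>
  have "1/2 \<le> prob (A g)"
  proof (rule family.half_le_measure[OF f' g' As'])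
    show "sqrt (real n) * L2_dist (base M) f g \<le> z'" using dist n by (simp add: field_simps)
    show "\<Phi> z' \<le> measure (law M g) (A g)"
      using C g \<alpha> unfolding conf_intervals_def A_def by (simp add: \<Phi>_z_quantile)
  qed
  moreover have "1 - \<alpha> \<le> prob (A f)" using C f unfolding conf_intervals_def A_def by simp
  moreover have "prob (A f) + prob (A g) \<le> 1 + prob (A f \<inter> A g)"
  proof -
    have "prob (A f \<union> A g) = prob (A f) + prob (A g - A f)"
      using As st by (intro finite_measure_Union') auto
    moreover have "prob (A g - A f) = prob (A g) - prob (A g \<inter> A f)"
      using As st by (intro finite_measure_Diff') auto
    ultimately have "prob (A f \<union> A g) + prob (A f \<inter> A g) = prob (A f) + prob (A g)"
      by (simp add: Int_commute)
    then show ?thesis using prob_le_1[of "A f \<union> A g"] by linarith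
  qed
  ultimately have both: "1/2 - \<alpha> \<le> prob (A f \<inter> A g)" by linarith
  have len: "ennreal \<bar>T g - T f\<bar> \<le> emeasure lborel (C y)" if y: "y \<in> A f \<inter> A g" for y
  proof -
    have int: "is_interval (C y)" using C y unfolding conf_intervals_def A_def by auto
    have "{min (T f) (T g)..max (T f) (T g)} \<subseteq> C y"
      using int y unfolding is_interval_1 A_def by (auto simp: min_def max_def split: if_splits; blast)
    then have "emeasure lborel {min (T f) (T g)..max (T f) (T g)} \<le> emeasure lborel (C y)"
      using real_interval_borel_measurable[OF int] by (intro emeasure_mono) auto
    then show ?thesis by (simp add: min_def max_def abs_if split: if_splits)
  qed
  have "ennreal (\<bar>T g - T f\<bar> * (1/2 - \<alpha>)) \<le> ennreal \<bar>T g - T f\<bar> * emeasure (law M f) (A f \<inter> A g)"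
    using both \<alpha> by (simp add: emeasure_eq_measure flip: ennreal_mult) (intro ennreal_leI mult_left_mono; simp)
  also have "\<dots> = (\<integral>\<^sup>+ y. ennreal \<bar>T g - T f\<bar> * indicator (A f \<inter> A g) y \<partial>law M f)"
    using As st by (subst nn_integral_cmult_indicator) auto
  also have "\<dots> \<le> (\<integral>\<^sup>+ y. emeasure lborel (C y) \<partial>law M f)"
    using len by (intro nn_integral_mono) (auto simp: indicator_def)
  also have "\<dots> \<le> max_length M C G" unfolding max_length_def using fG by (intro SUP_upper)
  finally show ?thesis .
qed

text \<open>Shrinking \<open>f\<close> and \<open>g\<close> towards a common \<open>h\<close> in the smaller space by the factor \<open>z' / z\<close> brings them to
  the distance at which the previous lemma applies.\<close>

lemma minimax_lower_bound:
  assumes j: "j \<in> indices \<xi> k" and f: "f \<in> F j" and g: "g \<in> F k" and dist: "L2_dist (base M) f g \<le> noise n \<alpha>"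
  shows "ennreal (\<bar>T g - T f\<bar> * (z' / z) * (1/2 - \<alpha>)) \<le> minimax_length M T \<alpha> (F j) (F k)"
  unfolding minimax_length_def
proof (rule INF_greatest)
  fix C assume C: "C \<in> conf_intervals M T \<alpha> (F k)"
  define u where "u = z' / z"
  have u: "0 < u" "u < 1" using z z' by (auto simp: u_def)
  obtain h where h: "h \<in> F j" using indexD(3)[OF j] by blast
  define f1 where "f1 = (\<lambda>t. u * f t + (1 - u) * h t)"
  define g1 where "g1 = (\<lambda>t. u * g t + (1 - u) * h t)"
  have in_k: "f \<in> F k" "h \<in> F k" using f h indexD(4)[OF j] by auto
  have f1: "f1 \<in> F j" unfolding f1_def using indexD(6)[OF j] f h u unfolding convex_space_def by auto
  have g1: "g1 \<in> F k" unfolding g1_def using indexD(7)[OF j] g in_k u unfolding convex_space_def by auto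
  have T1: "T (\<lambda>t. u * e t + (1 - u) * h t) = u * T e + (1 - u) * T h" if "e \<in> F k" for e
    using functional that in_k unfolding linear_functional_on_def by blast
  have "T g1 - T f1 = u * (T g - T f)" unfolding f1_def g1_def using T1[OF g] T1[OF in_k(1)] by (simp add: algebra_simps)
  then have Tdiff: "\<bar>T g1 - T f1\<bar> = \<bar>T g - T f\<bar> * u" using u by (simp add: abs_mult)
  have "(L2_dist (base M) f1 g1) = u * L2_dist (base M) f g"
  proof -
    have "(\<lambda>t. (g1 t - f1 t)\<^sup>2) = (\<lambda>t. u\<^sup>2 * (g t - f t)\<^sup>2)"
      unfolding f1_def g1_def by (simp add: power2_eq_square algebra_simps)
    then show ?thesis unfolding L2_dist_def using u by (simp add: real_sqrt_mult)
  qed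
  also have "\<dots> \<le> u * noise n \<alpha>" using dist u by (intro mult_left_mono) auto
  also have "\<dots> = z' / sqrt n" using z by (simp add: u_def noise_def)
  finally have "L2_dist (base M) f1 g1 \<le> z' / sqrt n" .
  then have "ennreal (\<bar>T g1 - T f1\<bar> * (1/2 - \<alpha>)) \<le> max_length M C (F j)"
    using f1 g1 indexD(4)[OF j] by (intro length_lower_bound[OF C]) auto
  then show "ennreal (\<bar>T g - T f\<bar> * (z' / z) * (1/2 - \<alpha>)) \<le> max_length M C (F j)"
    unfolding Tdiff u_def by simp
qed

text \<open>The two-point bound controls \<open>\<bar>T g - T f\<bar>\<close>, so one estimate
  serves both orders of the spaces in \<open>modulus_plus\<close>.\<close>

lemma modulus_le_minimax:
  assumes j: "j \<in> indices \<xi> k" and L: "minimax_length M T \<alpha> (F j) (F k) = ennreal l" "0 \<le> l"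
  shows "s j \<le> l * z / ((1/2 - \<alpha>) * z')"
proof -
  have pos: "0 < (1/2 - \<alpha>) * z'" using \<alpha> z' by simp
  have *: "\<bar>T g - T f\<bar> \<le> l * z / ((1/2 - \<alpha>) * z')"
    if "f \<in> F j" "g \<in> F k" "L2_dist (base M) f g \<le> noise n \<alpha>" for f g
  proof -
    have "\<bar>T g - T f\<bar> * (z' / z) * (1/2 - \<alpha>) \<le> l"
      using minimax_lower_bound[OF j that] L by simp
    then show ?thesis using pos z(1) by (simp add: field_simps)
  qed
  have "modulus_plus M T (noise n \<alpha>) (F j) (F k) \<le> ereal (l * z / ((1/2 - \<alpha>) * z'))"
    unfolding modulus_plus_def modulus_def
  proof (intro max.boundedI Sup_least)
    fix x assume "x \<in> {ereal (T g - T f) |f g. L2_dist (base M) f g \<le> noise n \<alpha> \<and> f \<in> F j \<and> g \<in> F k}"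
    then show "x \<le> ereal (l * z / ((1/2 - \<alpha>) * z'))"
      using * by (force intro: order.trans[OF abs_ge_self])
  next
    fix x assume "x \<in> {ereal (T g - T f) |f g. L2_dist (base M) f g \<le> noise n \<alpha> \<and> f \<in> F k \<and> g \<in> F j}"
    then obtain f g where x: "x = ereal (T g - T f)" "L2_dist (base M) g f \<le> noise n \<alpha>" "f \<in> F k" "g \<in> F j"
      by (auto simp: L2_dist_commute)
    then show "x \<le> ereal (l * z / ((1/2 - \<alpha>) * z'))"
      using *[OF x(4,3,2)] by simp
  qed
  then show ?thesis unfolding indexD(8)[OF j, symmetric] indexD(9)[OF j] by simp
qed

lemma CI_length_minimax:
  assumes j: "j \<in> indices \<xi> k"
  shows "minimax_length M T \<alpha> (F j) (F k) \<le> max_length M CI (F j)"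
    "max_length M CI (F j) \<le> ennreal (16 * z / ((1/2 - \<alpha>) * z')) * minimax_length M T \<alpha> (F j) (F k)"
proof -
  show "minimax_length M T \<alpha> (F j) (F k) \<le> max_length M CI (F j)"
    unfolding minimax_length_def by (rule INF_lower[OF CI_conf_interval])
  have pos: "0 < 16 * z / ((1/2 - \<alpha>) * z')" using \<alpha> z z' by simp
  show "max_length M CI (F j) \<le> ennreal (16 * z / ((1/2 - \<alpha>) * z')) * minimax_length M T \<alpha> (F j) (F k)"
  proof (cases "minimax_length M T \<alpha> (F j) (F k)")
    case (real l)
    have "max_length M CI (F j) \<le> ennreal (16 * s j)" by (rule CI_length[OF j])
    also have "\<dots> \<le> ennreal (16 * (l * z / ((1/2 - \<alpha>) * z')))"
      using modulus_le_minimax[OF j real(2,1)] by (intro ennreal_leI mult_left_mono) auto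
    also have "16 * (l * z / ((1/2 - \<alpha>) * z')) = 16 * z / ((1/2 - \<alpha>) * z') * l" by simp
    also have "ennreal \<dots> = ennreal (16 * z / ((1/2 - \<alpha>) * z')) * ennreal l"
      using pos real by (intro ennreal_mult) auto
    finally show ?thesis using real by simp
  next
    case top
    \<comment> \<open>A zero factor would annihilate \<infinity>, so its positivity has to be
      checked.\<close>
    have "ennreal (16 * z / ((1/2 - \<alpha>) * z')) \<noteq> 0" using pos by (simp only: ennreal_eq_0_iff not_le)
    then have "ennreal (16 * z / ((1/2 - \<alpha>) * z')) * minimax_length M T \<alpha> (F j) (F k) = \<top>"
      unfolding top by (simp only: ennreal_mult_eq_top_iff) simp
    then show ?thesis by (simp only: top_greatest)
  qed
qed

lemma adaptive_ci_bounds: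
  "CI \<in> conf_intervals M T \<alpha> (F k) \<and>
   (\<forall>j \<in> indices \<xi> k.
      minimax_length M T \<alpha> (F j) (F k) \<le> max_length M CI (F j) \<and>
      max_length M CI (F j)
        \<le> ennreal (16 * z_quantile (\<alpha> / 2) / ((1/2 - \<alpha>) * z_quantile \<alpha>))
            * minimax_length M T \<alpha> (F j) (F k)) \<and>
   (\<forall>i. 1 \<le> i \<and> enat i \<le> m \<longrightarrow>
      enn2ereal (max_length M CI (F (js i)))
        \<le> 8 * modulus_plus M T (z_quantile (\<alpha> / 2) / sqrt (real n)) (F (js i)) (F k)) \<and>
   (\<forall>j \<in> indices \<xi> k.
      enn2ereal (max_length M CI (F j))
        \<le> 16 * modulus_plus M T (z_quantile (\<alpha> / 2) / sqrt (real n)) (F j) (F k))"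
proof (intro conjI ballI allI impI)
  have e: "enn2ereal x \<le> ereal c * modulus_plus M T (z_quantile (\<alpha> / 2) / sqrt (real n)) (F j) (F k)"
    if j: "j \<in> indices \<xi> k" and x: "x \<le> ennreal (c * s j)" and c: "0 \<le> c" for x j c
  proof -
    have "enn2ereal x \<le> enn2ereal (ennreal (c * s j))" using x by (simp add: less_eq_ennreal.rep_eq)
    also have "\<dots> = ereal (c * s j)" using c indexD(10)[OF j] by (intro enn2ereal_ennreal) simp
    also have "\<dots> = ereal c * modulus_plus M T (noise n \<alpha>) (F j) (F k)"
      unfolding indexD(8)[OF j, symmetric] indexD(9)[OF j] by simp
    finally show ?thesis by (simp add: noise_def)
  qed
  show "CI \<in> conf_intervals M T \<alpha> (F k)" by (rule CI_conf_interval)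
  show "minimax_length M T \<alpha> (F j) (F k) \<le> max_length M CI (F j)"
    "max_length M CI (F j) \<le> ennreal (16 * z_quantile (\<alpha> / 2) / ((1/2 - \<alpha>) * z_quantile \<alpha>)) * minimax_length M T \<alpha> (F j) (F k)"
    if "j \<in> indices \<xi> k" for j using CI_length_minimax[OF that] by auto
  show "enn2ereal (max_length M CI (F (js i))) \<le> 8 * modulus_plus M T (z_quantile (\<alpha> / 2) / sqrt (real n)) (F (js i)) (F k)"
    if "1 \<le> i \<and> enat i \<le> m" for i
    using e[of "js i" _ 8] js_index[of i] CI_length_subsequence[of i] that by (simp add: N_def)
  show "enn2ereal (max_length M CI (F j)) \<le> 16 * modulus_plus M T (z_quantile (\<alpha> / 2) / sqrt (real n)) (F j) (F k)"
    if "j \<in> indices \<xi> k" for j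
    using e[OF that CI_length[OF that]] by simp
qed

end

theorem theorem2:
  fixes n :: nat and \<alpha> :: real and k m :: enat and js :: "nat \<Rightarrow> enat"
  assumes "n > 0" and "0 < \<alpha>" and "\<alpha> \<le> 1/5"
  shows
    "(\<forall>(I :: 'i set) D T F That ihat.
        countable I \<longrightarrow>
        adaptive_ci_setting (sequence_model n I) n \<alpha> D T k F That m js ihat \<longrightarrow>
        (let M = sequence_model n I;
             \<xi> = xi M n \<alpha> T k F;
             CI = adaptive_ci \<xi> k That js ihat
         in CI \<in> conf_intervals M T \<alpha> (F k) \<and>
            (\<forall>j \<in> indices \<xi> k.
               minimax_length M T \<alpha> (F j) (F k) \<le> max_length M CI (F j) \<and>
               max_length M CI (F j)
                 \<le> ennreal (16 * z_quantile (\<alpha> / 2) / ((1/2 - \<alpha>) * z_quantile \<alpha>))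
                     * minimax_length M T \<alpha> (F j) (F k)) \<and>
            (\<forall>i. 1 \<le> i \<and> enat i \<le> m \<longrightarrow>
               enn2ereal (max_length M CI (F (js i)))
                 \<le> 8 * modulus_plus M T (z_quantile (\<alpha> / 2) / sqrt (real n)) (F (js i)) (F k)) \<and>
            (\<forall>j \<in> indices \<xi> k.
               enn2ereal (max_length M CI (F j))
                 \<le> 16 * modulus_plus M T (z_quantile (\<alpha> / 2) / sqrt (real n)) (F j) (F k))))
     \<and>
     (\<forall>(\<Omega> :: 'w measure) W D T F That ihat.
        brownian_motion \<Omega> W \<longrightarrow>
        adaptive_ci_setting (white_noise_model n \<Omega> W) n \<alpha> D T k F That m js ihat \<longrightarrow>
        (let M = white_noise_model n \<Omega> W;
             \<xi> = xi M n \<alpha> T k F;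
             CI = adaptive_ci \<xi> k That js ihat
         in CI \<in> conf_intervals M T \<alpha> (F k) \<and>
            (\<forall>j \<in> indices \<xi> k.
               minimax_length M T \<alpha> (F j) (F k) \<le> max_length M CI (F j) \<and>
               max_length M CI (F j)
                 \<le> ennreal (16 * z_quantile (\<alpha> / 2) / ((1/2 - \<alpha>) * z_quantile \<alpha>))
                     * minimax_length M T \<alpha> (F j) (F k)) \<and>
            (\<forall>i. 1 \<le> i \<and> enat i \<le> m \<longrightarrow>
               enn2ereal (max_length M CI (F (js i)))
                 \<le> 8 * modulus_plus M T (z_quantile (\<alpha> / 2) / sqrt (real n)) (F (js i)) (F k)) \<and>
            (\<forall>j \<in> indices \<xi> k.
               enn2ereal (max_length M CI (F j))
                 \<le> 16 * modulus_plus M T (z_quantile (\<alpha> / 2) / sqrt (real n)) (F j) (F k))))"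
proof (intro conjI allI impI, goal_cases)
  case (1 I D T F That ihat)
  have "adaptive_gaussian (sequence_model n I) n \<alpha> D T k F That m js ihat"
  proof (intro adaptive_gaussian.intro adaptive_gaussian_axioms.intro)
    show "adaptive_ci_setting (sequence_model n I) n \<alpha> D T k F That m js ihat" by (rule 1)
  qed (use assms gaussian_family_sequence[OF assms(1), of I] linear_limit_sequence[of _ n I]
      in \<open>simp_all only: sequence_model_def gaussian_model.simps space_count_space\<close>)
  then show ?case unfolding Let_def by (rule adaptive_gaussian.adaptive_ci_bounds)
next
  case (2 \<Omega> W D T F That ihat)
  have "adaptive_gaussian (white_noise_model n \<Omega> W) n \<alpha> D T k F That m js ihat"
  proof (intro adaptive_gaussian.intro adaptive_gaussian_axioms.intro)
    show "adaptive_ci_setting (white_noise_model n \<Omega> W) n \<alpha> D T k F That m js ihat" by (rule 2)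
    have "space (lebesgue_on unit_interval) = unit_interval" by simp
    then show "gaussian_family (space (base (white_noise_model n \<Omega> W))) (L2 (base (white_noise_model n \<Omega> W)))
        (law (white_noise_model n \<Omega> W)) (\<lambda>f g. sqrt n * L2_dist (base (white_noise_model n \<Omega> W)) f g)"
      using gaussian_family_white_noise[OF assms(1) 2(1)]
      by (simp only: white_noise_model_def gaussian_model.simps)
    show "linear_limit (space (base (white_noise_model n \<Omega> W))) (law (white_noise_model n \<Omega> W) f) X"
      if "X \<in> linear_estimators (white_noise_model n \<Omega> W)" "f \<in> L2 (base (white_noise_model n \<Omega> W))" for X f
      using linear_limit_white_noise[of X n \<Omega> W f] that \<open>space (lebesgue_on unit_interval) = unit_interval\<close>
      by (simp only: white_noise_model_def gaussian_model.simps)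
  qed (use assms in auto)
  then show ?case unfolding Let_def by (rule adaptive_gaussian.adaptive_ci_bounds)
qed

end
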